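(* Let $\alpha^{(0)},\beta^{(0)}\in\mathbb{C}$ be fixed, and let $$x_n = A^{(0)}(B^{(0)})^n\,\frac{\sigma(z_0+nz)}{\sigma(z)^{n^2}}$$ be the solution of the Somos-4 recurrence $x_{n+4}x_n=\alpha^{(0)}x_{n+3}x_{n+1}+\beta^{(0)}x_{n+2}^2$ with four non-zero initial values $x_0,x_1,x_2,x_3$, and let $J^{(0)}$ be the corresponding value of its first integral. Then the Somos-4 shadow equation $$x_n y_{n+4} - \alpha^{(0)} x_{n+1}y_{n+3}-2\beta^{(0)}x_{n+2}y_{n+2} - \alpha^{(0)} x_{n+3}y_{n+1} +x_{n+4}y_n = 0$$ has four linearly independent solutions, given by $$y_n^{(i)}=x_n,\qquad y_n^{(ii)}=n\,x_n,\qquad y_n^{(iii)}=x_n\,\zeta(z_0+nz),$$ $$y_n^{(iv)}=x_n\,\partial_{J^{(0)}}\log x_n = x_n\left(\frac{\mathrm{d}z}{\mathrm{d}J^{(0)}}\,\partial_z+\frac{\mathrm{d}g_2}{\mathrm{d}J^{(0)}}\,\partial_{g_2}+\frac{\mathrm{d}g_3}{\mathrm{d}J^{(0)}}\,\partial_{g_3}\right)\log x_n .$$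
   Context: $\sigma(\cdot)=\sigma(\cdot\,;g_2,g_3)$, $\zeta(\cdot)=\zeta(\cdot\,;g_2,g_3)$, $\wp(\cdot)=\wp(\cdot\,;g_2,g_3)$ are the Weierstrass functions of the curve $\mathrm{y}^2=4\mathrm{x}^3-g_2\mathrm{x}-g_3$ (when $g_2^3-27g_3^2=0$ the formula for $x_n$ is understood in terms of the trigonometric/rational limits of the sigma function), and $A^{(0)},B^{(0)}\in\mathbb{C}^*$. The general solution of the initial value problem for the Somos-4 recurrence over $\mathbb{C}$ with non-zero initial values has the stated sigma-function form. The first integral is $$J^{(0)} = \frac{x_n^2x_{n+3}^2 +\alpha^{(0)}(x_{n+1}^3x_{n+3}+x_nx_{n+2}^3) +\beta^{(0)}x_{n+1}^2x_{n+2}^2}{x_nx_{n+1}x_{n+2}x_{n+3}},$$ which does not depend on $n$. For fixed $\alpha^{(0)},\beta^{(0)}$, the quantities $z,g_2,g_3$ vary with $J^{(0)}$ according to $$\alpha^{(0)}=\wp'(z)^2,\qquad \frac{\beta^{(0)}}{\alpha^{(0)}}=\wp(2z)-\wp(z),\qquad J^{(0)}=\wp''(z);$$ explicitly $g_2=12\lambda^2-2J^{(0)}$, $g_3=4\lambda^3-g_2\lambda-\alpha^{(0)}$ and $\wp(z)=\lambda$, with $\lambda=\frac{1}{3\alpha^{(0)}}\big(\frac{(J^{(0)})^2}{4}-\beta^{(0)}\big)$. Thus, for fixed $\alpha^{(0)},\beta^{(0)}$, $x_n$ depends on the four arbitrary parameters $A^{(0)},B^{(0)},z_0,J^{(0)}$;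 $\partial_{J^{(0)}}$ is the derivative with $A^{(0)},B^{(0)},z_0$ held fixed, while $\partial_z,\partial_{g_2},\partial_{g_3}$ are the partial derivatives of the formula for $x_n$ in $z,g_2,g_3$. *)

theory Defs
  imports "HOL-Complex_Analysis.Complex_Analysis"
begin

text \<open>
  The Weierstrass functions of the curve $y^2 = 4x^3 - g_2 x - g_3$, for arbitrary complex
  $g_2, g_3$.  The function $\wp$ is the meromorphic function on the complex plane that
  has a pole at the origin and parametrises the curve by $(\wp, \wp')$.  It is unique, because
  the equation determines every Laurent coefficient at a pole.  The functions $\zeta$ and
  $\sigma$ are then given by $\zeta' = -\wp$, $\zeta(u) - 1/u \to 0$ and
  $\sigma'/\sigma = \zeta$, $\sigma(u)/u \to 1$ as $u \to 0$.

  If $g_2^3 \neq 27 g_3^2$, these are the elliptic functions of the period lattice of the curve.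
  If $g_2^3 = 27 g_3^2$, they are the trigonometric or rational limits, e.g.
  $\wp = u^{-2}$, $\zeta = u^{-1}$, $\sigma = u$ for $g_2 = g_3 = 0$.

  As usual for nicely meromorphic functions, $\wp$ and $\zeta$ have the dummy value 0 at poles.
\<close>

definition weierstrass_p :: "complex \<Rightarrow> complex \<Rightarrow> complex \<Rightarrow> complex" where
  "weierstrass_p g2 g3 = (THE p. p nicely_meromorphic_on UNIV \<and> is_pole p 0 \<and>
     (\<forall>u. \<not> is_pole p u \<longrightarrow> (deriv p u)\<^sup>2 = 4 * (p u) ^ 3 - g2 * p u - g3))"

definition weierstrass_zeta :: "complex \<Rightarrow> complex \<Rightarrow> complex \<Rightarrow> complex" where
  "weierstrass_zeta g2 g3 = (THE f. f nicely_meromorphic_on UNIV \<and>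
     (\<forall>u. \<not> is_pole (weierstrass_p g2 g3) u \<longrightarrow>
        (f has_field_derivative - weierstrass_p g2 g3 u) (at u)) \<and>
     ((\<lambda>u. f u - 1 / u) \<longlongrightarrow> 0) (at 0))"

definition weierstrass_sigma :: "complex \<Rightarrow> complex \<Rightarrow> complex \<Rightarrow> complex" where
  "weierstrass_sigma g2 g3 = (THE s. s holomorphic_on UNIV \<and>
     (\<forall>u. \<not> is_pole (weierstrass_p g2 g3) u \<longrightarrow>
        (s has_field_derivative s u * weierstrass_zeta g2 g3 u) (at u)) \<and>
     ((\<lambda>u. s u / u) \<longlongrightarrow> 1) (at 0))"

definition somos4 :: "complex \<Rightarrow> complex \<Rightarrow> (int \<Rightarrow> complex) \<Rightarrow> bool" where
  "somos4 \<alpha> \<beta> x \<longleftrightarrow>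
     (\<forall>n. x (n + 4) * x n = \<alpha> * x (n + 3) * x (n + 1) + \<beta> * (x (n + 2))\<^sup>2)"

definition somos4_shadow ::
    "complex \<Rightarrow> complex \<Rightarrow> (int \<Rightarrow> complex) \<Rightarrow> (int \<Rightarrow> complex) \<Rightarrow> bool" where
  "somos4_shadow \<alpha> \<beta> x y \<longleftrightarrow>
     (\<forall>n. x n * y (n + 4) - \<alpha> * x (n + 1) * y (n + 3) - 2 * \<beta> * x (n + 2) * y (n + 2)
          - \<alpha> * x (n + 3) * y (n + 1) + x (n + 4) * y n = 0)"

definition somos4_integral ::
    "complex \<Rightarrow> complex \<Rightarrow> (int \<Rightarrow> complex) \<Rightarrow> int \<Rightarrow> complex" where
  "somos4_integral \<alpha> \<beta> x n =
     ((x n)\<^sup>2 * (x (n + 3))\<^sup>2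
      + \<alpha> * ((x (n + 1)) ^ 3 * x (n + 3) + x n * (x (n + 2)) ^ 3)
      + \<beta> * (x (n + 1))\<^sup>2 * (x (n + 2))\<^sup>2)
     / (x n * x (n + 1) * x (n + 2) * x (n + 3))"

definition somos4_sol ::
    "complex \<Rightarrow> complex \<Rightarrow> complex \<Rightarrow> complex \<Rightarrow> complex \<Rightarrow> complex \<Rightarrow> int \<Rightarrow> complex" where
  "somos4_sol A B z0 z g2 g3 n =
     A * B powi n * weierstrass_sigma g2 g3 (z0 + of_int n * z)
       / weierstrass_sigma g2 g3 z powi (n\<^sup>2)"

definition somos4_lam :: "complex \<Rightarrow> complex \<Rightarrow> complex \<Rightarrow> complex" where
  "somos4_lam \<alpha> \<beta> J = 1 / (3 * \<alpha>) * (J\<^sup>2 / 4 - \<beta>)"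

definition somos4_g2 :: "complex \<Rightarrow> complex \<Rightarrow> complex \<Rightarrow> complex" where
  "somos4_g2 \<alpha> \<beta> J = 12 * (somos4_lam \<alpha> \<beta> J)\<^sup>2 - 2 * J"

definition somos4_g3 :: "complex \<Rightarrow> complex \<Rightarrow> complex \<Rightarrow> complex" where
  "somos4_g3 \<alpha> \<beta> J =
     4 * (somos4_lam \<alpha> \<beta> J) ^ 3 - somos4_g2 \<alpha> \<beta> J * somos4_lam \<alpha> \<beta> J - \<alpha>"

text \<open>
  The parameter $z$ attached to $\alpha, \beta, J$.  The condition on $\sigma$ says that $z$ is
  not a pole of $\wp$; it excludes the dummy values at poles and makes the formula for $x_n$
  meaningful.
\<close>

definition somos4_param :: "complex \<Rightarrow> complex \<Rightarrow> complex \<Rightarrow> complex \<Rightarrow> bool" where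
  "somos4_param \<alpha> \<beta> J z \<longleftrightarrow>
     (let \<P> = weierstrass_p (somos4_g2 \<alpha> \<beta> J) (somos4_g3 \<alpha> \<beta> J) in
        weierstrass_sigma (somos4_g2 \<alpha> \<beta> J) (somos4_g3 \<alpha> \<beta> J) z \<noteq> 0 \<and>
        \<P> z = somos4_lam \<alpha> \<beta> J \<and>
        \<alpha> = (deriv \<P> z)\<^sup>2 \<and>
        \<beta> / \<alpha> = \<P> (2 * z) - \<P> z \<and>
        J = deriv (deriv \<P>) z)"

text \<open>
  The equation $\wp(z) = \lambda$ determines $z$ only up to sign and periods, so the dependence
  of $z$ on $J$ is a local holomorphic branch through the given value of $z$.
\<close>

definition somos4_branch ::
    "complex \<Rightarrow> complex \<Rightarrow> complex \<Rightarrow> complex \<Rightarrow> (complex \<Rightarrow> complex) \<Rightarrow> bool" where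
  "somos4_branch \<alpha> \<beta> J0 z Z \<longleftrightarrow>
     Z analytic_on {J0} \<and> Z J0 = z \<and> (\<forall>\<^sub>F J in nhds J0. somos4_param \<alpha> \<beta> J (Z J))"

text \<open>The derivative of $\log f$, which is independent of the branch of the logarithm.\<close>

definition dlog :: "(complex \<Rightarrow> complex) \<Rightarrow> complex \<Rightarrow> complex" where
  "dlog f t = deriv f t / f t"

text \<open>
  Although the initial values are non-zero, $x_n$ may vanish for other $n$.  There, the products
  $x_n\,\zeta(z_0+nz)$ and $x_n\,\partial\log x_n$ have a removable singularity as functions of
  $z_0$ and are given by their continuous extension.
\<close>

definition shadow_iii ::
    "complex \<Rightarrow> complex \<Rightarrow> complex \<Rightarrow> complex \<Rightarrow> complex \<Rightarrow> complex \<Rightarrow> int \<Rightarrow> complex" where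
  "shadow_iii A B z0 z g2 g3 n =
     (let y = (\<lambda>w. somos4_sol A B w z g2 g3 n * weierstrass_zeta g2 g3 (w + of_int n * z))
      in if somos4_sol A B z0 z g2 g3 n \<noteq> 0 then y z0 else Lim (at z0) y)"

definition shadow_iv ::
    "complex \<Rightarrow> complex \<Rightarrow> complex \<Rightarrow> complex \<Rightarrow> complex \<Rightarrow> complex \<Rightarrow> (complex \<Rightarrow> complex) \<Rightarrow> int \<Rightarrow> complex"
  where
  "shadow_iv \<alpha> \<beta> J0 A B z0 Z n =
     (let X = (\<lambda>w J. somos4_sol A B w (Z J) (somos4_g2 \<alpha> \<beta> J) (somos4_g3 \<alpha> \<beta> J) n);
          y = (\<lambda>w. X w J0 * dlog (X w) J0)
      in if X z0 J0 \<noteq> 0 then y z0 else Lim (at z0) y)"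

definition shadow_iv_chain ::
    "complex \<Rightarrow> complex \<Rightarrow> complex \<Rightarrow> complex \<Rightarrow> complex \<Rightarrow> complex \<Rightarrow> (complex \<Rightarrow> complex) \<Rightarrow> int \<Rightarrow> complex"
  where
  "shadow_iv_chain \<alpha> \<beta> J0 A B z0 Z n =
     (let z = Z J0; g2 = somos4_g2 \<alpha> \<beta> J0; g3 = somos4_g3 \<alpha> \<beta> J0;
          y = (\<lambda>w. somos4_sol A B w z g2 g3 n *
                 (deriv Z J0 * dlog (\<lambda>t. somos4_sol A B w t g2 g3 n) z
                  + deriv (somos4_g2 \<alpha> \<beta>) J0 * dlog (\<lambda>t. somos4_sol A B w z t g3 n) g2
                  + deriv (somos4_g3 \<alpha> \<beta>) J0 * dlog (\<lambda>t. somos4_sol A B w z g2 t n) g3))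
      in if somos4_sol A B z0 z g2 g3 n \<noteq> 0 then y z0 else Lim (at z0) y)"

text \<open>
  Linear independence over the complex numbers of the restrictions to $n \ge 0$, and hence also
  of the bi-infinite sequences.
\<close>

definition lin_indep4 ::
    "(int \<Rightarrow> complex) \<Rightarrow> (int \<Rightarrow> complex) \<Rightarrow> (int \<Rightarrow> complex) \<Rightarrow> (int \<Rightarrow> complex) \<Rightarrow> bool" where
  "lin_indep4 y1 y2 y3 y4 \<longleftrightarrow>
     (\<forall>c1 c2 c3 c4. (\<forall>n\<ge>0. c1 * y1 n + c2 * y2 n + c3 * y3 n + c4 * y4 n = 0) \<longrightarrow>
        c1 = 0 \<and> c2 = 0 \<and> c3 = 0 \<and> c4 = 0)"

end

theory Submission
  imports Defs
begin

text \<open>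
  For arbitrary $g_2, g_3$, the recursion for the Laurent coefficients of $\wp$ at the origin gives a
  local solution of the differential equation, and integrating twice gives $\sigma$ near the origin.
  With $N(u,v) = \sigma(u)^2 \sigma(v)^2 (\wp(v) - \wp(u))$, the differential equation says that
  $\log N$ has vanishing mixed derivative in $a = u + v$ and $b = u - v$, so that $N$ factors as
  $\sigma(a) \sigma(b)$.  The limit $v \to u$ is a duplication formula, which extends $\sigma$
  to an entire function of $u$, holomorphic in $g_2, g_3$ as well.

  The addition formula yields the Somos-4 recurrence and the value $J$ of its first integral for every
  parameter $(z_0, J)$.  The solutions (iii) and (iv) of the shadow equation are the derivatives of
  $x_n$ with respect to $z_0$ and $J$.  Linear independence is visible on $n = 0, 1, 2, 3$:
  differentiating the first integral shows that (iv) does not occur in a linear relation, and if (iii)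
  did occur, then $z_0 + z$ and $z_0 + 2z$ would be half periods, which contradicts $\alpha \neq 0$.
\<close>

subsection \<open>Holomorphic functions of three complex variables\<close>

text \<open>Every property is therefore drawn from the differential equation, and periods enter only
  as zeros of \<sigma>, which are closed under differences. The extension to all u rests on one
  feature of the duplication formula: \<sigma>(2u) is a polynomial in derivatives of \<sigma> at u.
  Having no denominators, it doubles the domain without creating poles. The second obstacle is that
  x_n may vanish outside 0, ..., 3, and that \<wp> and \<zeta> carry dummy values at poles. Hence
  the central identities use the numerator of \<wp> and derivatives of \<sigma>, and (iii), (iv) are
  replaced by formulas that are continuous in z_0. Finally, z is given by J only implicitly, so a
  holomorphic branch has to be produced. The derivative that must not vanish there is \<wp>'(z), and
  \<alpha> = \<wp>'(z)^2 turns this into \<alpha> \<noteq> 0.\<close>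

lemma continuous_on_deriv_param:
  fixes f :: "complex \<Rightarrow> 'p::metric_space \<Rightarrow> complex"
  assumes "open D" and cont: "continuous_on D (\<lambda>(u, p). f u p)"
    and diff: "\<And>u p. (u, p) \<in> D \<Longrightarrow> (\<lambda>x. f x p) field_differentiable at u"
  shows "continuous_on D (\<lambda>(u, p). deriv (\<lambda>x. f x p) u)"
  unfolding continuous_on_eq_continuous_at[OF \<open>open D\<close>]
proof
  fix q assume "q \<in> D"
  obtain u0 p0 where q: "q = (u0, p0)" by (cases q)
  obtain A B where AB: "open A" "open B" "(u0, p0) \<in> A \<times> B" "A \<times> B \<subseteq> D"
    using open_prod_elim[OF \<open>open D\<close>] \<open>q \<in> D\<close> q by metis
  obtain R where R: "R > 0" "cball u0 R \<subseteq> A"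
    using AB open_contains_cball by (metis mem_Sigma_iff)
  \<comment> \<open>Halving leaves room for a disc of radius \<open>r\<close> around every
    \<open>u\<close> in \<open>ball u0 r\<close>. On these discs Cauchy's inequality turns uniform
    closeness of the functions for \<open>p\<close> and \<open>p0\<close> into closeness of their
    derivatives.\<close>
  define r where "r = R / 2"
  have r: "r > 0" using R by (simp add: r_def)
  have hol: "(\<lambda>x. f x p) holomorphic_on A" if "p \<in> B" for p
    using that AB by (intro holomorphic_onI field_differentiable_at_within[OF diff]) auto
  show "isCont (\<lambda>(u, p). deriv (\<lambda>x. f x p) u) q"
    unfolding isCont_def q prod.case
  proof (rule tendstoI)
    fix e :: real assume e: "e > 0"
    have "continuous_on (B \<times> cball u0 R) (\<lambda>(p, u). f u p)"
    proof -
      have "continuous_on (prod.swap ` (cball u0 R \<times> B)) ((\<lambda>(u, p). f u p) \<circ> prod.swap)"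
        using AB R(2) by (intro continuous_on_compose continuous_on_swap continuous_on_subset[OF cont])
          (use Sigma_mono[of "cball u0 R" A "\<lambda>_. B" "\<lambda>_. B"] in \<open>auto simp: image_comp o_def\<close>)
      thus ?thesis by (simp add: product_swap o_def case_prod_unfold)
    qed
    then obtain X0 where X0: "p0 \<in> X0" "open X0"
      "\<forall>p\<in>X0 \<inter> B. \<forall>u\<in>cball u0 R. dist (f u p) (f u p0) \<le> e * r / 2"
      using continuous_on_prod_compactE[of B "cball u0 R" "\<lambda>(p, u). f u p" p0 "e * r / 2"] e r AB
      by auto
    have 1: "norm (deriv (\<lambda>x. f x p) u - deriv (\<lambda>x. f x p0) u) \<le> e / 2"
      if "u \<in> ball u0 r" "p \<in> X0 \<inter> B" for u p
    proof -
      have sub: "cball u r \<subseteq> cball u0 R" "cball u r \<subseteq> A" "u \<in> A"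
      proof -
        show *: "cball u r \<subseteq> cball u0 R"
        proof
          fix x assume "x \<in> cball u r"
          moreover have "dist u0 x \<le> dist u0 u + dist u x" by (rule dist_triangle)
          ultimately show "x \<in> cball u0 R" using that(1) by (simp add: r_def)
        qed
        show "cball u r \<subseteq> A" "u \<in> A" using *[THEN subset_trans[OF _ R(2)]] r by auto
      qed
      have h: "(\<lambda>x. f x p - f x p0) holomorphic_on A"
        using that AB by (intro holomorphic_intros hol) auto
      have "norm ((deriv ^^ 1) (\<lambda>x. f x p - f x p0) u) \<le> fact 1 * (e * r / 2) / r ^ 1"
      proof (rule Cauchy_inequality)
        show "(\<lambda>x. f x p - f x p0) holomorphic_on ball u r"
          using sub by (intro holomorphic_on_subset[OF h]) auto
        show "continuous_on (cball u r) (\<lambda>x. f x p - f x p0)"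
          using sub by (intro holomorphic_on_imp_continuous_on holomorphic_on_subset[OF h]) auto
        show "norm (f x p - f x p0) \<le> e * r / 2" if "norm (u - x) = r" for x
        proof -
          have "x \<in> cball u r" using that by (simp add: dist_norm)
          thus ?thesis using X0(3) sub \<open>p \<in> X0 \<inter> B\<close> by (auto simp: dist_norm)
        qed
      qed (use r in auto)
      moreover have "deriv (\<lambda>x. f x p - f x p0) u = deriv (\<lambda>x. f x p) u - deriv (\<lambda>x. f x p0) u"
        using hol[of p] hol[of p0] that sub AB
        by (intro deriv_diff) (auto simp: holomorphic_on_imp_differentiable_at)
      ultimately show ?thesis using r by simp
    qed
    have "isCont (deriv (\<lambda>x. f x p0)) u0"
      using holomorphic_deriv[OF hol[of p0] AB(1)] AB
      by (meson continuous_on_eq_continuous_at holomorphic_on_imp_continuous_on mem_Sigma_iff)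
    hence "\<forall>\<^sub>F u in nhds u0. dist (deriv (\<lambda>x. f x p0) u) (deriv (\<lambda>x. f x p0) u0) < e / 2"
      using e unfolding isCont_def tendsto_at_iff_tendsto_nhds by (intro tendstoD) auto
    hence "\<forall>\<^sub>F v in nhds u0 \<times>\<^sub>F nhds p0. dist (deriv (\<lambda>x. f x p0) (fst v)) (deriv (\<lambda>x. f x p0) u0) < e / 2
             \<and> fst v \<in> ball u0 r \<and> snd v \<in> X0 \<inter> B"
    proof (intro eventually_conj)
      show "\<forall>\<^sub>F v in nhds u0 \<times>\<^sub>F nhds p0. fst v \<in> ball u0 r"
        by (rule eventually_compose_filterlim[OF eventually_nhds_in_open filterlim_fst]) (use r in auto)
      show "\<forall>\<^sub>F v in nhds u0 \<times>\<^sub>F nhds p0. snd v \<in> X0 \<inter> B"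
        by (rule eventually_compose_filterlim[OF eventually_nhds_in_open filterlim_snd]) (use X0 AB in auto)
    qed (erule eventually_compose_filterlim[OF _ filterlim_fst])
    hence "\<forall>\<^sub>F v in nhds (u0, p0). dist (deriv (\<lambda>x. f x (snd v)) (fst v)) (deriv (\<lambda>x. f x p0) u0) < e"
      unfolding nhds_prod
    proof eventually_elim
      case (elim v)
      with 1[of "fst v" "snd v"] have "norm (deriv (\<lambda>x. f x (snd v)) (fst v) - deriv (\<lambda>x. f x p0) (fst v)) \<le> e / 2"
        by auto
      with elim show ?case
        by (smt (verit) dist_norm dist_triangle field_sum_of_halves)
    qed
    thus "\<forall>\<^sub>F v in at (u0, p0). dist (case v of (u, p) \<Rightarrow> deriv (\<lambda>x. f x p) u) (deriv (\<lambda>x. f x p0) u0) < e"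
      by (auto simp: eventually_at_filter case_prod_unfold elim: eventually_mono)
  qed
qed

text \<open>The difference quotients in the first variable are holomorphic in the second and
  converge uniformly on a closed disc, so Weierstrass's theorem applies to their limit. Uniformity
  comes from the joint continuity of the partial derivative and the mean value inequality.\<close>

lemma holomorphic_deriv_param:
  fixes f :: "complex \<Rightarrow> complex \<Rightarrow> complex"
  assumes "open D" and cont: "continuous_on D (\<lambda>(u, v). f u v)"
    and du: "\<And>u v. (u, v) \<in> D \<Longrightarrow> (\<lambda>x. f x v) field_differentiable at u"
    and dv: "\<And>u v. (u, v) \<in> D \<Longrightarrow> f u field_differentiable at v"
    and "(u0, v0) \<in> D"
  shows "(\<lambda>v. deriv (\<lambda>x. f x v) u0) field_differentiable at v0"
proof -
  obtain A B where AB: "open A" "open B" "(u0, v0) \<in> A \<times> B" "A \<times> B \<subseteq> D"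
    using open_prod_elim[OF \<open>open D\<close>] \<open>(u0, v0) \<in> D\<close> by metis
  obtain r s where rs: "r > 0" "ball u0 r \<subseteq> A" "s > 0" "cball v0 s \<subseteq> B"
    using AB open_contains_cball open_contains_ball by (metis mem_Sigma_iff)
  have cd: "continuous_on (ball u0 r \<times> cball v0 s) (\<lambda>(u, v). deriv (\<lambda>x. f x v) u)"
    using AB rs by (intro continuous_on_subset[OF continuous_on_deriv_param[OF assms(1-3)]]) auto
  have hv: "f x holomorphic_on B" if "x \<in> A" for x
    using AB that by (intro holomorphic_onI field_differentiable_at_within[OF dv]) auto
  let ?q = "\<lambda>x v. (f x v - f u0 v) / (x - u0)"
  have ev: "\<forall>\<^sub>F x in at u0. x \<in> ball u0 r" 
    using rs by (intro eventually_at_in_open') auto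
  have "uniform_limit (cball v0 s) ?q (\<lambda>v. deriv (\<lambda>x. f x v) u0) (at u0)"
  proof (rule uniform_limitI)
    fix e :: real assume e: "e > 0"
    obtain X0 where X0: "u0 \<in> X0" "open X0"
      "\<forall>x\<in>X0 \<inter> ball u0 r. \<forall>v\<in>cball v0 s. dist (deriv (\<lambda>x. f x v) x) (deriv (\<lambda>x. f x v) u0) \<le> e / 2"
      using continuous_on_prod_compactE[OF cd, of u0 "e / 2"] e rs by auto
    obtain d where d: "d > 0" "ball u0 d \<subseteq> X0 \<inter> ball u0 r"
      using X0 rs open_contains_ball[of "X0 \<inter> ball u0 r"] by (metis IntI centre_in_ball open_Int open_ball)
    have "\<forall>\<^sub>F x in at u0. x \<in> ball u0 d \<and> x \<noteq> u0"
      using d by (auto simp: eventually_at_filter intro!: eventually_conj eventually_mono[OF eventually_nhds_in_open[of "ball u0 d"]])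
    thus "\<forall>\<^sub>F x in at u0. \<forall>v\<in>cball v0 s. dist (?q x v) (deriv (\<lambda>x. f x v) u0) < e"
    proof eventually_elim
      case (elim x)
      show ?case
      proof
        fix v assume v: "v \<in> cball v0 s"
        let ?c = "deriv (\<lambda>x. f x v) u0"
        have "norm ((f x v - ?c * x) - (f u0 v - ?c * u0)) \<le> e / 2 * norm (x - u0)"
        proof (rule field_differentiable_bound[of "ball u0 d"])
          fix y assume y: "y \<in> ball u0 d"
          have "(\<lambda>x. f x v) field_differentiable at y"
            using y d v AB rs by (intro du) blast
          hence "((\<lambda>x. f x v) has_field_derivative deriv (\<lambda>x. f x v) y) (at y within ball u0 d)"
            by (simp add: DERIV_deriv_iff_field_differentiable has_field_derivative_at_within)
          thus "((\<lambda>x. f x v - ?c * x) has_field_derivative deriv (\<lambda>x. f x v) y - ?c) (at y within ball u0 d)"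
            by (auto intro!: derivative_eq_intros)
          have "y \<in> X0 \<inter> ball u0 r" using y d by blast
          with X0(3) v show "norm (deriv (\<lambda>x. f x v) y - ?c) \<le> e / 2"
            unfolding dist_norm by blast
        qed (use elim d in auto)
        moreover have "(f x v - ?c * x) - (f u0 v - ?c * u0) = (?q x v - ?c) * (x - u0)"
          using elim by (simp add: field_simps)
        ultimately have "norm (?q x v - ?c) \<le> e / 2"
          using elim by (simp add: norm_mult)
        thus "dist (?q x v) ?c < e" using e by (simp add: dist_norm)
      qed
    qed
  qed
  moreover have "\<forall>\<^sub>F x in at u0. continuous_on (cball v0 s) (?q x) \<and> ?q x holomorphic_on ball v0 s"
    using ev
  proof eventually_elim
    case (elim x)
    have "?q x holomorphic_on B"
    proof (cases "x = u0")
      case False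
      thus ?thesis using elim rs AB by (intro holomorphic_intros hv) auto
    qed auto
    thus ?case using rs
      by (meson ball_subset_cball holomorphic_on_imp_continuous_on holomorphic_on_subset)
  qed
  ultimately have "(\<lambda>v. deriv (\<lambda>x. f x v) u0) holomorphic_on ball v0 s"
    by (elim holomorphic_uniform_limit[rotated]) auto
  thus ?thesis by (rule holomorphic_on_imp_differentiable_at) (use rs in auto)
qed

text \<open>The parameter moves together with the argument, so the derivative at a fixed parameter
  does not suffice. The difference quotient \<open>q\<close>, completed by the partial derivative at
  \<open>u = u0\<close>, is continuous at \<open>(u0, p0)\<close> in both variables; this replaces a
  total derivative in the chain rule.\<close>

lemma tendsto_diff_quotient_param:
  fixes f :: "complex \<Rightarrow> 'p::metric_space \<Rightarrow> complex"
  assumes "open D" and "continuous_on D (\<lambda>(u, p). f u p)"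
    and diff: "\<And>u p. (u, p) \<in> D \<Longrightarrow> (\<lambda>x. f x p) field_differentiable at u"
    and inD: "(a t0, p t0) \<in> D"
    and a: "(a has_field_derivative a') (at t0)" and p: "isCont p t0"
  shows "((\<lambda>t. (f (a t) (p t) - f (a t0) (p t)) / (t - t0)) \<longlongrightarrow>
           a' * deriv (\<lambda>x. f x (p t0)) (a t0)) (at t0)"
proof -
  define u0 p0 c where "u0 = a t0" and "p0 = p t0" and "c = deriv (\<lambda>x. f x p0) u0"
  define q where "q = (\<lambda>(u, p). if u = u0 then deriv (\<lambda>x. f x p) u0 else (f u p - f u0 p) / (u - u0))"
  have q: "(q \<longlongrightarrow> c) (nhds (u0, p0))"
  proof (rule tendstoI)
    fix e :: real assume e: "e > 0"
    have "isCont (\<lambda>(u, p). deriv (\<lambda>x. f x p) u) (u0, p0)"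
      using continuous_on_deriv_param[OF assms(1-3)] inD \<open>open D\<close>
      by (simp add: continuous_on_eq_continuous_at u0_def p0_def)
    hence "\<forall>\<^sub>F v in nhds (u0, p0). dist (case v of (u, p) \<Rightarrow> deriv (\<lambda>x. f x p) u) c < e / 2"
      using e tendstoD[of "\<lambda>(u, p). deriv (\<lambda>x. f x p) u" c "nhds (u0, p0)" "e / 2"]
      unfolding isCont_def tendsto_at_iff_tendsto_nhds c_def by auto
    moreover have "\<forall>\<^sub>F v in nhds (u0, p0). v \<in> D"
      using inD \<open>open D\<close> by (intro eventually_nhds_in_open) (auto simp: u0_def p0_def)
    ultimately have "\<forall>\<^sub>F v in nhds (u0, p0). dist (case v of (u, p) \<Rightarrow> deriv (\<lambda>x. f x p) u) c < e / 2 \<and> v \<in> D"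
      by (rule eventually_conj)
    then obtain S where S: "open S" "(u0, p0) \<in> S" "\<forall>v\<in>S. dist (case v of (u, p) \<Rightarrow> deriv (\<lambda>x. f x p) u) c < e / 2 \<and> v \<in> D"
      unfolding eventually_nhds by blast
    obtain A B where AB: "open A" "open B" "(u0, p0) \<in> A \<times> B" "A \<times> B \<subseteq> S"
      using open_prod_elim[OF S(1,2)] by metis
    obtain r where r: "r > 0" "ball u0 r \<subseteq> A" using AB open_contains_ball by (metis mem_Sigma_iff)
    have "\<forall>\<^sub>F v in nhds (u0, p0). v \<in> ball u0 r \<times> B"
      using AB r by (intro eventually_nhds_in_open open_Times) auto
    thus "\<forall>\<^sub>F v in nhds (u0, p0). dist (q v) c < e"
    proof eventually_elim
      case (elim v)
      obtain u p where v: "v = (u, p)" "u \<in> ball u0 r" "p \<in> B" using elim by auto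
      have in_S: "(y, p) \<in> S" if "y \<in> ball u0 r" for y using that v AB r by blast
      have "norm ((f u p - c * u) - (f u0 p - c * u0)) \<le> e / 2 * norm (u - u0)"
      proof (rule field_differentiable_bound[of "ball u0 r"])
        fix y assume y: "y \<in> ball u0 r"
        have "(\<lambda>x. f x p) field_differentiable at y"
          using in_S[OF y] S by (intro diff) blast
        hence "((\<lambda>x. f x p) has_field_derivative deriv (\<lambda>x. f x p) y) (at y within ball u0 r)"
          by (simp add: DERIV_deriv_iff_field_differentiable has_field_derivative_at_within)
        thus "((\<lambda>x. f x p - c * x) has_field_derivative deriv (\<lambda>x. f x p) y - c) (at y within ball u0 r)"
          by (auto intro!: derivative_eq_intros)
        show "norm (deriv (\<lambda>x. f x p) y - c) \<le> e / 2"
          using S(3) in_S[OF y] by (force simp: dist_norm)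
      qed (use v r in auto)
      moreover have "(f u p - c * u) - (f u0 p - c * u0) = (q v - c) * (u - u0)" if "u \<noteq> u0"
        using that v by (simp add: field_simps q_def)
      ultimately have "norm (q v - c) \<le> e / 2" if "u \<noteq> u0"
        using that by (simp add: norm_mult)
      moreover have "norm (q v - c) \<le> e / 2" if "u = u0"
        using S(3) in_S[of u] v that by (force simp: q_def dist_norm)
      ultimately show ?case using e by (force simp: dist_norm)
    qed
  qed
  have "((\<lambda>t. (a t, p t)) \<longlongrightarrow> (u0, p0)) (at t0)"
    using a p by (intro tendsto_Pair) (auto simp: u0_def p0_def isCont_def dest: DERIV_isCont)
  hence "((\<lambda>t. q (a t, p t)) \<longlongrightarrow> c) (at t0)"
    by (rule filterlim_compose[OF q])
  moreover have "((\<lambda>t. (a t - a t0) / (t - t0)) \<longlongrightarrow> a') (at t0)"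
    using a by (simp add: has_field_derivative_iff)
  ultimately have "((\<lambda>t. (a t - a t0) / (t - t0) * q (a t, p t)) \<longlongrightarrow> a' * c) (at t0)"
    by (intro tendsto_mult)
  moreover have "(a t - a t0) / (t - t0) * q (a t, p t) = (f (a t) (p t) - f (a t0) (p t)) / (t - t0)" for t
    by (auto simp: q_def u0_def)
  ultimately show ?thesis unfolding c_def p0_def u0_def by (simp only:)
qed

section \<open>Joint holomorphy, tested on complex lines\<close>

lemma field_differentiable_cong_nhds:
  assumes "\<forall>\<^sub>F x in nhds z. f x = g x" "f field_differentiable at z"
  shows "g field_differentiable at z"
  using assms DERIV_cong_ev[OF refl assms(1) refl] by (auto simp: field_differentiable_def)

text \<open>Joint holomorphy expressed by one-variable notions: continuity together with
  differentiability along every complex line. Uniform limits and derivatives then reduce to theorems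
  on a disc in such a line. The curried form matches the arguments g2, g3, u of the sigma
  function.\<close>

definition holo3 :: "(complex \<times> complex \<times> complex) set \<Rightarrow>
    (complex \<Rightarrow> complex \<Rightarrow> complex \<Rightarrow> complex) \<Rightarrow> bool" where
  "holo3 D f \<longleftrightarrow> open D \<and> continuous_on D (\<lambda>(x, y, z). f x y z) \<and>
     (\<forall>x y z a b c. (x, y, z) \<in> D \<longrightarrow>
        (\<lambda>h. f (x + h * a) (y + h * b) (z + h * c)) field_differentiable at 0)"

lemma holo3_const: "open D \<Longrightarrow> holo3 D (\<lambda>x y z. k)"
  by (auto simp: holo3_def case_prod_unfold)

lemma holo3_proj:
  assumes "open D"
  shows "holo3 D (\<lambda>x y z. x)" "holo3 D (\<lambda>x y z. y)" "holo3 D (\<lambda>x y z. z)"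
  using assms by (auto simp: holo3_def case_prod_unfold intro!: continuous_intros derivative_intros)

lemma holo3_add: "holo3 D f \<Longrightarrow> holo3 D g \<Longrightarrow> holo3 D (\<lambda>x y z. f x y z + g x y z)"
  by (auto simp: holo3_def case_prod_unfold intro!: continuous_intros derivative_intros)

lemma holo3_diff: "holo3 D f \<Longrightarrow> holo3 D g \<Longrightarrow> holo3 D (\<lambda>x y z. f x y z - g x y z)"
  by (auto simp: holo3_def case_prod_unfold intro!: continuous_intros derivative_intros)

lemma holo3_mult: "holo3 D f \<Longrightarrow> holo3 D g \<Longrightarrow> holo3 D (\<lambda>x y z. f x y z * g x y z)"
  by (auto simp: holo3_def case_prod_unfold intro!: continuous_intros derivative_intros)

lemma holo3_power:
  assumes "holo3 D f"
  shows "holo3 D (\<lambda>x y z. f x y z ^ n)"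
proof (induction n)
  case 0
  show ?case using assms holo3_const[of D 1] by (simp add: holo3_def)
next
  case (Suc n)
  from holo3_mult[OF assms this] show ?case by simp
qed

lemma holo3_exp:
  assumes "holo3 D f"
  shows "holo3 D (\<lambda>x y z. exp (f x y z))"
  unfolding holo3_def
proof (intro conjI allI impI)
  show "open D" using assms by (simp add: holo3_def)
  show "continuous_on D (\<lambda>(x, y, z). exp (f x y z))"
    using assms continuous_on_exp[of D "\<lambda>(x, y, z). f x y z"] by (simp add: holo3_def case_prod_unfold)
  fix x y z a b c assume "(x, y, z) \<in> D"
  hence "(\<lambda>h. f (x + h * a) (y + h * b) (z + h * c)) field_differentiable at 0"
    using assms by (simp add: holo3_def)
  from field_differentiable_compose[OF this field_differentiable_within_exp[of _ UNIV]]
  show "(\<lambda>h. exp (f (x + h * a) (y + h * b) (z + h * c))) field_differentiable at 0"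
    by (simp add: o_def)
qed

lemma holo3_sum: "open D \<Longrightarrow> (\<And>i. i \<in> I \<Longrightarrow> holo3 D (f i)) \<Longrightarrow> holo3 D (\<lambda>x y z. \<Sum>i\<in>I. f i x y z)"
  by (induction I rule: infinite_finite_induct) (auto intro: holo3_const holo3_add)

lemma holo3_subset: "holo3 D f \<Longrightarrow> E \<subseteq> D \<Longrightarrow> open E \<Longrightarrow> holo3 E f"
  by (auto simp: holo3_def intro: continuous_on_subset)

lemma holo3_Union: "(\<And>D. D \<in> \<D> \<Longrightarrow> holo3 D f) \<Longrightarrow> holo3 (\<Union>\<D>) f"
  by (auto simp: holo3_def intro!: continuous_on_open_Union)

lemma eventually_line_in_open:
  fixes D :: "(complex \<times> complex \<times> complex) set"
  assumes "open D" "(x, y, z) \<in> D"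
  shows "\<forall>\<^sub>F h in nhds 0. (x + h * a, y + h * b, z + h * c) \<in> D"
proof -
  have "open ((\<lambda>h. (x + h * a, y + h * b, z + h * c)) -` D)"
    by (intro open_vimage assms continuous_intros)
  from eventually_nhds_in_open[OF this, of 0] show ?thesis using assms by simp
qed

lemma holo3_cong:
  assumes "holo3 D f" "\<And>x y z. (x, y, z) \<in> D \<Longrightarrow> f x y z = g x y z"
  shows "holo3 D g"
  unfolding holo3_def
proof (intro conjI allI impI)
  show "open D" using assms by (simp add: holo3_def)
  show "continuous_on D (\<lambda>(x, y, z). g x y z)"
    using assms by (auto simp: holo3_def cong: continuous_on_cong_simp elim!: continuous_on_eq)
  fix x y z a b c assume *: "(x, y, z) \<in> D"
  have "\<forall>\<^sub>F h in nhds 0. f (x + h * a) (y + h * b) (z + h * c) = g (x + h * a) (y + h * b) (z + h * c)"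
    using eventually_line_in_open[OF \<open>open D\<close> *, of a b c] by eventually_elim (rule assms)
  moreover have "(\<lambda>h. f (x + h * a) (y + h * b) (z + h * c)) field_differentiable at 0"
    using assms * by (auto simp: holo3_def)
  ultimately show "(\<lambda>h. g (x + h * a) (y + h * b) (z + h * c)) field_differentiable at 0"
    by (rule field_differentiable_cong_nhds)
qed

lemma holo3_line:
  assumes "holo3 D f" "(x + h0 * a, y + h0 * b, z + h0 * c) \<in> D"
  shows "(\<lambda>h. f (x + h * a) (y + h * b) (z + h * c)) field_differentiable at h0"
proof -
  have *: "(\<lambda>h. f ((x + h0 * a) + h * a) ((y + h0 * b) + h * b) ((z + h0 * c) + h * c)) field_differentiable at (h0 - h0)"
    using assms by (simp add: holo3_def)
  have "(\<lambda>h. f ((x + h0 * a) + (h - h0) * a) ((y + h0 * b) + (h - h0) * b) ((z + h0 * c) + (h - h0) * c))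
          field_differentiable at h0"
    using field_differentiable_compose[of "\<lambda>h. h - h0" h0 "\<lambda>h. f (x + h0 * a + h * a) (y + h0 * b + h * b) (z + h0 * c + h * c)"] *
    by (simp add: o_def field_differentiable_diff)
  thus ?thesis by (simp add: algebra_simps)
qed

lemma holo3_partials:
  assumes "holo3 D f" "(x, y, z) \<in> D"
  shows "(\<lambda>t. f t y z) field_differentiable at x" "(\<lambda>t. f x t z) field_differentiable at y"
    "f x y field_differentiable at z"
  using holo3_line[OF assms(1), of 0 x 1 y 0 z 0] holo3_line[OF assms(1), of x y 0 0 1 z 0]
    holo3_line[OF assms(1), of x z 0 y 0 0 1] assms(2) by simp_all

text \<open>On a closed disc of a complex line inside \<open>D\<close> this is the one-variable
  theorem of Weierstrass.\<close>

lemma holo3_uniform_limit: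
  assumes "open D" "\<And>n. holo3 D (f n)"
    and lim: "uniform_limit D (\<lambda>n (x, y, z). f n x y z) (\<lambda>(x, y, z). g x y z) sequentially"
  shows "holo3 D g"
  unfolding holo3_def
proof (intro conjI allI impI)
  show "open D" by fact
  show "continuous_on D (\<lambda>(x, y, z). g x y z)"
  proof (rule uniform_limit_theorem[OF _ lim])
    show "\<forall>\<^sub>F n in sequentially. continuous_on D (\<lambda>(x, y, z). f n x y z)"
      using assms(2) unfolding holo3_def by (intro always_eventually allI) blast
  qed simp
  fix x y z a b c assume *: "(x, y, z) \<in> D"
  let ?l = "\<lambda>h. (x + h * a, y + h * b, z + h * c)"
  obtain d where d: "d > 0" "\<And>h. dist h 0 < d \<Longrightarrow> ?l h \<in> D"
    using eventually_line_in_open[OF \<open>open D\<close> *, of a b c] unfolding eventually_nhds_metric by metis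
  define r where "r = d / 2"
  have r: "r > 0" "\<And>h. h \<in> cball 0 r \<Longrightarrow> ?l h \<in> D"
    using d by (auto simp: r_def)
  let ?F = "\<lambda>n h. f n (x + h * a) (y + h * b) (z + h * c)"
  let ?G = "\<lambda>h. g (x + h * a) (y + h * b) (z + h * c)"
  have hol: "?F n holomorphic_on cball 0 r" for n
  proof (rule holomorphic_onI)
    fix h :: complex assume "h \<in> cball 0 r"
    hence "?l h \<in> D" by (rule r)
    thus "?F n field_differentiable at h within cball 0 r"
      by (rule field_differentiable_at_within[OF holo3_line[OF assms(2)]])
  qed
  have "uniform_limit (cball 0 r) ?F ?G sequentially"
  proof (rule uniform_limitI)
    fix e :: real assume "e > 0"
    from uniform_limitD[OF lim this]
    show "\<forall>\<^sub>F n in sequentially. \<forall>h\<in>cball 0 r. dist (?F n h) (?G h) < e"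
    proof eventually_elim
      case (elim n)
      show ?case
      proof
        fix h :: complex assume "h \<in> cball 0 r"
        hence "?l h \<in> D" by (rule r)
        with elim show "dist (?F n h) (?G h) < e" by fastforce
      qed
    qed
  qed
  then obtain "?G holomorphic_on ball 0 r"
    using hol holomorphic_on_imp_continuous_on[OF hol] holomorphic_on_subset[OF hol ball_subset_cball]
    by (elim holomorphic_uniform_limit[rotated]) (auto intro: always_eventually)
  thus "?G field_differentiable at 0"
    by (rule holomorphic_on_imp_differentiable_at) (use r in auto)
qed

lemma open_permute3:
  fixes D :: "(complex \<times> complex \<times> complex) set"
  assumes "open D"
  shows "open {(z, x, y). (x, y, z) \<in> D}" "open {(y, x, z). (x, y, z) \<in> D}"
proof -
  have "open ((\<lambda>(z, x, y). (x, y, z)) -` D)" "open ((\<lambda>(y, x, z). (x, y, z)) -` D)"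
    by (intro open_vimage assms continuous_intros, simp add: case_prod_unfold, intro continuous_intros)+
  thus "open {(z, x, y). (x, y, z) \<in> D}" "open {(y, x, z). (x, y, z) \<in> D}"
    by (simp_all add: vimage_def case_prod_unfold)
qed

lemma continuous_on_permute3:
  fixes f :: "complex \<Rightarrow> complex \<Rightarrow> complex \<Rightarrow> complex"
  assumes "continuous_on D (\<lambda>(x, y, z). f x y z)"
  shows "continuous_on {(z, x, y). (x, y, z) \<in> D} (\<lambda>(z, x, y). f x y z)"
    "continuous_on {(y, x, z). (x, y, z) \<in> D} (\<lambda>(y, x, z). f x y z)"
    "continuous_on {(x, y, z). (z, x, y) \<in> D} (\<lambda>(x, y, z). f z x y)"
    "continuous_on {(x, y, z). (y, x, z) \<in> D} (\<lambda>(x, y, z). f y x z)"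
proof -
  have *: "continuous_on A (\<lambda>p. f (fst (\<phi> p)) (fst (snd (\<phi> p))) (snd (snd (\<phi> p))))"
    if "continuous_on A \<phi>" "\<phi> ` A \<subseteq> D" for \<phi> and A :: "(complex \<times> complex \<times> complex) set"
    using continuous_on_compose2[OF assms that] by (simp add: case_prod_unfold)
  show "continuous_on {(z, x, y). (x, y, z) \<in> D} (\<lambda>(z, x, y). f x y z)"
  proof -
    have "continuous_on {(z, x, y). (x, y, z) \<in> D} (\<lambda>p. (fst (snd p), snd (snd p), fst p))"
      by (intro continuous_intros)
    from *[OF this] show ?thesis by (auto simp: case_prod_unfold)
  qed
  show "continuous_on {(y, x, z). (x, y, z) \<in> D} (\<lambda>(y, x, z). f x y z)"
  proof -
    have "continuous_on {(y, x, z). (x, y, z) \<in> D} (\<lambda>p. (fst (snd p), fst p, snd (snd p)))"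
      by (intro continuous_intros)
    from *[OF this] show ?thesis by (auto simp: case_prod_unfold)
  qed
  show "continuous_on {(x, y, z). (z, x, y) \<in> D} (\<lambda>(x, y, z). f z x y)"
  proof -
    have "continuous_on {(x, y, z). (z, x, y) \<in> D} (\<lambda>p. (snd (snd p), fst p, fst (snd p)))"
      by (intro continuous_intros)
    from *[OF this] show ?thesis by (auto simp: case_prod_unfold)
  qed
  show "continuous_on {(x, y, z). (y, x, z) \<in> D} (\<lambda>(x, y, z). f y x z)"
  proof -
    have "continuous_on {(x, y, z). (y, x, z) \<in> D} (\<lambda>p. (fst (snd p), fst p, snd (snd p)))"
      by (intro continuous_intros)
    from *[OF this] show ?thesis by (auto simp: case_prod_unfold)
  qed
qed

text \<open>For continuity, the coordinates are permuted so that the differentiated variable comes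
  first. For differentiability along a line, the line and the third axis span a two-parameter family
  \<open>?F u v\<close>; differentiating in \<open>u\<close> at 0 leaves a function of
  \<open>v\<close> covered by \<open>holomorphic_deriv_param\<close>.\<close>

lemma holo3_deriv:
  assumes "holo3 D f"
  shows "holo3 D (\<lambda>x y z. deriv (f x y) z)"
  unfolding holo3_def
proof (intro conjI allI impI)
  show "open D" using assms by (simp add: holo3_def)
  have "continuous_on {(z, x, y). (x, y, z) \<in> D} (\<lambda>(z, p). deriv (\<lambda>t. f (fst p) (snd p) t) z)"
    using assms holo3_partials(3)[OF assms] continuous_on_permute3(1)[of D f]
    by (intro continuous_on_deriv_param open_permute3) (auto simp: holo3_def case_prod_unfold)
  from continuous_on_permute3(3)[of "{(z, x, y). (x, y, z) \<in> D}" "\<lambda>z x y. deriv (\<lambda>t. f x y t) z"] this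
  show "continuous_on D (\<lambda>(x, y, z). deriv (f x y) z)"
    by (simp add: case_prod_unfold)
  fix x y z a b c assume *: "(x, y, z) \<in> D"
  let ?l = "\<lambda>v. (x + snd v * a, y + snd v * b, z + fst v + snd v * c)"
  let ?F = "\<lambda>u v. f (x + v * a) (y + v * b) (z + u + v * c)"
  have "(\<lambda>v. deriv (\<lambda>u. ?F u v) 0) field_differentiable at 0"
  proof (rule holomorphic_deriv_param)
    show "open (?l -` D)"
      using \<open>open D\<close> by (intro open_vimage continuous_intros)
    have "continuous_on (?l -` D) ((\<lambda>(x, y, z). f x y z) \<circ> ?l)"
      using assms by (intro continuous_on_compose continuous_intros) (auto simp: holo3_def elim!: continuous_on_subset)
    thus "continuous_on (?l -` D) (\<lambda>(u, v). ?F u v)" by (simp add: o_def case_prod_unfold)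
    show "(\<lambda>u. ?F u v) field_differentiable at u" if "(u, v) \<in> ?l -` D" for u v
      using holo3_line[OF assms, of "x + v * a" u 0 "y + v * b" 0 "z + v * c" 1] that
      by (simp add: algebra_simps)
    show "?F u field_differentiable at v" if "(u, v) \<in> ?l -` D" for u v
      using holo3_line[OF assms, of x v a y b "z + u" c] that by simp
    show "(0, 0) \<in> ?l -` D" using * by simp
  qed
  moreover have "\<forall>\<^sub>F v in nhds 0. deriv (\<lambda>u. ?F u v) 0 = deriv (f (x + v * a) (y + v * b)) (z + v * c)"
    using eventually_line_in_open[OF \<open>open D\<close> *, of a b c]
  proof eventually_elim
    case (elim v)
    have "(f (x + v * a) (y + v * b) has_field_derivative deriv (f (x + v * a) (y + v * b)) (z + v * c)) 
           (at (z + 0 + v * c))"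
      using holo3_partials(3)[OF assms elim] by (simp add: DERIV_deriv_iff_field_differentiable)
    hence "((\<lambda>u. ?F u v) has_field_derivative deriv (f (x + v * a) (y + v * b)) (z + v * c) * 1) (at 0)"
      by (intro DERIV_chain2[where f = "f (x + v * a) (y + v * b)"]) (auto intro!: derivative_eq_intros)
    thus ?case by (simp add: DERIV_imp_deriv)
  qed
  ultimately show "(\<lambda>h. deriv (f (x + h * a) (y + h * b)) (z + h * c)) field_differentiable at 0"
    by (rule field_differentiable_cong_nhds[rotated])
qed

lemma holo3_continuous_partials:
  assumes "holo3 D f"
  shows "continuous_on D (\<lambda>(x, y, z). deriv (\<lambda>t. f t y z) x)"
    "continuous_on D (\<lambda>(x, y, z). deriv (\<lambda>t. f x t z) y)"
proof -
  have "continuous_on D (\<lambda>(x, p). deriv (\<lambda>t. f t (fst p) (snd p)) x)"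
    using assms holo3_partials(1)[OF assms]
    by (intro continuous_on_deriv_param) (auto simp: holo3_def case_prod_unfold)
  thus "continuous_on D (\<lambda>(x, y, z). deriv (\<lambda>t. f t y z) x)" by (simp add: case_prod_unfold)
  have "continuous_on {(y, x, z). (x, y, z) \<in> D} (\<lambda>(y, p). deriv (\<lambda>t. f (fst p) t (snd p)) y)"
    using assms holo3_partials(2)[OF assms] continuous_on_permute3(2)[of D f]
    by (intro continuous_on_deriv_param open_permute3) (auto simp: holo3_def case_prod_unfold)
  from continuous_on_permute3(4)[of "{(y, x, z). (x, y, z) \<in> D}" "\<lambda>y x z. deriv (\<lambda>t. f x t z) y"] this
  show "continuous_on D (\<lambda>(x, y, z). deriv (\<lambda>t. f x t z) y)"
    by (simp add: case_prod_unfold)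
qed

text \<open>The increment is telescoped by freezing one argument after the other at
  \<open>t0\<close>. In the first two differences the later arguments still move with
  \<open>t\<close>, which is what \<open>tendsto_diff_quotient_param\<close> allows.\<close>

lemma holo3_chain:
  assumes f: "holo3 D f" and "(a t0, b t0, c t0) \<in> D"
    and a: "(a has_field_derivative a') (at t0)"
    and b: "(b has_field_derivative b') (at t0)"
    and c: "(c has_field_derivative c') (at t0)"
  shows "((\<lambda>t. f (a t) (b t) (c t)) has_field_derivative
           a' * deriv (\<lambda>x. f x (b t0) (c t0)) (a t0) + b' * deriv (\<lambda>y. f (a t0) y (c t0)) (b t0)
           + c' * deriv (f (a t0) (b t0)) (c t0)) (at t0)"
proof -
  have [simp]: "isCont b t0" "isCont c t0" using b c DERIV_isCont by blast+
  have "open D" and cont: "continuous_on D (\<lambda>(x, y, z). f x y z)" using f by (auto simp: holo3_def)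
  have 1: "((\<lambda>t. (f (a t) (b t) (c t) - f (a t0) (b t) (c t)) / (t - t0)) \<longlongrightarrow>
             a' * deriv (\<lambda>x. f x (b t0) (c t0)) (a t0)) (at t0)"
    using tendsto_diff_quotient_param[of D "\<lambda>x p. f x (fst p) (snd p)" a t0 "\<lambda>t. (b t, c t)" a']
      \<open>open D\<close> cont holo3_partials(1)[OF f] a assms(2)
    by (simp add: case_prod_unfold)
  have 2: "((\<lambda>t. (f (a t0) (b t) (c t) - f (a t0) (b t0) (c t)) / (t - t0)) \<longlongrightarrow>
             b' * deriv (\<lambda>y. f (a t0) y (c t0)) (b t0)) (at t0)"
    using tendsto_diff_quotient_param[of "{(y, x, z). (x, y, z) \<in> D}" "\<lambda>y p. f (fst p) y (snd p)" b t0 "\<lambda>t. (a t0, c t)" b']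
      open_permute3(2)[OF \<open>open D\<close>] continuous_on_permute3(2)[OF cont] holo3_partials(2)[OF f] b assms(2)
    by (simp add: case_prod_unfold)
  have 3: "((\<lambda>t. (f (a t0) (b t0) (c t) - f (a t0) (b t0) (c t0)) / (t - t0)) \<longlongrightarrow>
             c' * deriv (\<lambda>z. f (a t0) (b t0) z) (c t0)) (at t0)"
    using tendsto_diff_quotient_param[of "{(z, x, y). (x, y, z) \<in> D}" "\<lambda>z p. f (fst p) (snd p) z" c t0 "\<lambda>t. (a t0, b t0)" c']
      open_permute3(1)[OF \<open>open D\<close>] continuous_on_permute3(1)[OF cont] holo3_partials(3)[OF f] c assms(2)
    by (simp add: case_prod_unfold)
  from tendsto_add[OF tendsto_add[OF 1 2] 3] show ?thesis
    unfolding has_field_derivative_iff by (simp add: diff_divide_distrib)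
qed

subsection \<open>The Laurent coefficients of the Weierstrass function\<close>

text \<open>The coefficient of $u^{2k+2}$ in $\wp(u)$.\<close>
fun wp_coeff :: "complex \<Rightarrow> complex \<Rightarrow> nat \<Rightarrow> complex" where
  "wp_coeff g2 g3 k =
     (if k = 0 then g2 / 20 else if k = 1 then g3 / 28
      else 3 / ((2 * of_nat k + 5) * (of_nat k - 1)) *
        (\<Sum>i\<le>k-2. wp_coeff g2 g3 i * wp_coeff g2 g3 (k - 2 - i)))"

declare wp_coeff.simps [simp del]

text \<open>The bound respects the grading in which g2, g3 and the k-th coefficient have weights 2,
  3 and k + 2; the constants 20 and 28 are the denominators of the first two coefficients. In the
  recursion there are k - 1 products, each at most \<rho>^(k+2), and the prefactor leaves 3/(2k+5),
  which is below 1.\<close>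

lemma norm_wp_coeff_le:
  assumes "\<rho> \<ge> 0" "norm g2 \<le> 20 * \<rho> ^ 2" "norm g3 \<le> 28 * \<rho> ^ 3"
  shows "norm (wp_coeff g2 g3 k) \<le> \<rho> ^ (k + 2)"
proof (induction k rule: less_induct)
  case (less k)
  consider "k = 0" | "k = 1" | "k \<ge> 2" by linarith
  thus ?case
  proof cases
    case 3
    have "norm (\<Sum>i\<le>k-2. wp_coeff g2 g3 i * wp_coeff g2 g3 (k - 2 - i)) \<le> (\<Sum>i\<le>k-2. \<rho> ^ (k + 2))"
    proof (rule order.trans[OF norm_sum], rule sum_mono)
      fix i assume i: "i \<in> {..k-2}"
      have "norm (wp_coeff g2 g3 i * wp_coeff g2 g3 (k - 2 - i)) \<le> \<rho> ^ (i + 2) * \<rho> ^ (k - 2 - i + 2)"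
        unfolding norm_mult using i 3 assms(1) by (intro mult_mono less.IH) auto
      also have "\<dots> = \<rho> ^ (k + 2)"
      proof -
        have "i + 2 + (k - 2 - i + 2) = k + 2" using i 3 by auto
        thus ?thesis by (metis power_add)
      qed
      finally show "norm (wp_coeff g2 g3 i * wp_coeff g2 g3 (k - 2 - i)) \<le> \<rho> ^ (k + 2)" .
    qed
    also have "\<dots> = (real k - 1) * \<rho> ^ (k + 2)"
      using 3 by (simp add: of_nat_diff)
    finally have sum: "norm (\<Sum>i\<le>k-2. wp_coeff g2 g3 i * wp_coeff g2 g3 (k - 2 - i)) \<le> (real k - 1) * \<rho> ^ (k + 2)" .
    have nk: "norm (3 / ((2 * of_nat k + 5) * (of_nat k - 1)) :: complex) = 3 / ((2 * real k + 5) * (real k - 1))"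
    proof -
      have "(3 / ((2 * of_nat k + 5) * (of_nat k - 1)) :: complex) = of_real (3 / ((2 * real k + 5) * (real k - 1)))"
        by simp
      also have "norm \<dots> = 3 / ((2 * real k + 5) * (real k - 1))"
        using 3 by (subst norm_of_real) simp
      finally show ?thesis .
    qed
    have "wp_coeff g2 g3 k = 3 / ((2 * of_nat k + 5) * (of_nat k - 1)) *
        (\<Sum>i\<le>k-2. wp_coeff g2 g3 i * wp_coeff g2 g3 (k - 2 - i))"
      using 3 by (subst wp_coeff.simps) auto
    hence "norm (wp_coeff g2 g3 k) \<le> 3 / ((2 * real k + 5) * (real k - 1)) * ((real k - 1) * \<rho> ^ (k + 2))"
      by (simp only: norm_mult nk, intro mult_left_mono[OF sum]) (use 3 in auto)
    also have "\<dots> = 3 / (2 * real k + 5) * \<rho> ^ (k + 2)"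
    proof -
      have "3 / (a * b) * (b * c) = 3 / a * c" if "b \<noteq> 0" for a b c :: real using that by simp
      from this[of "real k - 1"] show ?thesis using 3 by auto
    qed
    also have "\<dots> \<le> 1 * \<rho> ^ (k + 2)"
      using assms(1) by (intro mult_right_mono) auto
    finally show ?thesis by simp
  qed (use assms in \<open>auto simp: wp_coeff.simps norm_divide power3_eq_cube power2_eq_square\<close>)
qed

text \<open>The series of -log(\<sigma>(u)/u) in the variable u^2: integrating the term c_k u^(2k+2)
  of \<wp>(u) - u^(-2) twice gives, with n = k + 2, the factor 1/(2n(2n-1)).\<close>

definition sigma_log :: "complex \<Rightarrow> complex \<Rightarrow> complex fps" where
  "sigma_log g2 g3 = Abs_fps (\<lambda>n. if n < 2 then 0 else wp_coeff g2 g3 (n - 2) / (2 * of_nat n * (2 * of_nat n - 1)))"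

lemma norm_sigma_log_le:
  assumes "\<rho> \<ge> 0" "norm g2 \<le> 20 * \<rho> ^ 2" "norm g3 \<le> 28 * \<rho> ^ 3"
  shows "norm (fps_nth (sigma_log g2 g3) n) \<le> \<rho> ^ n"
proof (cases "n < 2")
  case False
  have "norm (2 * of_nat n * (2 * of_nat n - 1) :: complex) = 2 * real n * (2 * real n - 1)"
  proof -
    have "(2 * of_nat n * (2 * of_nat n - 1) :: complex) = of_real (2 * real n * (2 * real n - 1))" by simp
    also have "norm \<dots> = 2 * real n * (2 * real n - 1)"
      using False by (subst norm_of_real) simp
    finally show ?thesis .
  qed
  moreover have "2 * real n * (2 * real n - 1) \<ge> 1 * 1"
    using False by (intro mult_mono) auto
  moreover have "norm (wp_coeff g2 g3 (n - 2)) \<le> \<rho> ^ n"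
  proof -
    have "n - 2 + 2 = n" using False by simp
    with norm_wp_coeff_le[OF assms, of "n - 2"] show ?thesis by metis
  qed
  ultimately have "norm (wp_coeff g2 g3 (n - 2) / (2 * of_nat n * (2 * of_nat n - 1))) \<le> \<rho> ^ n / 1"
    unfolding norm_divide using assms(1) by (intro frac_le) auto
  thus ?thesis using False by (simp add: sigma_log_def)
qed (use assms in \<open>auto simp: sigma_log_def\<close>)

lemma norm_sigma_log_summand_le:
  assumes "\<rho> \<ge> 0" "norm g2 \<le> 20 * \<rho> ^ 2" "norm g3 \<le> 28 * \<rho> ^ 3" "\<rho> * norm t \<le> 1 / 2"
  shows "norm (fps_nth (sigma_log g2 g3) n * t ^ n) \<le> (1 / 2) ^ n"
proof -
  have "norm (fps_nth (sigma_log g2 g3) n * t ^ n) \<le> \<rho> ^ n * norm t ^ n"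
    unfolding norm_mult norm_power by (intro mult_right_mono norm_sigma_log_le assms) auto
  also have "\<dots> = (\<rho> * norm t) ^ n" by (simp add: power_mult_distrib)
  also have "\<dots> \<le> (1 / 2) ^ n" using assms by (intro power_mono) auto
  finally show ?thesis .
qed

lemma sigma_log_conv_radius:
  assumes "\<rho> > 0" "norm g2 \<le> 20 * \<rho> ^ 2" "norm g3 \<le> 28 * \<rho> ^ 3"
  shows "fps_conv_radius (sigma_log g2 g3) \<ge> ereal (1 / (2 * \<rho>))"
proof -
  define t :: complex where "t = of_real (1 / (2 * \<rho>))"
  have t: "norm t = 1 / (2 * \<rho>)"
    using assms(1) unfolding t_def norm_of_real by simp
  have "norm (fps_nth (sigma_log g2 g3) n * t ^ n) \<le> (1 / 2) ^ n" for n
    by (rule norm_sigma_log_summand_le[of \<rho>]) (use assms t in \<open>auto\<close>)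
  moreover have "summable (\<lambda>n. (1 / 2 :: real) ^ n)" by (rule summable_geometric) simp
  ultimately have "summable (\<lambda>n. fps_nth (sigma_log g2 g3) n * t ^ n)"
    by (rule summable_comparison_test'[rotated])
  from conv_radius_geI[OF this] show ?thesis
    by (simp add: fps_conv_radius_def t)
qed

lemma wp_bound_exists:
  obtains \<rho> :: real where "\<rho> > 0" "norm (g2 :: complex) < 20 * \<rho> ^ 2" "norm (g3 :: complex) < 28 * \<rho> ^ 3"
proof -
  define \<rho> where "\<rho> = 1 + norm g2 + norm g3"
  have \<rho>: "\<rho> \<ge> 1" by (simp add: \<rho>_def)
  have "norm g2 < 20 * \<rho>" "norm g3 < 28 * \<rho>" using norm_ge_zero[of g2] norm_ge_zero[of g3]
    unfolding \<rho>_def by (simp_all add: algebra_simps, linarith+)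
  moreover have "\<rho> \<le> \<rho> ^ 2" "\<rho> \<le> \<rho> ^ 3" using \<rho> by (simp_all add: self_le_power)
  ultimately show ?thesis using \<rho> by (intro that[of \<rho>]) auto
qed

lemma holo3_wp_coeff: "holo3 UNIV (\<lambda>g2 g3 u. wp_coeff g2 g3 k)"
proof (induction k rule: less_induct)
  case (less k)
  consider "k = 0" | "k = 1" | "k \<ge> 2" by linarith
  thus ?case
  proof cases
    case 1
    thus ?thesis using holo3_mult[OF holo3_const[of UNIV "1/20"] holo3_proj(1)] by (simp add: wp_coeff.simps)
  next
    case 2
    thus ?thesis using holo3_mult[OF holo3_const[of UNIV "1/28"] holo3_proj(2)] by (simp add: wp_coeff.simps)
  next
    case 3
    have "holo3 UNIV (\<lambda>g2 g3 u. 3 / ((2 * of_nat k + 5) * (of_nat k - 1)) *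
        (\<Sum>i\<le>k-2. wp_coeff g2 g3 i * wp_coeff g2 g3 (k - 2 - i)))"
      by (intro holo3_mult holo3_const holo3_sum open_UNIV less.IH) (use 3 in auto)
    thus ?thesis using 3 by (subst wp_coeff.simps) simp
  qed
qed

text \<open>On this polydisc \<rho> |u|^2 is at most 1/2, so (1/2)^n majorises the series uniformly
  in all three variables. The number \<rho> trades the size of the invariants against the size of
  the u-disc.\<close>

lemma holo3_sigma_log:
  assumes "\<rho> > 0"
  shows "holo3 (ball 0 (20 * \<rho> ^ 2) \<times> ball 0 (28 * \<rho> ^ 3) \<times> ball 0 (sqrt (1 / (2 * \<rho>))))
           (\<lambda>g2 g3 u. eval_fps (sigma_log g2 g3) (u^2))"
proof (rule holo3_uniform_limit)
  let ?D = "ball 0 (20 * \<rho> ^ 2) \<times> ball 0 (28 * \<rho> ^ 3) \<times> ball 0 (sqrt (1 / (2 * \<rho>))) :: (complex \<times> complex \<times> complex) set"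
  show "open ?D" by (intro open_Times open_ball)
  have "holo3 UNIV (\<lambda>g2 g3 u. fps_nth (sigma_log g2 g3) n * (u^2) ^ n)" for n
  proof (cases "n < 2")
    case False
    have "holo3 UNIV (\<lambda>g2 g3 u. 1 / (2 * of_nat n * (2 * of_nat n - 1)) * wp_coeff g2 g3 (n - 2) * (u^2) ^ n)"
      by (intro holo3_mult holo3_const holo3_wp_coeff holo3_power holo3_proj open_UNIV)
    thus ?thesis using False by (simp add: sigma_log_def)
  qed (auto simp: sigma_log_def intro!: holo3_const)
  thus "holo3 ?D (\<lambda>g2 g3 u. \<Sum>n<N. fps_nth (sigma_log g2 g3) n * (u^2) ^ n)" for N
    using \<open>open ?D\<close> by (intro holo3_sum) (auto intro: holo3_subset)
  have "uniform_limit ?D (\<lambda>N x. \<Sum>n<N. case x of (g2, g3, u) \<Rightarrow> fps_nth (sigma_log g2 g3) n * (u^2) ^ n)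
          (\<lambda>x. suminf (\<lambda>n. case x of (g2, g3, u) \<Rightarrow> fps_nth (sigma_log g2 g3) n * (u^2) ^ n)) sequentially"
  proof (rule Weierstrass_m_test)
    fix n x assume x: "x \<in> ?D"
    obtain g2 g3 u where [simp]: "x = (g2, g3, u)" by (cases x)
    have "norm u < sqrt (1 / (2 * \<rho>))" using x by simp
    hence "norm u ^ 2 \<le> (sqrt (1 / (2 * \<rho>))) ^ 2" by (intro power_mono) auto
    hence "\<rho> * norm (u^2) \<le> 1 / 2" using assms by (simp add: norm_power field_simps)
    thus "norm (case x of (g2, g3, u) \<Rightarrow> fps_nth (sigma_log g2 g3) n * (u^2) ^ n) \<le> (1 / 2) ^ n"
      using x assms by (auto intro!: norm_sigma_log_summand_le[of \<rho>])
  qed auto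
  thus "uniform_limit ?D (\<lambda>n (g2, g3, u). \<Sum>i<n. fps_nth (sigma_log g2 g3) i * (u^2) ^ i)
          (\<lambda>(g2, g3, u). eval_fps (sigma_log g2 g3) (u^2)) sequentially"
    by (simp add: eval_fps_def case_prod_unfold)
qed

text \<open>The power series of $\wp(u) - u^{-2}$ in the variable $u^2$.\<close>
definition wp_regpart :: "complex \<Rightarrow> complex \<Rightarrow> complex fps" where
  "wp_regpart g2 g3 = fps_const 2 * fps_deriv (sigma_log g2 g3)
     + fps_const 4 * fps_X * fps_deriv (fps_deriv (sigma_log g2 g3))"

text \<open>With t = u^2, the second u-derivative of L(u^2) is 2 L'(t) + 4 t L''(t). On t^(n+1) it
  acts by the factor (2n+2)(2n+1), which is the denominator in \<open>sigma_log\<close>.\<close>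

lemma wp_regpart_eq: "wp_regpart g2 g3 = fps_X * Abs_fps (wp_coeff g2 g3)"
proof (rule fps_ext)
  fix n
  show "fps_nth (wp_regpart g2 g3) n = fps_nth (fps_X * Abs_fps (wp_coeff g2 g3)) n"
  proof (cases n)
    case (Suc m)
    define c where "c = (of_nat n :: complex)"
    have c: "2 * c + 1 \<noteq> 0" "c + 1 \<noteq> 0"
      using of_nat_neq_0[of "2 * n", where 'a = complex] of_nat_neq_0[of n, where 'a = complex]
      by (simp_all add: add_ac c_def)
    have "fps_nth (wp_regpart g2 g3) n = (c + 1) * (4 * c + 2) * fps_nth (sigma_log g2 g3) (n + 1)"
      using Suc by (simp add: wp_regpart_def mult.assoc c_def algebra_simps)
    also have "fps_nth (sigma_log g2 g3) (n + 1) = wp_coeff g2 g3 m / (2 * (c + 1) * (2 * (c + 1) - 1))"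
      using Suc by (simp add: sigma_log_def c_def add_ac)
    also have "(c + 1) * (4 * c + 2) * (wp_coeff g2 g3 m / (2 * (c + 1) * (2 * (c + 1) - 1))) = wp_coeff g2 g3 m"
    proof -
      have "(c + 1) * (4 * c + 2) = 2 * (c + 1) * (2 * (c + 1) - 1)" by (simp add: algebra_simps)
      moreover have "2 * (c + 1) - 1 = 2 * c + 1" by simp
      hence "2 * (c + 1) * (2 * (c + 1) - 1) \<noteq> 0" using c by (metis mult_eq_0_iff zero_neq_numeral)
      ultimately show ?thesis by simp
    qed
    finally show ?thesis using Suc by simp
  qed (simp add: wp_regpart_def sigma_log_def mult.assoc)
qed

text \<open>This is \<wp>'' = 6 \<wp>^2 - g2/2 for \<wp> = 1/t + V(t), t = u^2, multiplied by t. The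
  left side multiplies the n-th coefficient by 2(2n+3)(n-2), the source of the denominators in
  \<open>wp_coeff\<close>. The factor vanishes at n = 2: there the coefficient is free, and g3
  enters as the integration constant of the first-order equation.\<close>

lemma wp_regpart_ode:
  fixes g2 g3 :: complex
  defines "V \<equiv> wp_regpart g2 g3"
  shows "fps_const 4 * fps_X ^ 2 * fps_deriv (fps_deriv V) + fps_const 2 * fps_X * fps_deriv V - fps_const 12 * V
         = fps_const 6 * fps_X * V ^ 2 - fps_const (g2 / 2) * fps_X" (is "?L = ?R")
proof (rule fps_ext)
  fix n
  have V: "fps_nth V n = (if n = 0 then 0 else wp_coeff g2 g3 (n - 1))" for n
    by (simp add: V_def wp_regpart_eq)
  have V2: "fps_nth (V ^ 2) n = (if n < 2 then 0 else \<Sum>i\<le>n-2. wp_coeff g2 g3 i * wp_coeff g2 g3 (n - 2 - i))" for n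
  proof -
    have "V ^ 2 = fps_X ^ 2 * (Abs_fps (wp_coeff g2 g3) * Abs_fps (wp_coeff g2 g3))"
      by (simp add: V_def wp_regpart_eq power2_eq_square algebra_simps)
    thus ?thesis by (simp only: fps_X_power_mult_nth) (simp add: fps_mult_nth atLeast0AtMost)
  qed
  have L: "fps_nth ?L n
        = (4 * of_nat n * (of_nat n - 1) + 2 * of_nat n - 12) * fps_nth V n"
  proof -
    consider "n = 0" | "n = 1" | m where "n = Suc (Suc m)" by (metis One_nat_def not0_implies_Suc)
    thus ?thesis
    proof cases
      case (3 m)
      have "fps_nth (fps_const 4 * fps_X ^ 2 * fps_deriv (fps_deriv V)) n = 4 * ((of_nat m + 1) * ((of_nat m + 2) * fps_nth V n))"
        using 3 by (simp add: mult.assoc fps_X_power_mult_nth) (simp add: algebra_simps)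
      thus ?thesis using 3 by (simp add: mult.assoc) (simp add: algebra_simps)
    qed (simp_all add: mult.assoc fps_X_power_mult_nth)
  qed
  have R: "fps_nth ?R n
         = (if n = 0 then 0 else 6 * fps_nth (V ^ 2) (n - 1)) - (if n = 1 then g2 / 2 else 0)"
    by (simp add: mult.assoc)
  consider "n = 0" | "n = 1" | "n = 2" | "n \<ge> 3" by linarith
  thus "fps_nth ?L n
      = fps_nth ?R n"
  proof cases
    case 4
    define k where "k = n - 1"
    have k: "n = k + 1" "k \<ge> 2" using 4 by (simp_all add: k_def)
    have k1: "(of_nat k - 1 :: complex) \<noteq> 0" using k by auto
    have k2: "(2 * of_nat k + 5 :: complex) \<noteq> 0"
      using of_nat_neq_0[of "2 * k + 4", where 'a = complex] by (simp add: add_ac)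
    have "(4 * of_nat n * (of_nat n - 1) + 2 * of_nat n - 12) = (2 * ((2 * of_nat k + 5) * (of_nat k - 1)) :: complex)"
      using k by (simp add: algebra_simps)
    moreover have "fps_nth V n = 3 / ((2 * of_nat k + 5) * (of_nat k - 1)) *
        (\<Sum>i\<le>k-2. wp_coeff g2 g3 i * wp_coeff g2 g3 (k - 2 - i))"
      using k unfolding V by (subst wp_coeff.simps) auto
    moreover have "2 * (a * b) * (3 / (a * b) * c) = 6 * c" if "a \<noteq> 0" "b \<noteq> 0" for a b c :: complex
      using that by (simp add: field_simps)
    ultimately have "(4 * of_nat n * (of_nat n - 1) + 2 * of_nat n - 12) * fps_nth V n =
       6 * (\<Sum>i\<le>k-2. wp_coeff g2 g3 i * wp_coeff g2 g3 (k - 2 - i))"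
      using k1 k2 by simp
    thus ?thesis unfolding L R V2 using k by simp
  qed (unfold L R V2 V, auto simp: wp_coeff.simps)
qed

subsection \<open>The sigma function near the origin\<close>

text \<open>Minus the second logarithmic derivative of \<open>s\<close>. At a zero of
  \<open>s\<close> the division yields 0, which is the dummy value that a nicely meromorphic
  function takes at a pole.\<close>

definition wp_of :: "(complex \<Rightarrow> complex) \<Rightarrow> complex \<Rightarrow> complex" where
  "wp_of s u = ((deriv s u)^2 - s u * deriv (deriv s) u) / (s u)^2"

text \<open>The second equation is the derivative of the first with 2 p' cancelled. Carrying both
  avoids a discussion of the zeros of p'.\<close>

definition wp_ode :: "complex \<Rightarrow> complex \<Rightarrow> (complex \<Rightarrow> complex) \<Rightarrow> complex \<Rightarrow> bool" where
  "wp_ode g2 g3 p u \<longleftrightarrow> (deriv p u)^2 = 4 * p u ^ 3 - g2 * p u - g3 \<and>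
     deriv (deriv p) u = 6 * (p u)^2 - g2 / 2"

definition sigma_loc :: "complex \<Rightarrow> complex \<Rightarrow> complex \<Rightarrow> complex" where
  "sigma_loc g2 g3 u = u * exp (- eval_fps (sigma_log g2 g3) (u^2))"

lemma deriv_eqI_open:
  assumes "open S" "u \<in> S" "\<And>w. w \<in> S \<Longrightarrow> f w = g w" "(g has_field_derivative D) (at u)"
  shows "deriv f u = D"
proof -
  have "\<forall>\<^sub>F w in nhds u. f w = g w"
    using assms(1-3) eventually_nhds by blast
  hence "deriv f u = deriv g u" by (rule deriv_cong_ev) simp
  thus ?thesis using assms(4) by (simp add: DERIV_imp_deriv)
qed

text \<open>The coefficient recursion yields the second-order equation. It makes \<open>H\<close>,
  the defect of the first-order equation, constant on a punctured disc, and the limit of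
  \<open>H\<close> at the origin shows that the constant is 0.\<close>

lemma sigma_loc_ode:
  obtains r where "r > 0" "sigma_loc g2 g3 holomorphic_on ball 0 r"
    "deriv (sigma_loc g2 g3) 0 = 1" "deriv (deriv (sigma_loc g2 g3)) 0 = 0"
    "((\<lambda>u. deriv (sigma_loc g2 g3) u / sigma_loc g2 g3 u - 1 / u) \<longlongrightarrow> 0) (at 0)"
    "\<And>u. u \<in> ball 0 r - {0} \<Longrightarrow> sigma_loc g2 g3 u \<noteq> 0"
    "\<And>u. u \<in> ball 0 r - {0} \<Longrightarrow> wp_ode g2 g3 (wp_of (sigma_loc g2 g3)) u"
proof -
  define L where "L = sigma_log g2 g3"
  define V where "V = wp_regpart g2 g3"
  define l where "l = eval_fps L"
  define v where "v = (\<lambda>t. 2 * deriv l t + 4 * t * deriv (deriv l) t)"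
  \<comment> \<open>\<open>b0\<close> and \<open>b1\<close> are the two leading coefficients of
    \<open>V\<close>; \<open>h\<close> and \<open>k\<close> are the remainders of \<open>v\<close>
    and of its derivative behind them. They are separated because exactly these two have to cancel
    against g2 and g3 at the pole.\<close>
  define b0 b1 where "b0 = g2 / 20" and "b1 = g3 / 28"
  define h where "h = eval_fps (fps_shift 3 V)"
  define k where "k = eval_fps (fps_shift 2 (fps_deriv V))"
  have cL: "fps_conv_radius L > 0"
  proof -
    obtain \<rho> where \<rho>: "\<rho> > 0" "norm g2 < 20 * \<rho> ^ 2" "norm g3 < 28 * \<rho> ^ 3"
      by (rule wp_bound_exists)
    have "0 < ereal (1 / (2 * \<rho>))" using \<rho> by simp
    also have "\<dots> \<le> fps_conv_radius L"
      unfolding L_def using \<rho> by (intro sigma_log_conv_radius) auto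
    finally show ?thesis .
  qed
  have lL: "l has_fps_expansion L" unfolding l_def by (rule eval_fps_has_fps_expansion[OF cL])
  have vV: "v has_fps_expansion V"
    unfolding v_def V_def wp_regpart_def L_def[symmetric]
    by (intro fps_expansion_intros lL)
  have cV: "fps_conv_radius V > 0" using vV by (simp add: has_fps_expansion_def)
  have "0 < fps_conv_radius (fps_deriv V)"
    using has_fps_expansion_deriv[OF vV] by (simp add: has_fps_expansion_def)
  hence hk: "h has_fps_expansion fps_shift 3 V" "k has_fps_expansion fps_shift 2 (fps_deriv V)"
    unfolding h_def k_def using cV by (auto intro!: eval_fps_has_fps_expansion)
  have nV: "fps_nth V n = (if n = 0 then 0 else wp_coeff g2 g3 (n - 1))" for n
    by (simp add: V_def wp_regpart_eq)
  have "(\<lambda>t. 4 * t ^ 2 * deriv (deriv v) t + 2 * t * deriv v t - 12 * v t - (6 * t * v t ^ 2 - g2 / 2 * t))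
      has_fps_expansion fps_const 4 * fps_X ^ 2 * fps_deriv (fps_deriv V) + fps_const 2 * fps_X * fps_deriv V - fps_const 12 * V
        - (fps_const 6 * fps_X * V ^ 2 - fps_const (g2 / 2) * fps_X)"
    by (intro fps_expansion_intros vV)
  hence e1: "\<forall>\<^sub>F t in nhds 0. 4 * t ^ 2 * deriv (deriv v) t + 2 * t * deriv v t - 12 * v t - (6 * t * v t ^ 2 - g2 / 2 * t) = 0"
    using wp_regpart_ode[of g2 g3] by (simp add: V_def has_fps_expansion_0_iff)
  let ?A = "fps_const b0 * fps_X + fps_const b1 * fps_X ^ 2 + fps_X ^ 3 * fps_shift 3 V"
  let ?A' = "fps_const b0 + fps_const (2 * b1) * fps_X + fps_X ^ 2 * fps_shift 2 (fps_deriv V)"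
  have "(\<lambda>t. v t - (b0 * t + b1 * t ^ 2 + t ^ 3 * h t)) has_fps_expansion
      V - ?A"
    by (intro fps_expansion_intros vV hk)
  also have "V - ?A = 0"
  proof (rule fps_ext)
    fix n :: nat
    consider "n = 0" | "n = 1" | "n = 2" | "n \<ge> 3" by linarith
    thus "fps_nth (V - ?A) n = fps_nth 0 n"
      by cases (auto simp: fps_X_power_mult_nth nV b0_def b1_def wp_coeff.simps)
  qed
  finally have e2: "\<forall>\<^sub>F t in nhds 0. v t - (b0 * t + b1 * t ^ 2 + t ^ 3 * h t) = 0"
    by (simp add: has_fps_expansion_0_iff)
  have "(\<lambda>t. deriv v t - (b0 + 2 * b1 * t + t ^ 2 * k t)) has_fps_expansion
      fps_deriv V - ?A'"
    by (intro fps_expansion_intros vV hk)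
  also have "fps_deriv V - ?A' = 0"
  proof (rule fps_ext)
    fix n :: nat
    consider "n = 0" | "n = 1" | "n \<ge> 2" by linarith
    thus "fps_nth (fps_deriv V - ?A') n = fps_nth 0 n"
      by cases (auto simp: fps_X_power_mult_nth nV b0_def b1_def wp_coeff.simps)
  qed
  finally have e3: "\<forall>\<^sub>F t in nhds 0. deriv v t - (b0 + 2 * b1 * t + t ^ 2 * k t) = 0"
    by (simp add: has_fps_expansion_0_iff)
  have e4: "\<forall>\<^sub>F t in nhds 0. t \<in> eball 0 (fps_conv_radius L)"
    using cL by (intro eventually_nhds_in_open) (auto simp: zero_ereal_def)
  obtain e where e0: "e > 0" "\<And>t. dist t 0 < e \<Longrightarrow>
      (4 * t ^ 2 * deriv (deriv v) t + 2 * t * deriv v t - 12 * v t - (6 * t * v t ^ 2 - g2 / 2 * t) = 0 \<and>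
       v t - (b0 * t + b1 * t ^ 2 + t ^ 3 * h t) = 0) \<and>
      deriv v t - (b0 + 2 * b1 * t + t ^ 2 * k t) = 0 \<and> t \<in> eball 0 (fps_conv_radius L)"
    using eventually_conj[OF eventually_conj[OF e1 e2] eventually_conj[OF e3 e4]]
    unfolding eventually_nhds_metric by blast
  have e: "e > 0" "t \<in> ball 0 e \<Longrightarrow> 4 * t ^ 2 * deriv (deriv v) t + 2 * t * deriv v t - 12 * v t = 6 * t * v t ^ 2 - g2 / 2 * t"
     "t \<in> ball 0 e \<Longrightarrow> v t = b0 * t + b1 * t ^ 2 + t ^ 3 * h t"
     "t \<in> ball 0 e \<Longrightarrow> deriv v t = b0 + 2 * b1 * t + t ^ 2 * k t"
     "t \<in> ball 0 e \<Longrightarrow> t \<in> eball 0 (fps_conv_radius L)" for t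
    using e0(1) e0(2)[of t] unfolding mem_ball dist_commute[of 0 t] right_minus_eq by blast+
  have hol_l: "l holomorphic_on ball 0 e"
    unfolding l_def using e(5) by (intro holomorphic_on_eval_fps) auto
  have hol_l1: "deriv l holomorphic_on ball 0 e" "deriv (deriv l) holomorphic_on ball 0 e"
    by (intro holomorphic_deriv hol_l open_ball)+
  have hol_v: "v holomorphic_on ball 0 e"
    unfolding v_def by (intro holomorphic_intros hol_l1)
  have hol_v1: "deriv v holomorphic_on ball 0 e" by (intro holomorphic_deriv hol_v open_ball)
  have D: "(f has_field_derivative deriv f t) (at t)" if "t \<in> ball 0 e" "f holomorphic_on ball 0 e" for f t
    using that by (intro holomorphic_derivI[OF that(2)]) auto
  \<comment> \<open>The bound 1 gives |u|^2 \<le> |u|, so that u^2 stays in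
    \<open>ball 0 e\<close>.\<close>
  define r where "r = min 1 e"
  have r: "r > 0" using e by (simp add: r_def)
  have sq: "u^2 \<in> ball 0 e" if "u \<in> ball 0 r" for u :: complex
  proof -
    have "norm u ^ 2 \<le> norm u * 1" unfolding power2_eq_square
      using that by (intro mult_left_mono) (auto simp: r_def)
    thus ?thesis using that by (simp add: r_def norm_power)
  qed
  define s where "s = sigma_loc g2 g3"
  define P where "P = ball (0::complex) r - {0}"
  have P: "open P" "\<And>u. u \<in> P \<Longrightarrow> u \<noteq> 0" "\<And>u. u \<in> P \<Longrightarrow> u^2 \<in> ball 0 e"
    using sq by (auto simp: P_def)
  have s_eq: "s = (\<lambda>u. u * exp (- l (u^2)))" by (simp add: fun_eq_iff s_def sigma_loc_def l_def L_def)
  have hol_s: "s holomorphic_on ball 0 r"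
    unfolding s_eq using sq
    by (intro holomorphic_intros holomorphic_on_compose_gen[OF _ hol_l, unfolded o_def]) auto
  have s_nz: "s u \<noteq> 0" if "u \<in> P" for u using P(2)[OF that] by (simp add: s_eq)
  define \<zeta> where "\<zeta> = (\<lambda>u. 1 / u - 2 * u * deriv l (u^2))"
  define p where "p = (\<lambda>u. 1 / u^2 + v (u^2))"
  define p1 where "p1 = (\<lambda>u. - 2 / u ^ 3 + 2 * u * deriv v (u^2))"
  have comp: "((\<lambda>u. f (u^2)) has_field_derivative deriv f (u^2) * (2 * u)) (at u)"
    if "u \<in> ball 0 r" "f holomorphic_on ball 0 e" for f u
    by (rule DERIV_chain2[where f = f and g = "\<lambda>u. u^2"])
      (use D[OF sq[OF that(1)] that(2)] in \<open>auto intro!: derivative_eq_intros\<close>)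
  have PB: "u \<in> ball 0 r" if "u \<in> P" for u using that by (simp add: P_def)
  have ds0: "(s has_field_derivative exp (- l (u^2)) * (1 - 2 * u^2 * deriv l (u^2))) (at u)" if "u \<in> ball 0 r" for u
    unfolding s_eq
    by (auto intro!: derivative_eq_intros comp[OF that hol_l]; simp add: algebra_simps power2_eq_square)
  hence ds0': "deriv s u = exp (- l (u^2)) * (1 - 2 * u^2 * deriv l (u^2))" if "u \<in> ball 0 r" for u
    using that by (simp add: DERIV_imp_deriv)
  have l0: "l 0 = 0" by (simp add: l_def eval_fps_at_0 L_def sigma_log_def)
  have r0: "0 \<in> ball 0 r" using r by simp
  have s1: "deriv s 0 = 1" using ds0'[of 0] r l0 by simp
  have s2: "deriv (deriv s) 0 = 0"
    by (rule deriv_eqI_open[OF open_ball r0 ds0'])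
      (use comp[OF r0 hol_l] comp[OF r0 hol_l1(1)] l0 in \<open>auto intro!: derivative_eq_intros\<close>)
  have ds: "(s has_field_derivative s u * \<zeta> u) (at u)" if "u \<in> P" for u
    unfolding s_eq \<zeta>_def using P(2)[OF that]
    by (auto intro!: derivative_eq_intros comp[OF PB[OF that] hol_l]; simp add: field_simps power2_eq_square)
  have d\<zeta>: "(\<zeta> has_field_derivative - p u) (at u)" if "u \<in> P" for u
    unfolding \<zeta>_def p_def v_def using P(2)[OF that]
    by (auto intro!: derivative_eq_intros comp[OF PB[OF that] hol_l1(1)]; simp add: field_simps power2_eq_square)
  have dp: "(p has_field_derivative p1 u) (at u)" if "u \<in> P" for u
    unfolding p_def p1_def using P(2)[OF that]
    by (auto intro!: derivative_eq_intros comp[OF PB[OF that] hol_v]; simp add: field_simps eval_nat_numeral)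
  have dp1: "(p1 has_field_derivative 6 * (p u)^2 - g2 / 2) (at u)" if "u \<in> P" for u
  proof -
    have "(p1 has_field_derivative 6 / u ^ 4 + 2 * deriv v (u^2) + 4 * u^2 * deriv (deriv v) (u^2)) (at u)"
      unfolding p1_def using P(2)[OF that]
      by (auto intro!: derivative_eq_intros comp[OF PB[OF that] hol_v1]; simp add: field_simps eval_nat_numeral)
    also have "6 / u ^ 4 + 2 * deriv v (u^2) + 4 * u^2 * deriv (deriv v) (u^2) = 6 * (p u)^2 - g2 / 2"
    proof -
      define t where "t = u^2"
      have t: "t \<noteq> 0" "u ^ 4 = t ^ 2" using P(2)[OF that] by (simp_all add: t_def flip: power_mult)
      have "t * (6 / t ^ 2 + 2 * deriv v t + 4 * t * deriv (deriv v) t) = t * (6 * (1 / t + v t)^2 - g2 / 2)"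
      proof -
        have "t * (6 / t ^ 2 + 2 * deriv v t + 4 * t * deriv (deriv v) t)
            = 6 / t + (4 * t ^ 2 * deriv (deriv v) t + 2 * t * deriv v t - 12 * v t) + 12 * v t"
          using t by (simp add: field_simps power2_eq_square)
        also have "\<dots> = t * (6 * (1 / t + v t)^2 - g2 / 2)"
          unfolding e(2)[OF P(3)[OF that], folded t_def] using t by (simp add: field_simps power2_eq_square)
        finally show ?thesis .
      qed
      thus ?thesis using t by (simp add: p_def flip: t_def)
    qed
    finally show ?thesis .
  qed
  have evP: "\<forall>\<^sub>F u in at 0. u \<in> P"
    unfolding P_def by (rule eventually_at_in_open) (use r in auto)
  have zeta_lim: "((\<lambda>u. deriv s u / s u - 1 / u) \<longlongrightarrow> 0) (at 0)"
  proof (rule Lim_transform_eventually)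
    have "isCont (\<lambda>u. deriv l (u^2)) 0"
      by (rule DERIV_isCont[OF comp[OF r0 hol_l1(1)]])
    hence "isCont (\<lambda>u. - (2 * u * deriv l (u^2))) 0" by (intro continuous_intros)
    thus "((\<lambda>u. - (2 * u * deriv l (u^2))) \<longlongrightarrow> 0) (at 0)" by (simp add: isCont_def)
    show "\<forall>\<^sub>F u in at 0. - (2 * u * deriv l (u^2)) = deriv s u / s u - 1 / u"
      using evP
    proof eventually_elim
      case (elim u)
      with DERIV_imp_deriv[OF ds[OF elim]] s_nz[OF elim] show ?case by (simp add: \<zeta>_def)
    qed
  qed
  have wp: "wp_of s u = p u" if "u \<in> P" for u
  proof -
    have 1: "deriv s w = s w * \<zeta> w" if "w \<in> P" for w using ds[OF that] by (simp add: DERIV_imp_deriv)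
    have 2: "deriv (deriv s) u = s u * \<zeta> u * \<zeta> u + s u * (- p u)"
      by (rule deriv_eqI_open[OF P(1) that 1])
        (auto intro!: derivative_eq_intros ds[OF that] d\<zeta>[OF that] simp: algebra_simps)
    thus ?thesis using s_nz[OF that]
      unfolding wp_of_def 1[OF that] 2 by (simp add: field_simps power2_eq_square)
  qed
  have w1: "deriv (wp_of s) u = p1 u" if "u \<in> P" for u
    by (rule deriv_eqI_open[OF P(1) that wp dp[OF that]])
  have w2: "deriv (deriv (wp_of s)) u = 6 * (p u)^2 - g2 / 2" if "u \<in> P" for u
    by (rule deriv_eqI_open[OF P(1) that w1 dp1[OF that]])
  define H where "H = (\<lambda>u. (p1 u)^2 - 4 * p u ^ 3 + g2 * p u + g3)"
  have dH: "(H has_field_derivative 0) (at u)" if "u \<in> P" for u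
    unfolding H_def
    by (auto intro!: derivative_eq_intros dp[OF that] dp1[OF that] simp: algebra_simps power2_eq_square)
  have "connected P" unfolding P_def by (rule connected_open_delete) auto
  then obtain c where c: "\<And>u. u \<in> P \<Longrightarrow> H u = c"
    using DERIV_zero_connected_constant[of P "{}" H] P(1) dH
    by (metis Diff_empty DERIV_isCont continuous_at_imp_continuous_on finite.emptyI)
  \<comment> \<open>\<open>E\<close> is \<open>H\<close> in the variable t = u^2 after its polar and
    constant terms have cancelled. The term in 1/t vanishes since 20 b0 = g2, the constant one since
    28 b1 = g3. What remains is continuous with value 0 at t = 0.\<close>
  define E where "E = (\<lambda>t. - 8 * t * k t - 12 * t * h t + 4 * t * (deriv v t)^2
      - 12 * t * (b0 + b1 * t + t ^ 2 * h t)^2 - 4 * v t ^ 3 + g2 * v t)"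
  have HE: "H u = E (u^2)" if "u \<in> P" for u
  proof -
    define t where "t = u^2"
    have t: "t \<noteq> 0" "t \<in> ball 0 e" using P(2,3)[OF that] by (simp_all add: t_def)
    have "(p1 u)^2 = 4 / t ^ 3 - 8 * deriv v t / t + 4 * t * (deriv v t)^2"
      using P(2)[OF that] by (simp add: p1_def t_def field_simps eval_nat_numeral)
    moreover have "p u = 1 / t + v t" by (simp add: p_def t_def)
    ultimately have "H u = 4 / t ^ 3 - 8 * deriv v t / t + 4 * t * (deriv v t)^2 - 4 * (1 / t + v t) ^ 3
        + g2 * (1 / t + v t) + g3" by (simp add: H_def)
    also have "\<dots> = (g2 - 8 * deriv v t - 12 * (v t / t)) / t + g3 + 4 * t * (deriv v t)^2
        - 12 * t * (v t / t)^2 - 4 * v t ^ 3 + g2 * v t"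
      using t(1) by (simp add: field_simps eval_nat_numeral)
    also have "v t / t = b0 + b1 * t + t ^ 2 * h t"
      using t e(3)[OF t(2)] by (simp add: field_simps eval_nat_numeral)
    also have "(g2 - 8 * deriv v t - 12 * (b0 + b1 * t + t ^ 2 * h t)) / t = - g3 - 8 * t * k t - 12 * t * h t"
      using t(1) unfolding e(4)[OF t(2)] b0_def b1_def by (simp add: field_simps eval_nat_numeral)
    finally show ?thesis by (simp add: E_def t_def)
  qed
  have "isCont h 0" "isCont k 0" "isCont v 0" "isCont (deriv v) 0"
    using hk vV has_fps_expansion_deriv[OF vV] by (auto dest: has_fps_expansion_imp_continuous)
  hence "isCont E 0" unfolding E_def by (intro continuous_intros)
  moreover have "v 0 = 0" using e(3)[of 0] e(1) by simp
  ultimately have "E \<midarrow>0\<rightarrow> 0" by (simp add: isCont_def E_def)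
  moreover have "filterlim (\<lambda>u::complex. u^2) (at 0) (at 0)"
    by (auto simp: filterlim_at eventually_at_filter intro!: tendsto_eq_intros)
  ultimately have "((\<lambda>u. E (u^2)) \<longlongrightarrow> 0) (at 0)" by (rule filterlim_compose)
  moreover have "\<forall>\<^sub>F u in at 0. E (u^2) = c"
    using evP by eventually_elim (use HE c in auto)
  ultimately have "((\<lambda>u::complex. c) \<longlongrightarrow> 0) (at 0)" by (rule Lim_transform_eventually)
  hence "c = 0" by (simp add: tendsto_const_iff)
  have "wp_ode g2 g3 (wp_of s) u" if "u \<in> P" for u
    unfolding wp_ode_def w1[OF that] w2[OF that] wp[OF that]
    using c[OF that] \<open>c = 0\<close> by (simp add: H_def algebra_simps)
  with that[of r] show ?thesis using r hol_s s_nz s1 s2 zeta_lim by (simp add: s_def P_def)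
qed

subsection \<open>The addition formula\<close>

definition wp_num :: "(complex \<Rightarrow> complex) \<Rightarrow> complex \<Rightarrow> complex" where
  "wp_num s u = (deriv s u)^2 - s u * deriv (deriv s) u"

text \<open>$s(u)^2 s(v)^2 (\wp(v) - \wp(u))$, cleared of denominators.\<close>
definition addN :: "(complex \<Rightarrow> complex) \<Rightarrow> complex \<Rightarrow> complex \<Rightarrow> complex" where
  "addN s u v = (s u)^2 * wp_num s v - wp_num s u * (s v)^2"

lemma isCont_imp_eventually_ne:
  fixes f :: "'a::t2_space \<Rightarrow> complex"
  assumes "isCont f x" "f x \<noteq> 0"
  shows "\<forall>\<^sub>F y in nhds x. f y \<noteq> 0"
proof -
  have "(f \<longlongrightarrow> f x) (nhds x)"
    using assms(1) by (simp add: isCont_def tendsto_at_iff_tendsto_nhds)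
  thus ?thesis by (rule tendsto_imp_eventually_ne) fact
qed

text \<open>Used for two functions: for \<open>sigma_loc\<close> on a small disc, where it gives the
  duplication formula before any entire function exists, and later for \<open>wsigma\<close> on
  discs of arbitrary radius.\<close>

locale local_sigma =
  fixes g2 g3 :: complex and s :: "complex \<Rightarrow> complex" and R :: real
  assumes R_pos: "R > 0" and hol: "s holomorphic_on ball 0 R"
    and s_0: "s 0 = 0" and s'_0: "deriv s 0 = 1" and s''_0: "deriv (deriv s) 0 = 0"
    and ode: "\<And>u. u \<in> ball 0 R \<Longrightarrow> s u \<noteq> 0 \<Longrightarrow> wp_ode g2 g3 (wp_of s) u"
begin

lemma hol': "deriv s holomorphic_on ball 0 R" "deriv (deriv s) holomorphic_on ball 0 R"
  by (intro holomorphic_deriv hol open_ball)+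

lemma hol_wp_num: "wp_num s holomorphic_on ball 0 R"
  unfolding wp_num_def by (intro holomorphic_intros hol hol')

lemma DERIV_s: "u \<in> ball 0 R \<Longrightarrow> (s has_field_derivative deriv s u) (at u)"
  and DERIV_s': "u \<in> ball 0 R \<Longrightarrow> (deriv s has_field_derivative deriv (deriv s) u) (at u)"
  and DERIV_s'': "u \<in> ball 0 R \<Longrightarrow> (deriv (deriv s) has_field_derivative deriv (deriv (deriv s)) u) (at u)"
  and DERIV_wp_num: "u \<in> ball 0 R \<Longrightarrow> (wp_num s has_field_derivative deriv (wp_num s) u) (at u)"
  using hol hol' hol_wp_num by (auto intro!: holomorphic_derivI)

lemma open_nz: "open {u \<in> ball 0 R. s u \<noteq> 0}"
  using continuous_open_preimage[OF holomorphic_on_imp_continuous_on[OF hol] open_ball, of "- {0}"]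
  by (auto simp: Int_def vimage_def)

lemma hol_wp: "wp_of s holomorphic_on {u \<in> ball 0 R. s u \<noteq> 0}"
  unfolding wp_of_def by (intro holomorphic_intros holomorphic_on_subset[OF hol] holomorphic_on_subset[OF hol'(1)]
      holomorphic_on_subset[OF hol'(2)]) auto

lemma DERIV_wp:
  assumes "u \<in> ball 0 R" "s u \<noteq> 0"
  shows "(wp_of s has_field_derivative deriv (wp_of s) u) (at u)"
    "(deriv (wp_of s) has_field_derivative 6 * (wp_of s u)^2 - g2 / 2) (at u)"
  using holomorphic_derivI[OF hol_wp open_nz, of u]
    holomorphic_derivI[OF holomorphic_deriv[OF hol_wp open_nz] open_nz, of u] ode[OF assms] assms
  by (simp_all add: wp_ode_def)

lemma wp_num_eq: "s u \<noteq> 0 \<Longrightarrow> wp_num s u = wp_of s u * (s u)^2"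
  by (simp add: wp_num_def wp_of_def)

lemma deriv_wp_num_eq:
  assumes "u \<in> ball 0 R" "s u \<noteq> 0"
  shows "deriv (wp_num s) u = deriv (wp_of s) u * (s u)^2 + 2 * wp_of s u * s u * deriv s u"
  by (rule deriv_eqI_open[OF open_nz _ wp_num_eq])
    (use assms in \<open>auto intro!: derivative_eq_intros DERIV_wp DERIV_s simp: algebra_simps\<close>)

lemma DERIV_zeta:
  assumes "u \<in> ball 0 R" "s u \<noteq> 0"
  shows "((\<lambda>u. deriv s u / s u) has_field_derivative - wp_of s u) (at u)"
  by (rule derivative_eq_intros DERIV_s DERIV_s' assms refl)+
    (use assms in \<open>simp add: wp_of_def field_simps power2_eq_square\<close>)

definition addNu :: "complex \<Rightarrow> complex \<Rightarrow> complex" where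
  "addNu u v = 2 * s u * deriv s u * wp_num s v - deriv (wp_num s) u * (s v)^2"

definition addNv :: "complex \<Rightarrow> complex \<Rightarrow> complex" where
  "addNv u v = (s u)^2 * deriv (wp_num s) v - wp_num s u * (2 * s v * deriv s v)"

lemma DERIV_addN:
  assumes "(f has_field_derivative f') (at x)" "(g has_field_derivative g') (at x)"
    and "f x \<in> ball 0 R" "g x \<in> ball 0 R"
  shows "((\<lambda>x. addN s (f x) (g x)) has_field_derivative f' * addNu (f x) (g x) + g' * addNv (f x) (g x)) (at x)"
  unfolding addN_def addNu_def addNv_def
  by (rule derivative_eq_intros DERIV_chain2[OF DERIV_s assms(1)] DERIV_chain2[OF DERIV_s assms(2)]
      DERIV_chain2[OF DERIV_wp_num assms(1)] DERIV_chain2[OF DERIV_wp_num assms(2)] assms refl)+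
    (simp add: algebra_simps)

text \<open>With a = u + v and b = u - v, half the sum of the two partial derivatives is the
  derivative in a. The quotient is thus the a-derivative of log N, and the right side is its
  classical form: a sum of zeta values plus a quotient of differences.\<close>

lemma addN_div:
  assumes "u \<in> ball 0 R" "v \<in> ball 0 R" "s u \<noteq> 0" "s v \<noteq> 0" "addN s u v \<noteq> 0"
  shows "wp_of s v - wp_of s u \<noteq> 0"
    "(addNu u v + addNv u v) / 2 / addN s u v =
      deriv s u / s u + deriv s v / s v + (deriv (wp_of s) v - deriv (wp_of s) u) / (2 * (wp_of s v - wp_of s u))"
proof -
  define p q where "p = wp_of s u" and "q = wp_of s v"
  have N: "addN s u v = (s u)^2 * (s v)^2 * (q - p)"
    using assms by (simp add: addN_def wp_num_eq p_def q_def algebra_simps)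
  thus d: "wp_of s v - wp_of s u \<noteq> 0" using assms(5) by (auto simp: p_def q_def)
  have eqs: "addNu u v = 2 * s u * deriv s u * (s v)^2 * (q - p) - deriv (wp_of s) u * (s u)^2 * (s v)^2"
       "addNv u v = 2 * s v * deriv s v * (s u)^2 * (q - p) + deriv (wp_of s) v * (s u)^2 * (s v)^2"
    using assms by (simp_all add: addNu_def addNv_def wp_num_eq deriv_wp_num_eq p_def q_def algebra_simps)
  show "(addNu u v + addNv u v) / 2 / addN s u v =
      deriv s u / s u + deriv s v / s v + (deriv (wp_of s) v - deriv (wp_of s) u) / (2 * (wp_of s v - wp_of s u))"
    unfolding N eqs using assms(3,4) d unfolding p_def[symmetric] q_def[symmetric]
    by (simp add: field_simps power2_eq_square)
qed

abbreviation "addN_mid a b \<equiv> addN s ((a + b) / 2) ((a - b) / 2)"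

abbreviation "addN_ratio a b \<equiv>
  (addNu ((a + b) / 2) ((a - b) / 2) + addNv ((a + b) / 2) ((a - b) / 2)) / 2 / addN_mid a b"

text \<open>The vanishing of the mixed logarithmic derivative. The two zeta terms contribute (q -
  p)/2, where p = \<wp>(u) and q = \<wp>(v), and the quotient of differences contributes the
  opposite.\<close>

lemma DERIV_addN_quotient:
  fixes a b :: complex
  defines "u \<equiv> (a + b) / 2" and "v \<equiv> (a - b) / 2"
  assumes "u \<in> ball 0 R" "v \<in> ball 0 R" "s u \<noteq> 0" "s v \<noteq> 0" "addN s u v \<noteq> 0"
  shows "((\<lambda>b. addN_ratio a b) has_field_derivative 0) (at b)"
proof -
  let ?U = "\<lambda>b. (a + b) / 2" and ?V = "\<lambda>b. (a - b) / 2"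
  let ?W = "{b. ?U b \<in> {u \<in> ball 0 R. s u \<noteq> 0} \<and> ?V b \<in> {u \<in> ball 0 R. s u \<noteq> 0}}"
  let ?F = "\<lambda>b. deriv s (?U b) / s (?U b) + deriv s (?V b) / s (?V b) +
      (deriv (wp_of s) (?V b) - deriv (wp_of s) (?U b)) / (2 * (wp_of s (?V b) - wp_of s (?U b)))"
  have dU: "(?U has_field_derivative 1 / 2) (at b)" and dV: "(?V has_field_derivative - 1 / 2) (at b)"
    by (auto intro!: derivative_eq_intros)
  have "open (?U -` {u \<in> ball 0 R. s u \<noteq> 0} \<inter> ?V -` {u \<in> ball 0 R. s u \<noteq> 0})"
    by (intro open_Int open_vimage open_nz continuous_intros) auto
  moreover have "?U -` {u \<in> ball 0 R. s u \<noteq> 0} \<inter> ?V -` {u \<in> ball 0 R. s u \<noteq> 0} = ?W" by auto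
  ultimately have "open ?W" by simp
  hence "\<forall>\<^sub>F b in nhds b. b \<in> ?W"
    using assms by (intro eventually_nhds_in_open) auto
  moreover have "isCont (\<lambda>b. addN s (?U b) (?V b)) b"
    by (rule DERIV_isCont[OF DERIV_addN[OF dU dV]]) (use assms in auto)
  hence "\<forall>\<^sub>F b in nhds b. addN s (?U b) (?V b) \<noteq> 0"
    by (rule isCont_imp_eventually_ne) (use assms in auto)
  ultimately have ev: "\<forall>\<^sub>F b in nhds b. (addNu (?U b) (?V b) + addNv (?U b) (?V b)) / 2 / addN s (?U b) (?V b) = ?F b"
  proof eventually_elim
    case (elim b)
    thus ?case by (intro addN_div(2)) auto
  qed
  define p q p1 q1 where "p = wp_of s u" and "q = wp_of s v" and "p1 = deriv (wp_of s) u" and "q1 = deriv (wp_of s) v"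
  have d: "q - p \<noteq> 0" using addN_div(1)[of u v] assms by (simp add: p_def q_def)
  have pq: "p1^2 = 4 * p ^ 3 - g2 * p - g3" "q1^2 = 4 * q ^ 3 - g2 * q - g3"
    using ode[of u] ode[of v] assms by (simp_all add: wp_ode_def p_def q_def p1_def q1_def)
  have "(?F has_field_derivative
      (- p) * (1 / 2) + (- q) * (- 1 / 2) +
      (((6 * q^2 - g2 / 2) * (- 1 / 2) - (6 * p^2 - g2 / 2) * (1 / 2)) * (2 * (q - p))
        - (q1 - p1) * (2 * (q1 * (- 1 / 2) - p1 * (1 / 2)))) / (2 * (q - p))^2) (at b)"
    unfolding p_def q_def p1_def q1_def u_def v_def
    by (rule derivative_eq_intros DERIV_chain2[OF DERIV_zeta dU] DERIV_chain2[OF DERIV_zeta dV]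
        DERIV_chain2[OF DERIV_wp(1) dU] DERIV_chain2[OF DERIV_wp(1) dV]
        DERIV_chain2[OF DERIV_wp(2) dU] DERIV_chain2[OF DERIV_wp(2) dV] refl
        assms[unfolded u_def v_def])+
      (use d in \<open>simp_all add: p_def q_def u_def v_def power2_eq_square\<close>)
  also have "((6 * q^2 - g2 / 2) * (- 1 / 2) - (6 * p^2 - g2 / 2) * (1 / 2)) * (2 * (q - p))
        - (q1 - p1) * (2 * (q1 * (- 1 / 2) - p1 * (1 / 2))) = (q1^2 - p1^2) - (6 * q^2 + 6 * p^2 - g2) * (q - p)"
    by (simp add: algebra_simps power2_eq_square)
  \<comment> \<open>By the first-order equation, q1^2 - p1^2 is divisible by q - p. The remaining
    quadratic factor is -2 (q - p)^2, and g2 and g3 drop out.\<close>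
  also have "\<dots> = - ((2 * (q - p))^2 * ((q - p) / 2))"
    unfolding pq by (simp add: field_simps eval_nat_numeral)
  finally have "(?F has_field_derivative 0) (at b)" using d by (simp add: field_simps)
  thus ?thesis using DERIV_cong_ev[OF refl ev refl] by simp
qed

lemma wp_num_0: "wp_num s 0 = 1"
  by (simp add: wp_num_def s_0 s'_0)

lemma deriv_wp_num_0: "deriv (wp_num s) 0 = 0"
proof -
  have "(wp_num s has_field_derivative 2 * deriv s 0 * deriv (deriv s) 0
      - (deriv s 0 * deriv (deriv s) 0 + s 0 * deriv (deriv (deriv s)) 0)) (at 0)"
    unfolding wp_num_def using R_pos
    by (auto intro!: derivative_eq_intros DERIV_s DERIV_s' DERIV_s'')
  thus ?thesis by (simp add: DERIV_imp_deriv s_0 s''_0)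
qed

lemma half_sum_in_ball:
  fixes a b :: complex
  assumes "a \<in> ball 0 r" "b \<in> ball 0 r"
  shows "(a + b) / 2 \<in> ball 0 r" "(a - b) / 2 \<in> ball 0 r"
  using norm_triangle_ineq[of a b] norm_triangle_ineq4[of a b] assms by (auto simp: norm_divide)

text \<open>The argument takes place near a point \<open>b0\<close> other than the origin: for a, b
  near \<open>b0\<close> the half sum is near \<open>b0\<close> and the half difference near 0,
  where N(b0, 0) = s(b0)^2 \<noteq> 0. The a-derivative of log N is independent of b, so it can be
  evaluated at b = a, where it is s'(a)/s(a). Hence N/s(a) is constant in a, and its value at a = b
  is s(b).\<close>

lemma addition_formula_local:
  obtains b0 \<delta> where "\<delta> > 0" "ball b0 \<delta> \<subseteq> ball 0 R"
    "\<And>a b. a \<in> ball b0 \<delta> \<Longrightarrow> b \<in> ball b0 \<delta> \<Longrightarrow> addN_mid a b = s a * s b"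
proof -
  have in0: "0 \<in> ball 0 R" using R_pos by simp
  have "\<forall>\<^sub>F u in at 0. s u \<noteq> 0"
  proof -
    have "((\<lambda>u. s u / u) \<longlongrightarrow> 1) (at 0)"
      using DERIV_s[OF in0] by (simp add: has_field_derivative_iff s_0 s'_0)
    hence "\<forall>\<^sub>F u in at 0. s u / u \<noteq> 0" by (rule tendsto_imp_eventually_ne) simp
    thus ?thesis by eventually_elim auto
  qed
  moreover have "\<forall>\<^sub>F u in at 0. u \<in> ball 0 R" using R_pos by (intro eventually_at_in_open') auto
  ultimately have "\<forall>\<^sub>F u in at 0. s u \<noteq> 0 \<and> u \<in> ball 0 R" by eventually_elim simp
  then obtain \<rho> where \<rho>: "\<rho> > 0" "\<And>u. u \<noteq> 0 \<Longrightarrow> dist u 0 < \<rho> \<Longrightarrow> s u \<noteq> 0 \<and> u \<in> ball 0 R"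
    unfolding eventually_at by blast
  \<comment> \<open>Modulus \<rho>/2 together with a radius of at most \<rho>/4 keeps the ball away
    from 0 and inside the disc where \<open>s\<close> has no zero but the origin.\<close>
  define b0 :: complex where "b0 = of_real (\<rho> / 2)"
  have b0: "norm b0 = \<rho> / 2" using \<rho> by (simp add: b0_def)
  have sb0: "s b0 \<noteq> 0" "b0 \<in> ball 0 R" using \<rho>(2)[of b0] b0 \<rho>(1) by force+
  have "continuous_on (ball 0 R \<times> ball 0 R) (\<lambda>p. addN s (fst p) (snd p))"
    unfolding addN_def
    by (intro continuous_intros continuous_on_compose2[OF holomorphic_on_imp_continuous_on[OF hol]]
        continuous_on_compose2[OF holomorphic_on_imp_continuous_on[OF hol_wp_num]]) auto
  hence "isCont (\<lambda>p. addN s (fst p) (snd p)) (b0, 0)"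
    using sb0 in0 by (subst (asm) continuous_on_eq_continuous_at) (auto simp: open_Times)
  moreover have "addN s b0 0 \<noteq> 0" using sb0 by (simp add: addN_def wp_num_0 s_0)
  ultimately have "\<forall>\<^sub>F p in nhds (b0, 0). addN s (fst p) (snd p) \<noteq> 0"
    by (intro isCont_imp_eventually_ne) auto
  then obtain S where S: "open S" "(b0, 0) \<in> S" "\<And>p. p \<in> S \<Longrightarrow> addN s (fst p) (snd p) \<noteq> 0"
    unfolding eventually_nhds by blast
  obtain A B where AB: "open A" "open B" "(b0, 0) \<in> A \<times> B" "A \<times> B \<subseteq> S"
    using open_prod_elim[OF S(1,2)] by metis
  obtain d1 d2 where d12: "d1 > 0" "ball b0 d1 \<subseteq> A" "d2 > 0" "ball 0 d2 \<subseteq> B"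
    using AB open_contains_ball by (metis mem_Sigma_iff)
  define \<delta> where "\<delta> = min (\<rho> / 4) (min d1 d2)"
  have \<delta>: "\<delta> > 0" using \<rho> d12 by (simp add: \<delta>_def)
  have ball_b0: "a \<noteq> 0 \<and> norm a < \<rho>" if "a \<in> ball b0 \<delta>" for a
  proof -
    have "norm (b0 - a) < \<rho> / 4" using that by (simp add: \<delta>_def dist_norm)
    with norm_triangle_ineq2[of b0 a] norm_triangle_ineq2[of a b0] b0 \<rho> show ?thesis
      by (auto simp: norm_minus_commute)
  qed
  have good: "(a + b) / 2 \<in> ball 0 R" "(a - b) / 2 \<in> ball 0 R" "s ((a + b) / 2) \<noteq> 0" "s a \<noteq> 0" "a \<in> ball 0 R"
       "addN_mid a b \<noteq> 0" "a \<noteq> b \<Longrightarrow> s ((a - b) / 2) \<noteq> 0"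
    if "a \<in> ball b0 \<delta>" "b \<in> ball b0 \<delta>" for a b
  proof -
    have u: "(a + b) / 2 \<in> ball b0 \<delta>"
      using convexD[OF convex_ball that, of "1/2" "1/2"] by (simp add: scaleR_conv_of_real field_simps)
    have "norm (a - b) < 2 * \<delta>"
      using that dist_triangle2[of a b b0] by (simp add: dist_norm norm_minus_commute)
    hence v: "norm ((a - b) / 2) < \<delta>" by (simp add: norm_divide)
    moreover have "\<delta> < \<rho>" using \<rho>(1) by (simp add: \<delta>_def)
    ultimately have v2: "norm ((a - b) / 2) < \<rho>" by linarith
    show "(a + b) / 2 \<in> ball 0 R" "s ((a + b) / 2) \<noteq> 0" "s a \<noteq> 0" "a \<in> ball 0 R"
      using \<rho>(2)[of "(a + b) / 2"] ball_b0[OF u] \<rho>(2)[of a] ball_b0[OF that(1)] by simp_all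
    show "a \<noteq> b \<Longrightarrow> s ((a - b) / 2) \<noteq> 0"
      using \<rho>(2)[of "(a - b) / 2"] v v2 by simp
    show "(a - b) / 2 \<in> ball 0 R"
      using \<rho>(2)[of "(a - b) / 2"] v2 in0 by (cases "a = b") auto
    have "((a + b) / 2, (a - b) / 2) \<in> S"
      using u v d12 AB(4) by (auto simp: \<delta>_def subset_iff)
    from S(3)[OF this] show "addN_mid a b \<noteq> 0" by simp
  qed
  have ratio: "addN_ratio a b = deriv s a / s a"
    if ab: "a \<in> ball b0 \<delta>" "b \<in> ball b0 \<delta>" for a b
  proof -
    let ?Q = "\<lambda>b. addN_ratio a b"
    have cs: "continuous_on (ball 0 R) s" "continuous_on (ball 0 R) (deriv s)"
      "continuous_on (ball 0 R) (wp_num s)" "continuous_on (ball 0 R) (deriv (wp_num s))"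
      by (intro holomorphic_on_imp_continuous_on hol hol' hol_wp_num holomorphic_deriv open_ball)+
    have cont: "continuous_on (ball b0 \<delta>) ?Q"
    proof -
      have cU: "continuous_on (ball b0 \<delta>) (\<lambda>b. f ((a + b) / 2))"
        and cV: "continuous_on (ball b0 \<delta>) (\<lambda>b. f ((a - b) / 2))"
        if "continuous_on (ball 0 R) f" for f :: "complex \<Rightarrow> complex"
        using good(1,2)[OF ab(1)]
        by (auto intro!: continuous_on_compose2[OF that] continuous_intros)
      have nz: "\<forall>b\<in>ball b0 \<delta>. addN_mid a b \<noteq> 0"
        using good(6)[OF ab(1)] by blast
      show ?thesis
        using nz unfolding addN_def addNu_def addNv_def
        by (intro continuous_intros cs[THEN cU] cs[THEN cV]) simp_all
    qed
    \<comment> \<open>At b = a the half difference is 0, a zero of \<open>s\<close>, and the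
      logarithmic derivatives break down. The quotient itself is continuous there, so one
      exceptional point does no harm.\<close>
    have "\<forall>b\<in>ball b0 \<delta> - {a}. (?Q has_field_derivative 0) (at b)"
      using good[OF ab(1)] by (intro ballI DERIV_addN_quotient) auto
    then obtain c where c: "\<And>b. b \<in> ball b0 \<delta> \<Longrightarrow> ?Q b = c"
      using DERIV_zero_connected_constant[OF connected_ball open_ball _ cont, of "{a}"] by blast
    have "?Q a = deriv s a / s a"
      using good(4)[OF ab(1) ab(1)]
      by (simp add: addNu_def addNv_def addN_def wp_num_0 deriv_wp_num_0 s_0 field_simps power2_eq_square)
    with c[OF ab(1)] c[OF ab(2)] show ?thesis by simp
  qed
  have "addN_mid a b = s a * s b"
    if ab: "a \<in> ball b0 \<delta>" "b \<in> ball b0 \<delta>" for a b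
  proof -
    let ?Q = "\<lambda>a. addN_mid a b / s a"
    have "(?Q has_field_derivative 0) (at a)" if a: "a \<in> ball b0 \<delta>" for a
    proof -
      let ?u = "(a + b) / 2" and ?v = "(a - b) / 2"
      have "(?Q has_field_derivative ((1 / 2 * addNu ?u ?v + 1 / 2 * addNv ?u ?v) * s a - addN s ?u ?v * deriv s a)
             / (s a * s a)) (at a)"
        using good[OF a ab(2)]
        by (intro DERIV_divide DERIV_addN DERIV_s) (auto intro!: derivative_eq_intros)
      moreover have "(1 / 2 * addNu ?u ?v + 1 / 2 * addNv ?u ?v) * s a = addN s ?u ?v * deriv s a"
        using ratio[OF a ab(2)] good[OF a ab(2)] by (simp add: field_simps)
      ultimately show ?thesis by simp
    qed
    then obtain c where c: "\<And>a. a \<in> ball b0 \<delta> \<Longrightarrow> ?Q a = c"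
      using has_field_derivative_0_imp_constant_on[of "ball b0 \<delta>" ?Q]
      unfolding constant_on_def by auto
    have "?Q b = s b" using good(4)[OF ab(2) ab(2)]
      by (simp add: addN_def wp_num_0 s_0 power2_eq_square)
    with c[OF ab(1)] c[OF ab(2)] good(4)[OF ab] show ?thesis by (simp add: field_simps)
  qed
  moreover have "ball b0 \<delta> \<subseteq> ball 0 R" using good(5) by blast
  ultimately show ?thesis using \<delta> by (intro that[of \<delta> b0])
qed

text \<open>The identity theorem is applied in a and then in b. Half sums and half differences of
  points of the disc stay in the disc, so both sides are defined throughout.\<close>

lemma addition_formula':
  assumes "a \<in> ball 0 R" "b \<in> ball 0 R"
  shows "addN_mid a b = s a * s b"
proof -
  obtain \<delta> b0 where \<delta>: "\<delta> > 0" "ball b0 \<delta> \<subseteq> ball 0 R"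
    and eq: "\<And>a b. a \<in> ball b0 \<delta> \<Longrightarrow> b \<in> ball b0 \<delta> \<Longrightarrow> addN_mid a b = s a * s b"
    using addition_formula_local by metis
  have comp: "(\<lambda>x. f (h x)) holomorphic_on ball 0 R"
    if "f holomorphic_on ball 0 R" "h holomorphic_on ball 0 R" "\<And>x. x \<in> ball 0 R \<Longrightarrow> h x \<in> ball 0 R"
    for f h :: "complex \<Rightarrow> complex"
    using holomorphic_on_compose_gen[OF that(2,1)] image_subsetI[of "ball 0 R" h, OF that(3)] by (simp add: o_def)
  have holA: "(\<lambda>a. addN_mid a b) holomorphic_on ball 0 R"
    and holB: "(\<lambda>b. addN_mid a b) holomorphic_on ball 0 R"
    if "b \<in> ball 0 R" "a \<in> ball 0 R" for a b
  proof -
    note halves = half_sum_in_ball[OF _ that(1)] half_sum_in_ball[OF that(2)]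
    show "(\<lambda>a. addN_mid a b) holomorphic_on ball 0 R"
      "(\<lambda>b. addN_mid a b) holomorphic_on ball 0 R"
      unfolding addN_def by (intro holomorphic_intros comp[OF hol] comp[OF hol_wp_num] halves; simp)+
  qed
  have 1: "addN_mid a b = s a * s b" if "a \<in> ball 0 R" "b \<in> ball b0 \<delta>" for a b
  proof (rule analytic_continuation_open[where f = "\<lambda>a. addN_mid a b" and g = "\<lambda>a. s a * s b"])
    show "(\<lambda>a. addN_mid a b) holomorphic_on ball 0 R"
      using that \<delta> by (intro holA[of _ 0]) (auto simp: R_pos)
  qed (use \<delta> that eq in \<open>auto intro!: holomorphic_intros hol\<close>)
  show ?thesis
  proof (rule analytic_continuation_open[where f = "\<lambda>b. addN_mid a b" and g = "\<lambda>b. s a * s b"])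
    show "(\<lambda>b. addN_mid a b) holomorphic_on ball 0 R"
      using assms by (intro holB[of 0]) (auto simp: R_pos)
  qed (use \<delta> assms 1 in \<open>auto intro!: holomorphic_intros hol\<close>)
qed

lemma addition_formula:
  assumes "u + v \<in> ball 0 R" "u - v \<in> ball 0 R"
  shows "s (u + v) * s (u - v) = addN s u v"
  using addition_formula'[OF assms] by simp

text \<open>Letting v tend to u in the addition formula amounts to differentiating in b at b = 0
  with a = 2u. The left side becomes s(2u) s'(0) = s(2u), and the right side is half the difference
  of the partial derivatives of \<open>addN\<close> at (u, u).\<close>

lemma duplication_formula:
  assumes "2 * u \<in> ball 0 R"
  shows "s (2 * u) = 2 * s u * deriv s u * wp_num s u - deriv (wp_num s) u * (s u)^2"
proof -
  have u: "u \<in> ball 0 R"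
    using half_sum_in_ball(1)[OF assms assms] half_sum_in_ball(1)[OF assms, of 0] R_pos by simp
  let ?f = "\<lambda>b. addN s ((2 * u + b) / 2) ((2 * u - b) / 2)"
  have "(?f has_field_derivative 1 / 2 * addNu ((2 * u + 0) / 2) ((2 * u - 0) / 2)
         + (- 1 / 2) * addNv ((2 * u + 0) / 2) ((2 * u - 0) / 2)) (at 0)"
    by (rule DERIV_addN) (use u in \<open>auto intro!: derivative_eq_intros\<close>)
  moreover have ev: "\<forall>\<^sub>F b in nhds 0. ?f b = s (2 * u) * s b"
  proof -
    have "\<forall>\<^sub>F b in nhds 0. b \<in> ball 0 R" using R_pos by (intro eventually_nhds_in_open) auto
    thus ?thesis by eventually_elim (rule addition_formula'[OF assms])
  qed
  ultimately have "((\<lambda>b. s (2 * u) * s b) has_field_derivative 1 / 2 * addNu u u + (- 1 / 2) * addNv u u) (at 0)"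
    using DERIV_cong_ev[OF refl ev refl] by simp
  moreover have "((\<lambda>b. s (2 * u) * s b) has_field_derivative s (2 * u) * deriv s 0) (at 0)"
    using R_pos by (intro DERIV_cmult DERIV_s) auto
  ultimately have "s (2 * u) * deriv s 0 = 1 / 2 * addNu u u + (- 1 / 2) * addNv u u"
    by (rule DERIV_unique[symmetric])
  thus ?thesis by (simp add: s'_0 addNu_def addNv_def algebra_simps)
qed

end

subsection \<open>The entire sigma function\<close>

definition dup :: "(complex \<Rightarrow> complex) \<Rightarrow> complex \<Rightarrow> complex" where
  "dup s u = 2 * s u * deriv s u * wp_num s u - deriv (wp_num s) u * (s u)^2"

lemma deriv_cong_eventually:
  assumes "\<forall>\<^sub>F w in nhds u. s w = t w"
  shows "\<forall>\<^sub>F w in nhds u. deriv s w = deriv t w"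
proof -
  from assms have "\<forall>\<^sub>F w in nhds u. \<forall>\<^sub>F w in nhds w. s w = t w"
    by (simp add: eventually_eventually)
  thus ?thesis by eventually_elim (rule deriv_cong_ev, auto)
qed

lemma wp_num_cong_eventually:
  assumes "\<forall>\<^sub>F w in nhds u. s w = t w"
  shows "\<forall>\<^sub>F w in nhds u. wp_num s w = wp_num t w"
  using assms deriv_cong_eventually[OF assms] deriv_cong_eventually[OF deriv_cong_eventually[OF assms]]
  by eventually_elim (simp add: wp_num_def)

lemma wp_of_cong_eventually:
  assumes "\<forall>\<^sub>F w in nhds u. s w = t w"
  shows "\<forall>\<^sub>F w in nhds u. wp_of s w = wp_of t w"
  using assms deriv_cong_eventually[OF assms] deriv_cong_eventually[OF deriv_cong_eventually[OF assms]]
  by eventually_elim (simp add: wp_of_def)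

lemma dup_cong:
  assumes "\<forall>\<^sub>F w in nhds u. s w = t w"
  shows "dup s u = dup t u"
  using eventually_nhds_x_imp_x[OF assms] eventually_nhds_x_imp_x[OF deriv_cong_eventually[OF assms]]
    eventually_nhds_x_imp_x[OF wp_num_cong_eventually[OF assms]]
    eventually_nhds_x_imp_x[OF deriv_cong_eventually[OF wp_num_cong_eventually[OF assms]]]
  by (simp add: dup_def)

lemma wp_ode_cong:
  assumes "\<forall>\<^sub>F w in nhds u. p w = q w"
  shows "wp_ode g2 g3 p u \<longleftrightarrow> wp_ode g2 g3 q u"
  using eventually_nhds_x_imp_x[OF assms] eventually_nhds_x_imp_x[OF deriv_cong_eventually[OF assms]]
    eventually_nhds_x_imp_x[OF deriv_cong_eventually[OF deriv_cong_eventually[OF assms]]]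
  by (simp add: wp_ode_def)

lemma holomorphic_wp_num: "open A \<Longrightarrow> s holomorphic_on A \<Longrightarrow> wp_num s holomorphic_on A"
  unfolding wp_num_def by (intro holomorphic_intros holomorphic_deriv)

lemma holomorphic_dup: "open A \<Longrightarrow> s holomorphic_on A \<Longrightarrow> dup s holomorphic_on A"
  unfolding dup_def by (intro holomorphic_intros holomorphic_deriv holomorphic_wp_num)

context local_sigma
begin

lemma has_fps_expansion_s: "s has_fps_expansion fps_expansion s 0"
  using R_pos hol by (intro analytic_at_imp_has_fps_expansion_0) (auto simp: analytic_at intro!: exI[of _ "ball 0 R"])

lemma eval_fps_expansion_s: "u \<in> ball 0 R \<Longrightarrow> eval_fps (fps_expansion s 0) u = s u"
  by (rule has_fps_expansion_imp_eval_fps_eq[OF has_fps_expansion_s _ hol]) simp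

text \<open>If the radius of convergence were finite, the duplication formula would double it.\<close>
lemma conv_radius_infinite: "fps_conv_radius (fps_expansion s 0) = \<infinity>"
proof (rule ccontr)
  define F where "F = fps_expansion s 0"
  assume "fps_conv_radius (fps_expansion s 0) \<noteq> \<infinity>"
  moreover have "fps_conv_radius F > 0"
    using has_fps_expansion_s by (simp add: has_fps_expansion_def F_def)
  ultimately obtain C where C: "fps_conv_radius F = ereal C" "C > 0"
    by (cases "fps_conv_radius F") (auto simp: F_def)
  define S where "S = eval_fps F"
  have hol_S: "S holomorphic_on ball 0 C"
    unfolding S_def by (intro holomorphic_on_eval_fps) (simp add: C)
  define f where "f = (\<lambda>u. dup S (u / 2))"
  have "(dup S \<circ> (\<lambda>u. u / 2)) holomorphic_on ball 0 (2 * C)"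
    by (intro holomorphic_on_compose_gen[OF _ holomorphic_dup[OF open_ball hol_S]] holomorphic_intros)
      (auto simp: norm_divide)
  hence hol_f: "f holomorphic_on ball 0 (2 * C)" by (simp add: f_def o_def)
  have "\<forall>\<^sub>F u in nhds 0. u \<in> ball 0 R"
    using R_pos by (intro eventually_nhds_in_open) auto
  hence "\<forall>\<^sub>F u in nhds 0. s u = f u"
  proof eventually_elim
    case (elim u)
    have u2: "u / 2 \<in> ball 0 R" using elim norm_ge_zero[of u] by (simp add: norm_divide del: norm_ge_zero)
    have "\<forall>\<^sub>F w in nhds (u / 2). w \<in> ball 0 R"
      using u2 by (intro eventually_nhds_in_open) auto
    hence "\<forall>\<^sub>F w in nhds (u / 2). s w = S w"
      by eventually_elim (simp add: S_def F_def eval_fps_expansion_s)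
    from dup_cong[OF this] show ?case
      using duplication_formula[of "u / 2"] elim by (simp add: f_def dup_def)
  qed
  hence "f has_fps_expansion F"
    using has_fps_expansion_s has_fps_expansion_cong[of s f F F] by (simp add: F_def)
  hence "fps_conv_radius F \<ge> ereal (2 * C)"
    using hol_f by (intro holomorphic_on_imp_fps_conv_radius_ge) auto
  thus False using C by simp
qed

end

text \<open>Summing the Taylor series continues \<open>sigma_loc\<close>, whose exponential formula
  is confined to the disc where \<open>sigma_log\<close> converges: the exponential never vanishes
  and cannot produce the other zeros of \<sigma>.\<close>

definition wsigma :: "complex \<Rightarrow> complex \<Rightarrow> complex \<Rightarrow> complex" where
  "wsigma g2 g3 = eval_fps (fps_expansion (sigma_loc g2 g3) 0)"

lemma sigma_local:
  obtains r where "r > 0" "local_sigma g2 g3 (sigma_loc g2 g3) r"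
    "\<And>u. u \<in> ball 0 r \<Longrightarrow> wsigma g2 g3 u = sigma_loc g2 g3 u"
    "\<And>u. u \<in> ball 0 r - {0} \<Longrightarrow> sigma_loc g2 g3 u \<noteq> 0"
    "((\<lambda>u. deriv (sigma_loc g2 g3) u / sigma_loc g2 g3 u - 1 / u) \<longlongrightarrow> 0) (at 0)"
proof -
  obtain r where r: "r > 0" "sigma_loc g2 g3 holomorphic_on ball 0 r"
    "deriv (sigma_loc g2 g3) 0 = 1" "deriv (deriv (sigma_loc g2 g3)) 0 = 0"
    "((\<lambda>u. deriv (sigma_loc g2 g3) u / sigma_loc g2 g3 u - 1 / u) \<longlongrightarrow> 0) (at 0)"
    "\<And>u. u \<in> ball 0 r - {0} \<Longrightarrow> sigma_loc g2 g3 u \<noteq> 0"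
    "\<And>u. u \<in> ball 0 r - {0} \<Longrightarrow> wp_ode g2 g3 (wp_of (sigma_loc g2 g3)) u"
    by (rule sigma_loc_ode) blast
  interpret local_sigma g2 g3 "sigma_loc g2 g3" r
  proof
    show 0: "sigma_loc g2 g3 0 = 0" by (simp add: sigma_loc_def)
    show "wp_ode g2 g3 (wp_of (sigma_loc g2 g3)) u" if "u \<in> ball 0 r" "sigma_loc g2 g3 u \<noteq> 0" for u
      using that 0 by (intro r) auto
  qed (use r in auto)
  show ?thesis
    by (rule that[OF r(1) local_sigma_axioms]) (use eval_fps_expansion_s r in \<open>auto simp: wsigma_def\<close>)
qed

lemma holomorphic_sigma: "wsigma g2 g3 holomorphic_on A"
proof -
  obtain r where "local_sigma g2 g3 (sigma_loc g2 g3) r" by (rule sigma_local)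
  then interpret local_sigma g2 g3 "sigma_loc g2 g3" r .
  have "wsigma g2 g3 holomorphic_on UNIV"
    unfolding wsigma_def by (intro holomorphic_on_eval_fps) (simp add: conv_radius_infinite)
  thus ?thesis by (rule holomorphic_on_subset) simp
qed

lemma wp_ode_analytic_continuation:
  assumes "open \<Omega>" "connected \<Omega>" "p holomorphic_on \<Omega>" "open P" "P \<noteq> {}" "P \<subseteq> \<Omega>"
    and P: "\<And>u. u \<in> P \<Longrightarrow> wp_ode g2 g3 p u" and "u \<in> \<Omega>"
  shows "wp_ode g2 g3 p u"
proof -
  note [holomorphic_intros] = assms(3) holomorphic_deriv[OF assms(3,1)]
    holomorphic_deriv[OF holomorphic_deriv[OF assms(3,1)] assms(1)]
  have "(deriv p u)^2 = 4 * p u ^ 3 - g2 * p u - g3"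
    by (rule analytic_continuation_open[OF assms(4,1,5,2,6), where f = "\<lambda>u. (deriv p u)^2"])
      (use P assms in \<open>auto simp: wp_ode_def intro!: holomorphic_intros\<close>)
  moreover have "deriv (deriv p) u = 6 * (p u)^2 - g2 / 2"
    by (rule analytic_continuation_open[OF assms(4,1,5,2,6), where f = "\<lambda>u. deriv (deriv p) u"])
      (use P assms in \<open>auto simp: wp_ode_def intro!: holomorphic_intros\<close>)
  ultimately show ?thesis by (simp add: wp_ode_def)
qed

text \<open>The data at the origin are inherited from \<open>sigma_loc\<close>. The differential
  equation spreads from a punctured disc to the complement of the zeros, which is connected because
  an entire non-constant function has only countably many zeros.\<close>

lemma sigma_jet_0: "wsigma g2 g3 0 = 0" "deriv (wsigma g2 g3) 0 = 1" "deriv (deriv (wsigma g2 g3)) 0 = 0"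
  and sigma_zeta_limit: "((\<lambda>u. deriv (wsigma g2 g3) u / wsigma g2 g3 u - 1 / u) \<longlongrightarrow> 0) (at 0)"
  and countable_sigma_zeros: "countable {u. wsigma g2 g3 u = 0}"
  and sigma_ode: "wsigma g2 g3 u \<noteq> 0 \<Longrightarrow> wp_ode g2 g3 (wp_of (wsigma g2 g3)) u"
proof -
  obtain r where r: "r > 0" "local_sigma g2 g3 (sigma_loc g2 g3) r"
    and eq: "\<And>u. u \<in> ball 0 r \<Longrightarrow> wsigma g2 g3 u = sigma_loc g2 g3 u"
    and nz: "\<And>u. u \<in> ball 0 r - {0} \<Longrightarrow> sigma_loc g2 g3 u \<noteq> 0"
    and zeta: "((\<lambda>u. deriv (sigma_loc g2 g3) u / sigma_loc g2 g3 u - 1 / u) \<longlongrightarrow> 0) (at 0)"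
    by (rule sigma_local) blast
  interpret local_sigma g2 g3 "sigma_loc g2 g3" r by (rule r(2))
  have ev: "\<forall>\<^sub>F w in nhds u. wsigma g2 g3 w = sigma_loc g2 g3 w" if "u \<in> ball 0 r" for u
    using eventually_nhds_in_open[OF open_ball that] by eventually_elim (rule eq)
  have in0: "0 \<in> ball 0 r" using r by simp
  show 0: "wsigma g2 g3 0 = 0" "deriv (wsigma g2 g3) 0 = 1" "deriv (deriv (wsigma g2 g3)) 0 = 0"
    using eventually_nhds_x_imp_x[OF ev[OF in0]] eventually_nhds_x_imp_x[OF deriv_cong_eventually[OF ev[OF in0]]]
      eventually_nhds_x_imp_x[OF deriv_cong_eventually[OF deriv_cong_eventually[OF ev[OF in0]]]]
      s_0 s'_0 s''_0 by auto
  have "\<forall>\<^sub>F u in at 0. deriv (sigma_loc g2 g3) u / sigma_loc g2 g3 u - 1 / u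
      = deriv (wsigma g2 g3) u / wsigma g2 g3 u - 1 / u"
    using eventually_nhds_conv_at[THEN iffD1, THEN conjunct1, OF ev[OF in0]]
      eventually_nhds_conv_at[THEN iffD1, THEN conjunct1, OF deriv_cong_eventually[OF ev[OF in0]]]
    by (auto elim: eventually_elim2)
  with zeta show "((\<lambda>u. deriv (wsigma g2 g3) u / wsigma g2 g3 u - 1 / u) \<longlongrightarrow> 0) (at 0)"
    by (rule Lim_transform_eventually)
  define \<Omega> where "\<Omega> = - {u. wsigma g2 g3 u = 0}"
  note hol = holomorphic_sigma[of g2 g3 UNIV]
  have "closed {u. wsigma g2 g3 u = 0}"
    using closed_Collect_eq[OF holomorphic_on_imp_continuous_on[OF hol] continuous_on_const, of 0] by simp
  hence "open \<Omega>" by (simp add: \<Omega>_def open_Compl)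
  have "\<not> wsigma g2 g3 constant_on UNIV"
  proof
    assume "wsigma g2 g3 constant_on UNIV"
    then obtain c where "wsigma g2 g3 = (\<lambda>_. c)" by (auto simp: constant_on_def)
    hence "deriv (wsigma g2 g3) 0 = 0" by simp
    with 0 show False by simp
  qed
  hence "countable {u \<in> UNIV. wsigma g2 g3 u = 0}"
    by (intro holomorphic_countable_zeros hol) auto
  thus countable: "countable {u. wsigma g2 g3 u = 0}" by simp
  hence "connected \<Omega>"
    using connected_open_diff_countable[of UNIV "{u. wsigma g2 g3 u = 0}"] connected_UNIV
    by (simp add: \<Omega>_def Compl_eq_Diff_UNIV)
  have "wp_of (wsigma g2 g3) holomorphic_on \<Omega>"
    unfolding wp_of_def
    by (intro holomorphic_intros holomorphic_sigma holomorphic_deriv \<open>open \<Omega>\<close>) (auto simp: \<Omega>_def)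
  show "wp_ode g2 g3 (wp_of (wsigma g2 g3)) u" if u: "wsigma g2 g3 u \<noteq> 0"
  proof (rule wp_ode_analytic_continuation[OF \<open>open \<Omega>\<close> \<open>connected \<Omega>\<close> \<open>_ holomorphic_on \<Omega>\<close>])
    show "wp_ode g2 g3 (wp_of (wsigma g2 g3)) u" if "u \<in> ball 0 r - {0}" for u
      using wp_ode_cong[OF wp_of_cong_eventually[OF ev]] ode nz that by simp
    show "ball 0 r - {0} \<noteq> ({} :: complex set)"
    proof -
      have "of_real (r / 2) \<in> ball 0 r - {0::complex}" using r by simp
      thus ?thesis by blast
    qed
  qed (use nz eq u in \<open>auto simp: \<Omega>_def\<close>)
qed

lemma local_sigma_sigma: "R > 0 \<Longrightarrow> local_sigma g2 g3 (wsigma g2 g3) R"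
  by unfold_locales (auto simp: holomorphic_sigma sigma_jet_0 intro: sigma_ode)

lemma sigma_addition: "wsigma g2 g3 (u + v) * wsigma g2 g3 (u - v) = addN (wsigma g2 g3) u v"
proof -
  interpret local_sigma g2 g3 "wsigma g2 g3" "norm (u + v) + norm (u - v) + 1"
    by (rule local_sigma_sigma) (simp add: add_nonneg_pos)
  show ?thesis by (rule addition_formula) (simp_all add: add_nonneg_pos)
qed

lemma sigma_duplication: "wsigma g2 g3 (2 * u) = dup (wsigma g2 g3) u"
proof -
  interpret local_sigma g2 g3 "wsigma g2 g3" "norm (2 * u) + 1"
    by (rule local_sigma_sigma) (simp add: add_nonneg_pos)
  show ?thesis unfolding dup_def by (rule duplication_formula) simp
qed

section \<open>Holomorphy of the entire sigma function in its argument and the invariants\<close>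

lemma holo3_half:
  assumes "holo3 (A \<times> B \<times> ball 0 R) f"
  shows "holo3 (A \<times> B \<times> ball 0 (2 * R)) (\<lambda>x y z. f x y (z / 2))"
  unfolding holo3_def
proof (intro conjI allI impI)
  have "open (A \<times> B \<times> ball (0::complex) R)" using assms by (simp add: holo3_def)
  hence "open ((\<lambda>p. (fst p, fst (snd p), snd (snd p) / 2)) -` (A \<times> B \<times> ball (0::complex) R))"
    by (intro open_vimage continuous_intros) auto
  also have "(\<lambda>p. (fst p, fst (snd p), snd (snd p) / 2)) -` (A \<times> B \<times> ball (0::complex) R) = A \<times> B \<times> ball 0 (2 * R)"
    by (auto simp: norm_divide)
  finally show "open (A \<times> B \<times> ball (0::complex) (2 * R))" .
  have "continuous_on (A \<times> B \<times> ball 0 (2 * R)) ((\<lambda>(x, y, z). f x y z) \<circ> (\<lambda>p. (fst p, fst (snd p), snd (snd p) / 2)))"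
    using assms unfolding holo3_def
    by (intro continuous_on_compose continuous_intros) (auto elim!: continuous_on_subset simp: norm_divide)
  thus "continuous_on (A \<times> B \<times> ball 0 (2 * R)) (\<lambda>(x, y, z). f x y (z / 2))"
    by (simp add: o_def case_prod_unfold)
  fix x y z a b c :: complex assume "(x, y, z) \<in> A \<times> B \<times> ball 0 (2 * R)"
  hence "(x + 0 * a, y + 0 * b, z / 2 + 0 * (c / 2)) \<in> A \<times> B \<times> ball 0 R" by (simp add: norm_divide)
  from holo3_line[OF assms this]
  show "(\<lambda>h. f (x + h * a) (y + h * b) ((z + h * c) / 2)) field_differentiable at 0"
    by (simp add: add_divide_distrib)
qed

lemma holo3_wp_num:
  assumes "holo3 D (\<lambda>g2 g3. s g2 g3)"
  shows "holo3 D (\<lambda>g2 g3. wp_num (s g2 g3))"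
  unfolding wp_num_def
  by (intro holo3_diff holo3_mult holo3_power assms holo3_deriv)

lemma holo3_dup:
  assumes "holo3 D (\<lambda>g2 g3. s g2 g3)"
  shows "holo3 D (\<lambda>g2 g3. dup (s g2 g3))"
proof -
  have "holo3 D (\<lambda>g2 g3 u. 2)" using assms by (intro holo3_const) (simp add: holo3_def)
  thus ?thesis unfolding dup_def
    by (intro holo3_diff holo3_mult holo3_power assms holo3_deriv holo3_wp_num)
qed

text \<open>Being entire in u says nothing about the invariants. For fixed \<rho> the u-disc is
  doubled with each k: \<open>dup\<close> takes only derivatives in u, products and differences, all
  of which preserve joint holomorphy. The polydiscs \<open>D \<rho> k\<close> cover the whole
  space.\<close>

lemma holo3_sigma: "holo3 UNIV wsigma"
proof -
  define r where "r = (\<lambda>\<rho>. sqrt (1 / (2 * \<rho>)) :: real)"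
  define D where "D = (\<lambda>\<rho> k. ball 0 (20 * \<rho> ^ 2) \<times> ball 0 (28 * \<rho> ^ 3) \<times> ball 0 (2 ^ k * r \<rho>) :: (complex \<times> complex \<times> complex) set)"
  have "holo3 (D \<rho> k) wsigma" if \<rho>: "\<rho> > 0" for \<rho> k
  proof (induction k)
    case 0
    have "r \<rho> > 0" using \<rho> by (simp add: r_def)
    have "open (D \<rho> 0)" by (auto simp: D_def intro!: open_Times)
    have "holo3 (D \<rho> 0) (\<lambda>g2 g3 u. u * exp (0 - eval_fps (sigma_log g2 g3) (u^2)))"
      by (intro holo3_mult holo3_exp holo3_proj holo3_diff holo3_const \<open>open (D \<rho> 0)\<close>)
        (use holo3_sigma_log[OF \<rho>] in \<open>simp add: D_def r_def\<close>)
    hence *: "holo3 (D \<rho> 0) sigma_loc"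
      by (simp add: sigma_loc_def[abs_def])
    have "sigma_loc g2 g3 u = wsigma g2 g3 u" if "(g2, g3, u) \<in> D \<rho> 0" for g2 g3 u
    proof -
      obtain r' where r': "r' > 0" "\<And>u. u \<in> ball 0 r' \<Longrightarrow> wsigma g2 g3 u = sigma_loc g2 g3 u"
        by (rule sigma_local) blast
      show ?thesis
      proof (rule analytic_continuation_open[where s = "ball 0 (min r' (r \<rho>))" and s' = "ball 0 (r \<rho>)"
            and f = "sigma_loc g2 g3" and g = "wsigma g2 g3"])
        show "sigma_loc g2 g3 holomorphic_on ball 0 (r \<rho>)"
          using that
          by (intro holomorphic_onI field_differentiable_at_within[OF holo3_partials(3)[OF *]]) (auto simp: D_def)
      qed (use that r' \<open>r \<rho> > 0\<close> holomorphic_sigma in \<open>auto simp: D_def min_le_iff_disj\<close>)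
    qed
    with * show ?case by (rule holo3_cong)
  next
    case (Suc k)
    have "holo3 (D \<rho> (Suc k)) (\<lambda>g2 g3 u. dup (wsigma g2 g3) (u / 2))"
      using holo3_half[OF holo3_dup[OF Suc.IH, unfolded D_def]] by (simp add: D_def mult.assoc)
    thus ?case by (rule holo3_cong) (simp flip: sigma_duplication)
  qed
  hence "holo3 (\<Union>{D \<rho> k |\<rho> k. \<rho> > 0}) wsigma"
    by (intro holo3_Union) auto
  also have "\<Union>{D \<rho> k |\<rho> k. \<rho> > 0} = UNIV"
  proof (intro equalityI subsetI UNIV_I)
    fix p :: "complex \<times> complex \<times> complex"
    obtain g2 g3 u where p: "p = (g2, g3, u)" by (cases p)
    obtain \<rho> where \<rho>: "\<rho> > 0" "norm g2 < 20 * \<rho> ^ 2" "norm g3 < 28 * \<rho> ^ 3" by (rule wp_bound_exists)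
    have "r \<rho> > 0" using \<rho> by (simp add: r_def)
    obtain k where "norm u / r \<rho> < 2 ^ k" using real_arch_pow[of 2 "norm u / r \<rho>"] by auto
    hence "norm u < 2 ^ k * r \<rho>" using \<open>r \<rho> > 0\<close> by (simp add: field_simps)
    hence "p \<in> D \<rho> k" using p \<rho> by (simp add: D_def)
    thus "p \<in> \<Union>{D \<rho> k |\<rho> k. \<rho> > 0}" using \<rho> by blast
  qed
  finally show ?thesis .
qed

subsection \<open>Identification with the Weierstrass functions\<close>

text \<open>The difference is merely meromorphic, and its values at poles of f and g are
  meaningless. After its singularities are removed, the identity theorem makes it vanish, so f and g
  agree near every point; the convention for nicely meromorphic functions then fixes their values at
  the point itself.\<close>

lemma nicely_meromorphic_eqI:
  assumes f: "f nicely_meromorphic_on UNIV" and g: "g nicely_meromorphic_on UNIV"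
    and eq: "\<forall>\<^sub>F u in at z0. f u = g u"
  shows "f = g"
proof
  fix a
  define h where "h = (\<lambda>u. f u - g u)"
  have h: "h meromorphic_on UNIV"
    using f g unfolding h_def nicely_meromorphic_on_def by (intro meromorphic_intros) auto
  have iso: "isolated_singularity_at h z" for z
    using meromorphic_on_subset[OF h] by (intro meromorphic_on_isolated_singularity) auto
  have "\<forall>\<^sub>F u in at z0. remove_sings h u = 0"
    using eventually_remove_sings_eq_at[OF iso[of z0]] eq
    by eventually_elim (simp add: h_def)
  hence "\<exists>\<^sub>F u in at z0. remove_sings h u = 0"
    by (intro eventually_frequently) auto
  from frequently_eq_meromorphic_imp_constant[OF this remove_sings_nicely_meromorphic[OF h]]
  have "remove_sings h u = 0" for u by auto
  hence ev: "\<forall>\<^sub>F u in at a. f u = g u"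
    using eventually_remove_sings_eq_at[OF iso[of a]] by (auto simp: h_def elim: eventually_mono)
  have "is_pole f a \<longleftrightarrow> is_pole g a" by (rule is_pole_cong[OF ev refl])
  moreover have "is_pole f a \<and> f a = 0 \<or> f \<midarrow>a\<rightarrow> f a" "is_pole g a \<and> g a = 0 \<or> g \<midarrow>a\<rightarrow> g a"
    using f g by (auto simp: nicely_meromorphic_on_def)
  moreover have False if "is_pole k a" "k \<midarrow>a\<rightarrow> c" for k and c :: complex
    using that not_tendsto_and_filterlim_at_infinity[of "at a" k c] by (auto simp: is_pole_def)
  moreover have "f a = g a" if "f \<midarrow>a\<rightarrow> f a" "g \<midarrow>a\<rightarrow> g a"
    using Lim_transform_eventually[OF that(1) ev] that(2) by (metis LIM_unique)
  ultimately show "f a = g a" by metis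
qed

section \<open>Uniqueness for the Weierstrass equation at the pole\<close>

lemma fps_mult_nth_cong:
  assumes "\<And>k. k \<le> n \<Longrightarrow> fps_nth F k = fps_nth G k" "\<And>k. k \<le> n \<Longrightarrow> fps_nth H k = fps_nth K k" "m \<le> n"
  shows "fps_nth (F * H) m = fps_nth (G * K) m"
  unfolding fps_mult_nth using assms by (intro sum.cong) auto

text \<open>The coefficient of index m + 2, times (m+1)(m+2), is a polynomial in the coefficients up
  to m.\<close>

lemma fps_ode_unique:
  fixes F G :: "complex fps"
  assumes F: "fps_deriv (fps_deriv F) = fps_const a + fps_const b * F ^ 2 + fps_const c * F ^ 3"
    and G: "fps_deriv (fps_deriv G) = fps_const a + fps_const b * G ^ 2 + fps_const c * G ^ 3"
    and init: "fps_nth F 0 = fps_nth G 0" "fps_nth F 1 = fps_nth G 1"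
  shows "F = G"
proof (rule fps_ext)
  fix n
  show "fps_nth F n = fps_nth G n"
  proof (induction n rule: less_induct)
    case (less n)
    consider "n = 0" | "n = 1" | m where "n = Suc (Suc m)" by (metis One_nat_def not0_implies_Suc)
    thus ?case
    proof cases
      case (3 m)
      have FG: "fps_nth F k = fps_nth G k" if "k \<le> m" for k using 3 that by (intro less) auto
      have "fps_nth (F ^ 2) k = fps_nth (G ^ 2) k" if "k \<le> m" for k
        unfolding power2_eq_square using that by (intro fps_mult_nth_cong[of m] FG)
      moreover from this have "fps_nth (F ^ 3) m = fps_nth (G ^ 3) m"
        unfolding power3_eq_cube power2_eq_square by (intro fps_mult_nth_cong[of m] FG) auto
      ultimately have "fps_nth (fps_deriv (fps_deriv F)) m = fps_nth (fps_deriv (fps_deriv G)) m"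
        by (simp add: F G)
      hence "of_nat (m + 1) * of_nat (m + 2) * fps_nth F n = of_nat (m + 1) * of_nat (m + 2) * fps_nth G n"
        using 3 by (simp add: algebra_simps)
      moreover have "of_nat (m + 1) * of_nat (m + 2) \<noteq> (0 :: complex)"
        by (metis add_is_0 mult_eq_0_iff of_nat_eq_0_iff one_neq_zero zero_neq_numeral)
      ultimately show ?thesis by (metis mult_left_cancel)
    qed (use init in auto)
  qed
qed

text \<open>In terms of $y = 1/\wp$ the equation becomes regular at the origin:
  $y'^2 = 4y - g_2 y^3 - g_3 y^4$.\<close>
lemma wp_equation_unique_near_0:
  fixes g2 g3 :: complex
  assumes p: "p nicely_meromorphic_on UNIV" "is_pole p 0"
    and ode: "\<And>u. \<not> is_pole p u \<Longrightarrow> (deriv p u)^2 = 4 * p u ^ 3 - g2 * p u - g3"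
  obtains F where "(\<lambda>u. inverse (p u)) has_fps_expansion F" "fps_nth F 0 = 0" "fps_nth F 1 = 0"
    "fps_deriv (fps_deriv F) = fps_const 2 + fps_const (- 3 / 2 * g2) * F ^ 2 + fps_const (- 2 * g3) * F ^ 3"
proof -
  have mero: "p meromorphic_on UNIV" using p(1) by (simp add: nicely_meromorphic_on_def)
  have p0: "p 0 = 0"
    using p not_tendsto_and_filterlim_at_infinity[of "at 0" p "p 0"]
    by (auto simp: nicely_meromorphic_on_def is_pole_def)
  have "isolated_singularity_at p 0"
    using meromorphic_on_subset[OF mero] by (intro meromorphic_on_isolated_singularity) auto
  hence "\<forall>\<^sub>F u in at 0. p analytic_on {u}" by (rule isolated_singularity_at_altdef[THEN iffD1])
  hence "\<forall>\<^sub>F u in at 0. p analytic_on {u} \<and> p u \<noteq> 0"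
    using non_zero_neighbour_pole[OF p(2)] by (rule eventually_conj)
  then obtain r where r: "r > 0" "\<And>u. u \<noteq> 0 \<Longrightarrow> dist u 0 < r \<Longrightarrow> p analytic_on {u} \<and> p u \<noteq> 0"
    unfolding eventually_at by blast
  define B where "B = ball (0::complex) r"
  have B: "open B" "0 \<in> B" using r by (auto simp: B_def)
  have an: "p analytic_on {u}" "p u \<noteq> 0" if "u \<in> B - {0}" for u
    using r(2)[of u] that by (auto simp: B_def)
  have hol_p: "p holomorphic_on B - {0}"
    using an(1) by (meson analytic_imp_holomorphic analytic_on_analytic_at)
  define y where "y = (\<lambda>u. inverse (p u))"
  have "(\<lambda>u. if u = 0 then 0 else inverse (p u)) holomorphic_on B"
    by (rule is_pole_inverse_holomorphic[OF B(1) hol_p p(2)]) (use an in auto)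
  also have "(\<lambda>u. if u = 0 then 0 else inverse (p u)) = y" by (auto simp: y_def p0)
  finally have hol_y: "y holomorphic_on B" .
  hence "y analytic_on {0}" using B by (auto simp: analytic_at)
  define F where "F = fps_expansion y 0"
  have yF: "y has_fps_expansion F"
    unfolding F_def by (rule analytic_at_imp_has_fps_expansion_0) fact
  have y0: "y 0 = 0" by (simp add: y_def p0)
  have F0: "fps_nth F 0 = 0" using fps_nth_fps_expansion[OF yF, of 0] y0 by simp
  define d where "d = (\<lambda>u. (deriv y u) ^ 2 - (4 * y u - g2 * y u ^ 3 - g3 * y u ^ 4))"
  have d: "d u = 0" if u: "u \<in> B - {0}" for u
  proof -
    have "p field_differentiable at u" using an[OF u] by (simp add: analytic_on_imp_differentiable_at)
    hence "(y has_field_derivative - (deriv p u / (p u)^2)) (at u)"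
      unfolding y_def using an[OF u]
      by (auto intro!: derivative_eq_intros simp: DERIV_deriv_iff_field_differentiable power2_eq_square field_simps)
    hence "deriv y u = - (deriv p u / (p u)^2)" by (rule DERIV_imp_deriv)
    moreover have "(deriv p u)^2 = 4 * p u ^ 3 - g2 * p u - g3"
      using analytic_at_imp_no_pole[OF an(1)[OF u]] by (rule ode)
    ultimately have "(deriv y u)^2 = (4 * p u ^ 3 - g2 * p u - g3) / (p u) ^ 4"
      by (simp add: power_divide flip: power_mult)
    thus ?thesis using an(2)[OF u] by (simp add: d_def y_def field_simps eval_nat_numeral)
  qed
  have "d holomorphic_on B"
    unfolding d_def by (intro holomorphic_intros hol_y holomorphic_deriv B)
  hence "isCont d 0" using B by (meson continuous_on_eq_continuous_at holomorphic_on_imp_continuous_on)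
  moreover have evB: "\<forall>\<^sub>F u in at 0. u \<in> B - {0}" by (rule eventually_at_in_open[OF B])
  hence "\<forall>\<^sub>F u in at 0. 0 = d u" by eventually_elim (simp add: d)
  hence "d \<midarrow>0\<rightarrow> 0" by (rule Lim_transform_eventually[OF tendsto_const])
  ultimately have "d 0 = 0" by (metis LIM_unique isCont_def)
  hence "\<forall>\<^sub>F u in nhds 0. d u = 0"
    using eventually_nhds_in_open[OF B] by (auto elim!: eventually_mono intro: d)
  hence "d has_fps_expansion 0" by (simp add: has_fps_expansion_0_iff)
  moreover have "d has_fps_expansion (fps_deriv F) ^ 2 - (fps_const 4 * F - fps_const g2 * F ^ 3 - fps_const g3 * F ^ 4)"
    unfolding d_def by (intro fps_expansion_intros yF)
  ultimately have F1: "(fps_deriv F) ^ 2 = fps_const 4 * F - fps_const g2 * F ^ 3 - fps_const g3 * F ^ 4"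
    using fps_expansion_unique_complex by force
  have "F \<noteq> 0"
  proof
    assume "F = 0"
    hence "\<forall>\<^sub>F u in nhds 0. y u = 0" using yF by (simp add: has_fps_expansion_0_iff)
    hence "\<forall>\<^sub>F u in at 0. y u = 0" by (simp add: eventually_nhds_conv_at)
    with evB have "\<forall>\<^sub>F u in at (0::complex). False"
      by eventually_elim (use an in \<open>auto simp: y_def\<close>)
    thus False by simp
  qed
  hence dF: "fps_deriv F \<noteq> 0" using F0 by (metis fps_const_0_eq_0 fps_deriv_eq_0_iff)
  have "fps_nth ((fps_deriv F) ^ 2) 0 = 0"
    unfolding F1 using F0 by (simp add: fps_nth_power_0)
  hence "fps_nth F 1 = 0" by (simp add: fps_power_zeroth_eq_one power2_eq_square)
  \<comment> \<open>The equation for y'^2 leaves the sign of y' open and has constant solutions as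
    well. Differentiating it and cancelling 2 F' removes both; F' \<noteq> 0 holds because y
    vanishes at 0 but not identically.\<close>
  have "2 * fps_deriv F * fps_deriv (fps_deriv F) = fps_deriv ((fps_deriv F) ^ 2)"
    by (simp add: fps_deriv_power mult_ac numeral_fps_const)
  also have "\<dots> = 2 * fps_deriv F * (fps_const 2 + fps_const (- 3 / 2 * g2) * F ^ 2 + fps_const (- 2 * g3) * F ^ 3)"
  proof -
    define D h A B where "D = fps_deriv F" and "h = fps_const (3 / 2 :: complex)"
      and "A = fps_const g2" and "B = fps_const g3"
    have h: "2 * h = 3"
      by (simp add: h_def numeral_fps_const)
    have const: "fps_const (- 3 / 2 * g2) = - (h * A)" "fps_const (- 2 * g3) = - (2 * B)"
      "fps_const (2 :: complex) = 2" "fps_const (4 :: complex) = 4"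
      by (simp_all add: h_def A_def B_def numeral_fps_const)
    have "fps_deriv ((fps_deriv F) ^ 2) = 4 * D - A * (3 * (D * F ^ 2)) - B * (4 * (D * F ^ 3))"
      unfolding F1 D_def A_def B_def const
      by (simp add: fps_deriv_power' mult_ac)
    also have "\<dots> = 4 * D - (2 * h) * A * D * F ^ 2 - 4 * B * D * F ^ 3"
      unfolding h by (simp add: algebra_simps)
    also have "\<dots> = 2 * D * (2 + - (h * A) * F ^ 2 + - (2 * B) * F ^ 3)"
      by (simp add: algebra_simps)
    finally show ?thesis unfolding const D_def .
  qed
  finally have "fps_deriv (fps_deriv F) = fps_const 2 + fps_const (- 3 / 2 * g2) * F ^ 2 + fps_const (- 2 * g3) * F ^ 3"
    using dF by (metis mult_cancel_left mult_eq_0_iff zero_neq_numeral)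
  thus ?thesis using that yF F0 \<open>fps_nth F 1 = 0\<close> unfolding y_def by blast
qed

text \<open>At a double zero a the function N(u, a) vanishes for all u, and so does \<sigma>(u+a)
  \<sigma>(u-a). The countable zero set would then cover the plane by two translates.\<close>

lemma sigma_zero_simple:
  assumes "wsigma g2 g3 a = 0"
  shows "deriv (wsigma g2 g3) a \<noteq> 0"
proof
  assume "deriv (wsigma g2 g3) a = 0"
  hence "wp_num (wsigma g2 g3) a = 0" using assms by (simp add: wp_num_def)
  hence "wsigma g2 g3 (u + a) * wsigma g2 g3 (u - a) = 0" for u
    unfolding sigma_addition by (simp add: addN_def assms)
  hence "UNIV \<subseteq> (\<lambda>u. u - a) ` {u. wsigma g2 g3 u = 0} \<union> (\<lambda>u. u + a) ` {u. wsigma g2 g3 u = 0}"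
    by (force simp: image_iff)
  moreover have "countable ((\<lambda>u. u - a) ` {u. wsigma g2 g3 u = 0} \<union> (\<lambda>u. u + a) ` {u. wsigma g2 g3 u = 0})"
    using countable_sigma_zeros by blast
  ultimately show False using uncountable_UNIV_complex countable_subset by blast
qed

section \<open>Behaviour of sigma and its quotients at the zeros\<close>

lemma DERIV_sigma:
  "(wsigma g2 g3 has_field_derivative deriv (wsigma g2 g3) u) (at u)"
  "(deriv (wsigma g2 g3) has_field_derivative deriv (deriv (wsigma g2 g3)) u) (at u)"
  "(wp_num (wsigma g2 g3) has_field_derivative deriv (wp_num (wsigma g2 g3)) u) (at u)"
  by (intro holomorphic_derivI[of _ UNIV] holomorphic_deriv holomorphic_wp_num holomorphic_sigma; simp)+

lemma isCont_sigma: "isCont (wsigma g2 g3) u" "isCont (deriv (wsigma g2 g3)) u" "isCont (wp_num (wsigma g2 g3)) u"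
  by (rule DERIV_isCont[OF DERIV_sigma(1)] DERIV_isCont[OF DERIV_sigma(2)] DERIV_isCont[OF DERIV_sigma(3)])+

lemma eventually_sigma_nonzero: "\<forall>\<^sub>F u in at a. wsigma g2 g3 u \<noteq> 0"
proof (cases "wsigma g2 g3 a = 0")
  case True
  have "((\<lambda>u. (wsigma g2 g3 u - wsigma g2 g3 a) / (u - a)) \<longlongrightarrow> deriv (wsigma g2 g3) a) (at a)"
    using DERIV_sigma(1) by (simp add: has_field_derivative_iff)
  hence "\<forall>\<^sub>F u in at a. (wsigma g2 g3 u - wsigma g2 g3 a) / (u - a) \<noteq> 0"
    by (rule tendsto_imp_eventually_ne[OF _ sigma_zero_simple[OF True]])
  thus ?thesis by eventually_elim (use True in auto)
next
  case False
  from isCont_imp_eventually_ne[OF isCont_sigma(1) this] show ?thesis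
    by (simp add: eventually_nhds_conv_at)
qed

lemma filterlim_sigma_at_zero:
  assumes "wsigma g2 g3 a = 0"
  shows "filterlim (wsigma g2 g3) (at 0) (at a)"
  using isCont_sigma(1)[of a g2 g3] eventually_sigma_nonzero[of g2 g3 a] assms
  by (auto simp: filterlim_at isCont_def)

definition sigma_nz :: "complex \<Rightarrow> complex \<Rightarrow> complex set" where
  "sigma_nz g2 g3 = - {u. wsigma g2 g3 u = 0}"

lemma open_sigma_nz: "open (sigma_nz g2 g3)"
  and connected_sigma_nz: "connected (sigma_nz g2 g3)"
proof -
  have "closed {u. wsigma g2 g3 u = 0}"
    using closed_Collect_eq[OF holomorphic_on_imp_continuous_on[OF holomorphic_sigma] continuous_on_const, of g2 g3 0] by simp
  thus "open (sigma_nz g2 g3)" by (simp add: sigma_nz_def open_Compl)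
  show "connected (sigma_nz g2 g3)"
    using connected_open_diff_countable[of UNIV "{u. wsigma g2 g3 u = 0}"] countable_sigma_zeros connected_UNIV
    by (simp add: sigma_nz_def Compl_eq_Diff_UNIV)
qed

lemma nicely_meromorphic_quotient_sigma:
  assumes "f holomorphic_on UNIV" "n > 0" "\<And>a. wsigma g2 g3 a = 0 \<Longrightarrow> f a \<noteq> 0"
  shows "(\<lambda>u. f u / wsigma g2 g3 u ^ n) nicely_meromorphic_on UNIV"
    "is_pole (\<lambda>u. f u / wsigma g2 g3 u ^ n) u \<longleftrightarrow> wsigma g2 g3 u = 0"
proof -
  let ?q = "\<lambda>u. f u / wsigma g2 g3 u ^ n"
  have pole: "is_pole ?q u" if "wsigma g2 g3 u = 0" for u
  proof (rule is_pole_divide)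
    show "isCont f u"
      using assms(1) by (metis continuous_on_eq_continuous_at holomorphic_on_imp_continuous_on open_UNIV UNIV_I)
    show "filterlim (\<lambda>u. wsigma g2 g3 u ^ n) (at 0) (at u)"
      using filterlim_sigma_at_zero[OF that] assms(2)
      by (auto simp: filterlim_at power_0_left elim: eventually_mono intro!: tendsto_eq_intros)
  qed (use assms that in auto)
  have "?q holomorphic_on sigma_nz g2 g3"
    by (intro holomorphic_intros holomorphic_on_subset[OF assms(1)] holomorphic_sigma) (auto simp: sigma_nz_def)
  hence an: "?q analytic_on sigma_nz g2 g3" using open_sigma_nz by (simp add: analytic_on_open)
  have "?q meromorphic_on {u}" for u
    by (intro meromorphic_intros analytic_on_imp_meromorphic_on)
       (auto intro!: holomorphic_on_imp_analytic_at[of _ UNIV] assms holomorphic_sigma)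
  hence iso: "isolated_singularity_at ?q u" for u by (rule meromorphic_on_isolated_singularity)
  show "?q nicely_meromorphic_on UNIV"
    by (rule nicely_meromorphic_onI_open[where pts = "{u. wsigma g2 g3 u = 0}"])
      (use an pole iso assms(2) in \<open>auto simp: sigma_nz_def Compl_eq_Diff_UNIV\<close>)
  show "is_pole ?q u \<longleftrightarrow> wsigma g2 g3 u = 0"
    using pole[of u] analytic_at_imp_no_pole[of ?q u] an analytic_on_analytic_at[of ?q "sigma_nz g2 g3"]
    by (auto simp: sigma_nz_def)
qed

lemma wp_of_sigma_eq: "wp_of (wsigma g2 g3) = (\<lambda>u. wp_num (wsigma g2 g3) u / wsigma g2 g3 u ^ 2)"
  by (simp add: fun_eq_iff wp_of_def wp_num_def)

lemma wp_nicely_meromorphic: "wp_of (wsigma g2 g3) nicely_meromorphic_on UNIV"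
  and is_pole_wp_iff: "is_pole (wp_of (wsigma g2 g3)) u \<longleftrightarrow> wsigma g2 g3 u = 0"
  unfolding wp_of_sigma_eq
  by (intro nicely_meromorphic_quotient_sigma holomorphic_wp_num holomorphic_sigma; simp add: wp_num_def sigma_zero_simple)+

text \<open>The reciprocals of \<open>wp_of (wsigma g2 g3)\<close> and of any other candidate solve
  the same regular second-order equation with zero initial data. They agree near the origin, and
  therefore the functions agree everywhere.\<close>

lemma weierstrass_p_eq: "weierstrass_p g2 g3 = wp_of (wsigma g2 g3)"
  unfolding weierstrass_p_def
proof (rule the_equality)
  let ?P = "wp_of (wsigma g2 g3)"
  show P: "?P nicely_meromorphic_on UNIV \<and> is_pole ?P 0 \<and>
     (\<forall>u. \<not> is_pole ?P u \<longrightarrow> (deriv ?P u)^2 = 4 * ?P u ^ 3 - g2 * ?P u - g3)"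
    using wp_nicely_meromorphic is_pole_wp_iff sigma_ode sigma_jet_0 by (auto simp: wp_ode_def)
  fix p assume p: "p nicely_meromorphic_on UNIV \<and> is_pole p 0 \<and>
     (\<forall>u. \<not> is_pole p u \<longrightarrow> (deriv p u)^2 = 4 * p u ^ 3 - g2 * p u - g3)"
  obtain F where F: "(\<lambda>u. inverse (p u)) has_fps_expansion F" "fps_nth F 0 = 0" "fps_nth F 1 = 0"
    "fps_deriv (fps_deriv F) = fps_const 2 + fps_const (- 3 / 2 * g2) * F ^ 2 + fps_const (- 2 * g3) * F ^ 3"
    using p wp_equation_unique_near_0[of p g2 g3] by blast
  obtain G where G: "(\<lambda>u. inverse (?P u)) has_fps_expansion G" "fps_nth G 0 = 0" "fps_nth G 1 = 0"
    "fps_deriv (fps_deriv G) = fps_const 2 + fps_const (- 3 / 2 * g2) * G ^ 2 + fps_const (- 2 * g3) * G ^ 3"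
    using P wp_equation_unique_near_0[of ?P g2 g3] by blast
  have "F = G" using fps_ode_unique[OF F(4) G(4)] F G by simp
  hence "\<forall>\<^sub>F u in nhds 0. inverse (p u) = inverse (?P u)"
    using F(1) G(1) unfolding has_fps_expansion_def by (auto elim: eventually_elim2)
  hence "\<forall>\<^sub>F u in nhds 0. p u = ?P u" by eventually_elim simp
  hence "\<forall>\<^sub>F u in at 0. p u = ?P u" by (simp add: eventually_nhds_conv_at)
  with p P show "p = ?P" by (blast intro: nicely_meromorphic_eqI)
qed

text \<open>Two candidates have the same derivative off the zeros of \<sigma>. This set is
  connected, so they differ by a constant, which the normalisation at the origin makes 0.\<close>

lemma weierstrass_zeta_eq: "weierstrass_zeta g2 g3 = (\<lambda>u. deriv (wsigma g2 g3) u / wsigma g2 g3 u)"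
  unfolding weierstrass_zeta_def weierstrass_p_eq is_pole_wp_iff
proof (rule the_equality)
  let ?Z = "\<lambda>u. deriv (wsigma g2 g3) u / wsigma g2 g3 u"
  have nice: "?Z nicely_meromorphic_on UNIV"
    using nicely_meromorphic_quotient_sigma(1)[of "deriv (wsigma g2 g3)" 1 g2 g3]
    by (simp add: holomorphic_deriv holomorphic_sigma sigma_zero_simple)
  have dZ: "(?Z has_field_derivative - wp_of (wsigma g2 g3) u) (at u)" if "wsigma g2 g3 u \<noteq> 0" for u
    by (rule derivative_eq_intros DERIV_sigma that refl)+
      (use that in \<open>simp add: wp_of_def field_simps power2_eq_square\<close>)
  show "?Z nicely_meromorphic_on UNIV \<and>
    (\<forall>u. wsigma g2 g3 u \<noteq> 0 \<longrightarrow> (?Z has_field_derivative - wp_of (wsigma g2 g3) u) (at u)) \<and>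
    ((\<lambda>u. ?Z u - 1 / u) \<longlongrightarrow> 0) (at 0)"
    using nice dZ sigma_zeta_limit by blast
  fix f assume f: "f nicely_meromorphic_on UNIV \<and>
    (\<forall>u. wsigma g2 g3 u \<noteq> 0 \<longrightarrow> (f has_field_derivative - wp_of (wsigma g2 g3) u) (at u)) \<and>
    ((\<lambda>u. f u - 1 / u) \<longlongrightarrow> 0) (at 0)"
  have "((\<lambda>u. f u - ?Z u) has_field_derivative 0) (at u)" if "u \<in> sigma_nz g2 g3" for u
    using DERIV_diff[of f "- wp_of (wsigma g2 g3) u" u UNIV ?Z "- wp_of (wsigma g2 g3) u"] f dZ[of u] that
    by (simp add: sigma_nz_def)
  hence "(\<lambda>u. f u - ?Z u) constant_on sigma_nz g2 g3"
    by (rule has_field_derivative_0_imp_constant_on[OF _ connected_sigma_nz open_sigma_nz])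
  then obtain c where c: "\<And>u. u \<in> sigma_nz g2 g3 \<Longrightarrow> f u - ?Z u = c"
    by (auto simp: constant_on_def)
  have ev: "\<forall>\<^sub>F u in at 0. f u - ?Z u = c"
    using eventually_sigma_nonzero[of g2 g3 0] by eventually_elim (auto intro: c simp: sigma_nz_def)
  have "((\<lambda>u. (f u - 1 / u) - (?Z u - 1 / u)) \<longlongrightarrow> 0 - 0) (at 0)"
    using f sigma_zeta_limit by (intro tendsto_diff) auto
  moreover have "(f u - 1 / u) - (?Z u - 1 / u) = f u - ?Z u" for u by (simp only: diff_conv_add_uminus minus_add_distrib minus_minus add.assoc) simp
  ultimately have "((\<lambda>u. f u - ?Z u) \<longlongrightarrow> 0) (at 0)" by (simp only: diff_zero)
  from Lim_transform_eventually[OF this ev] have "c = 0" by (simp add: tendsto_const_iff)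
  with ev have "\<forall>\<^sub>F u in at 0. f u = ?Z u" by simp
  with f nice show "f = ?Z" by (blast intro: nicely_meromorphic_eqI)
qed

lemma weierstrass_sigma_eq: "weierstrass_sigma g2 g3 = wsigma g2 g3"
  unfolding weierstrass_sigma_def weierstrass_p_eq weierstrass_zeta_eq is_pole_wp_iff
proof (rule the_equality)
  have lim: "((\<lambda>u. wsigma g2 g3 u / u) \<longlongrightarrow> 1) (at 0)"
    using DERIV_sigma(1)[of g2 g3 0] by (simp add: has_field_derivative_iff sigma_jet_0)
  show "wsigma g2 g3 holomorphic_on UNIV \<and>
    (\<forall>u. wsigma g2 g3 u \<noteq> 0 \<longrightarrow>
      (wsigma g2 g3 has_field_derivative wsigma g2 g3 u * (deriv (wsigma g2 g3) u / wsigma g2 g3 u)) (at u)) \<and>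
    ((\<lambda>u. wsigma g2 g3 u / u) \<longlongrightarrow> 1) (at 0)"
    using holomorphic_sigma lim DERIV_sigma(1) by auto
  fix s assume s: "s holomorphic_on UNIV \<and>
    (\<forall>u. wsigma g2 g3 u \<noteq> 0 \<longrightarrow>
      (s has_field_derivative s u * (deriv (wsigma g2 g3) u / wsigma g2 g3 u)) (at u)) \<and>
    ((\<lambda>u. s u / u) \<longlongrightarrow> 1) (at 0)"
  have "((\<lambda>u. s u / wsigma g2 g3 u) has_field_derivative 0) (at u)" if "u \<in> sigma_nz g2 g3" for u
    using DERIV_divide[of s "s u * (deriv (wsigma g2 g3) u / wsigma g2 g3 u)" u UNIV "wsigma g2 g3" "deriv (wsigma g2 g3) u"]
      s DERIV_sigma(1)[of g2 g3 u] that by (simp add: sigma_nz_def)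
  hence "(\<lambda>u. s u / wsigma g2 g3 u) constant_on sigma_nz g2 g3"
    by (rule has_field_derivative_0_imp_constant_on[OF _ connected_sigma_nz open_sigma_nz])
  then obtain c where c: "\<And>u. u \<in> sigma_nz g2 g3 \<Longrightarrow> s u / wsigma g2 g3 u = c"
    by (auto simp: constant_on_def)
  have "((\<lambda>u. (s u / u) / (wsigma g2 g3 u / u)) \<longlongrightarrow> 1 / 1) (at 0)"
    using s lim by (intro tendsto_divide) auto
  moreover have "\<forall>\<^sub>F u in at 0. (s u / u) / (wsigma g2 g3 u / u) = c"
    using eventually_sigma_nonzero[of g2 g3 0] eventually_neq_at_within[of 0 0 UNIV]
    by eventually_elim (use c in \<open>auto simp: sigma_nz_def\<close>)
  ultimately have "((\<lambda>u::complex. c) \<longlongrightarrow> 1) (at 0)"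
    by (auto elim: Lim_transform_eventually)
  hence "c = 1" by (simp add: tendsto_const_iff)
  show "s = wsigma g2 g3"
  proof
    fix u
    have "sigma_nz g2 g3 \<noteq> {}"
      using eventually_happens[OF eventually_sigma_nonzero[of g2 g3 0]] by (auto simp: sigma_nz_def)
    show "s u = wsigma g2 g3 u"
      by (rule analytic_continuation_open[OF open_sigma_nz open_UNIV \<open>sigma_nz g2 g3 \<noteq> {}\<close> connected_UNIV])
        (use s c \<open>c = 1\<close> holomorphic_sigma in \<open>auto simp: sigma_nz_def field_simps\<close>)
  qed
qed

subsection \<open>Sigma solutions of the Somos-4 recurrence\<close>

lemma wp_num_sigma_eq: "wsigma g2 g3 u \<noteq> 0 \<Longrightarrow> wp_num (wsigma g2 g3) u = wp_of (wsigma g2 g3) u * (wsigma g2 g3 u)^2"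
  by (simp add: wp_of_sigma_eq)

lemma local_sigma_1: "local_sigma g2 g3 (wsigma g2 g3) (norm u + 1)"
  by (rule local_sigma_sigma) (simp add: add_nonneg_pos)

lemma DERIV_wp_sigma:
  assumes "wsigma g2 g3 u \<noteq> 0"
  shows "(wp_of (wsigma g2 g3) has_field_derivative deriv (wp_of (wsigma g2 g3)) u) (at u)"
    "(deriv (wp_of (wsigma g2 g3)) has_field_derivative 6 * (wp_of (wsigma g2 g3) u)^2 - g2 / 2) (at u)"
    "deriv (wp_num (wsigma g2 g3)) u = deriv (wp_of (wsigma g2 g3)) u * (wsigma g2 g3 u)^2
      + 2 * wp_of (wsigma g2 g3) u * wsigma g2 g3 u * deriv (wsigma g2 g3) u"
    "((\<lambda>u. deriv (wsigma g2 g3) u / wsigma g2 g3 u) has_field_derivative - wp_of (wsigma g2 g3) u) (at u)"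
proof -
  interpret local_sigma g2 g3 "wsigma g2 g3" "norm u + 1" by (rule local_sigma_1)
  have "u \<in> ball 0 (norm u + 1)" by simp
  thus "(wp_of (wsigma g2 g3) has_field_derivative deriv (wp_of (wsigma g2 g3)) u) (at u)"
    "(deriv (wp_of (wsigma g2 g3)) has_field_derivative 6 * (wp_of (wsigma g2 g3) u)^2 - g2 / 2) (at u)"
    "deriv (wp_num (wsigma g2 g3)) u = deriv (wp_of (wsigma g2 g3)) u * (wsigma g2 g3 u)^2
      + 2 * wp_of (wsigma g2 g3) u * wsigma g2 g3 u * deriv (wsigma g2 g3) u"
    "((\<lambda>u. deriv (wsigma g2 g3) u / wsigma g2 g3 u) has_field_derivative - wp_of (wsigma g2 g3) u) (at u)"
    using assms DERIV_wp deriv_wp_num_eq DERIV_zeta by blast+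
qed

lemma DERIV_compose_add:
  assumes "(f has_field_derivative D) (at (x + c))"
  shows "((\<lambda>v. f (v + c)) has_field_derivative D) (at x)"
  using assms by (simp add: DERIV_shift)

lemma DERIV_unique_eventually:
  assumes "(f has_field_derivative D) (at t)" "(g has_field_derivative E) (at t)" "\<forall>\<^sub>F x in nhds t. f x = g x"
  shows "D = E"
  using DERIV_cong_ev[OF refl assms(3) refl] assms(1,2) DERIV_unique by blast

lemma sigma_double:
  assumes "wsigma g2 g3 u \<noteq> 0"
  shows "wsigma g2 g3 (2 * u) = - deriv (wp_of (wsigma g2 g3)) u * wsigma g2 g3 u ^ 4"
  unfolding sigma_duplication dup_def DERIV_wp_sigma(3)[OF assms] wp_num_sigma_eq[OF assms]
  by (simp add: algebra_simps eval_nat_numeral)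

text \<open>For a zero a, the addition formula reads \<sigma>(u+a) \<sigma>(u-a) = \<sigma>(u)^2
  \<sigma>'(a)^2. At u = b the right side has a double zero. If b - a were not a zero, the left side
  would have only the simple zero coming from b + a.\<close>

lemma sigma_zeros_diff:
  assumes a: "wsigma g2 g3 a = 0" and b: "wsigma g2 g3 b = 0"
  shows "wsigma g2 g3 (b - a) = 0"
proof (rule ccontr)
  let ?S = "wsigma g2 g3"
  assume nz: "?S (b - a) \<noteq> 0"
  have eq: "?S (u + a) * ?S (u - a) = (?S u)^2 * (deriv ?S a)^2" for u
    unfolding sigma_addition by (simp add: addN_def wp_num_def a)
  hence "?S (b + a) * ?S (b - a) = 0" unfolding eq using b by simp
  hence ba: "?S (b + a) = 0" using nz by simp
  have "((\<lambda>u. ?S (u + a) * ?S (u - a)) has_field_derivative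
      deriv ?S (b + a) * ?S (b - a) + deriv ?S (b - a) * ?S (b + a)) (at b)"
    by (auto intro!: derivative_eq_intros DERIV_chain2[where f = ?S] DERIV_sigma)
  moreover have "((\<lambda>u. (?S u)^2 * (deriv ?S a)^2) has_field_derivative 0) (at b)"
    using b by (auto intro!: derivative_eq_intros DERIV_sigma)
  ultimately have "deriv ?S (b + a) * ?S (b - a) + deriv ?S (b - a) * ?S (b + a) = 0"
    unfolding eq by (rule DERIV_unique)
  thus False using ba nz sigma_zero_simple[OF ba] by simp
qed

text \<open>Two logarithmic differentiations of \<sigma>(2v) = -\<wp>'(v) \<sigma>(v)^4. The first
  gives 2 \<zeta>(2v) = \<wp>''/\<wp>' + 4 \<zeta>(v); in the second, \<wp>''' = 12 \<wp>
  \<wp>'.\<close>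

lemma wp_duplication:
  assumes u: "wsigma g2 g3 u \<noteq> 0" and u2: "wsigma g2 g3 (2 * u) \<noteq> 0"
  defines "p \<equiv> wp_of (wsigma g2 g3)"
  shows "p (2 * u) = - 2 * p u + (deriv (deriv p) u / deriv p u)^2 / 4"
proof -
  let ?S = "wsigma g2 g3"
  define p1 p2 where "p1 = deriv p" and "p2 = (\<lambda>v. 6 * (p v)^2 - g2 / 2)"
  let ?W = "{v. ?S v \<noteq> 0 \<and> ?S (2 * v) \<noteq> 0}"
  have S2: "?S (2 * v) = - p1 v * ?S v ^ 4" if "?S v \<noteq> 0" for v
    using sigma_double[OF that] by (simp add: p_def p1_def)
  have dp: "(p has_field_derivative p1 v) (at v)" "(p1 has_field_derivative p2 v) (at v)" if "?S v \<noteq> 0" for v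
    using DERIV_wp_sigma(1,2)[OF that] by (simp_all add: p_def p1_def p2_def)
  have nzp: "p1 v \<noteq> 0" if "v \<in> ?W" for v using that S2[of v] by auto
  have "isCont (\<lambda>v. ?S (2 * v)) u"
    by (rule DERIV_isCont[OF DERIV_chain2[where f = ?S, OF DERIV_sigma(1) DERIV_cmult_Id]])
  hence "\<forall>\<^sub>F v in nhds u. ?S v \<noteq> 0 \<and> ?S (2 * v) \<noteq> 0"
    using u u2 isCont_sigma(1) by (intro eventually_conj isCont_imp_eventually_ne) auto
  hence evW: "\<forall>\<^sub>F v in nhds u. v \<in> ?W" by simp
  have log1: "2 * (deriv ?S (2 * v) / ?S (2 * v)) = p2 v / p1 v + 4 * (deriv ?S v / ?S v)" if v: "v \<in> ?W" for v
  proof -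
    have "\<forall>\<^sub>F w in nhds v. ?S w \<noteq> 0" using v isCont_sigma(1) by (intro isCont_imp_eventually_ne) auto
    hence ev: "\<forall>\<^sub>F w in nhds v. ?S (2 * w) = - p1 w * ?S w ^ 4" by eventually_elim (rule S2)
    have "((\<lambda>w. ?S (2 * w)) has_field_derivative deriv ?S (2 * v) * 2) (at v)"
      by (rule DERIV_chain2[where f = ?S, OF DERIV_sigma(1) DERIV_cmult_Id])
    moreover have "((\<lambda>w. - p1 w * ?S w ^ 4) has_field_derivative
        - p2 v * ?S v ^ 4 - p1 v * (4 * ?S v ^ 3 * deriv ?S v)) (at v)"
      using v by (auto intro!: derivative_eq_intros DERIV_sigma dp simp: algebra_simps)
    ultimately have D: "deriv ?S (2 * v) * 2 = - p2 v * ?S v ^ 4 - p1 v * (4 * ?S v ^ 3 * deriv ?S v)"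
      using ev by (rule DERIV_unique_eventually)
    have "2 * (deriv ?S (2 * v) / ?S (2 * v)) = (deriv ?S (2 * v) * 2) / ?S (2 * v)" by simp
    also have "\<dots> = (- p2 v * ?S v ^ 4 - p1 v * (4 * ?S v ^ 3 * deriv ?S v)) / (- p1 v * ?S v ^ 4)"
      using v S2[of v] D by simp
    also have "\<dots> = p2 v / p1 v + 4 * (deriv ?S v / ?S v)"
      using v nzp[OF v] by (simp add: field_simps eval_nat_numeral)
    finally show ?thesis .
  qed
  have W: "u \<in> ?W" using u u2 by simp
  have "((\<lambda>v. 2 * (deriv ?S (2 * v) / ?S (2 * v))) has_field_derivative 2 * (- p (2 * u) * 2)) (at u)"
    unfolding p_def
    by (rule DERIV_cmult[OF DERIV_chain2[where f = "\<lambda>v. deriv ?S v / ?S v", OF DERIV_wp_sigma(4)[OF u2] DERIV_cmult_Id]])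
  moreover have "((\<lambda>v. p2 v / p1 v + 4 * (deriv ?S v / ?S v)) has_field_derivative
      (12 * p u * p1 u * p1 u - p2 u * p2 u) / (p1 u * p1 u) + 4 * (- p u)) (at u)"
  proof -
    have "(p2 has_field_derivative 12 * p u * p1 u) (at u)"
      unfolding p2_def by (auto intro!: derivative_eq_intros dp u)
    from DERIV_add[OF DERIV_divide[OF this dp(2)[OF u] nzp[OF W]] DERIV_cmult[OF DERIV_wp_sigma(4)[OF u]]]
    show ?thesis unfolding p_def .
  qed
  ultimately have "2 * (- p (2 * u) * 2) = (12 * p u * p1 u * p1 u - p2 u * p2 u) / (p1 u * p1 u) + 4 * (- p u)"
    using eventually_mono[OF evW log1] by (rule DERIV_unique_eventually)
  moreover have "deriv p1 u = p2 u" by (rule DERIV_imp_deriv[OF dp(2)[OF u]])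
  ultimately show ?thesis
    using nzp[OF W] unfolding p1_def[symmetric] by (simp add: field_simps power2_eq_square)
qed

lemma sigma_shift_factor:
  assumes "wsigma g2 g3 z \<noteq> 0" "wsigma g2 g3 u \<noteq> 0"
  shows "wsigma g2 g3 (u + z) * wsigma g2 g3 (u - z) =
    (wsigma g2 g3 u)^2 * (wsigma g2 g3 z)^2 * (wp_of (wsigma g2 g3) z - wp_of (wsigma g2 g3) u)"
  unfolding sigma_addition addN_def wp_num_sigma_eq[OF assms(1)] wp_num_sigma_eq[OF assms(2)]
  by (simp add: algebra_simps)

text \<open>The second logarithmic derivative in $u$ of the addition formula for $\sigma(u+z)\sigma(u-z)$.\<close>
lemma wp_add_sub:
  fixes g2 g3 u z :: complex
  defines "p \<equiv> wp_of (wsigma g2 g3)"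
  assumes z: "wsigma g2 g3 z \<noteq> 0" and u: "wsigma g2 g3 u \<noteq> 0"
    and uz: "wsigma g2 g3 (u + z) \<noteq> 0" "wsigma g2 g3 (u - z) \<noteq> 0"
  shows "(2 * p u - p (u + z) - p (u - z)) * (p z - p u)^2 =
    - (6 * (p u)^2 - g2 / 2) * (p z - p u) - (4 * p u ^ 3 - g2 * p u - g3)"
proof -
  let ?S = "wsigma g2 g3"
  define p1 where "p1 = deriv p"
  define f where "f = (\<lambda>v. p z - p v)"
  have fac: "?S (v + z) * ?S (v - z) = (?S v)^2 * (?S z)^2 * f v" if "?S v \<noteq> 0" for v
    using sigma_shift_factor[OF z that] by (simp add: f_def p_def)
  have dp: "(p has_field_derivative p1 v) (at v)" "(p1 has_field_derivative 6 * (p v)^2 - g2 / 2) (at v)" if "?S v \<noteq> 0" for v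
    using DERIV_wp_sigma(1,2)[OF that] by (simp_all add: p_def p1_def)
  have df: "(f has_field_derivative - p1 v) (at v)" if "?S v \<noteq> 0" for v
    unfolding f_def using dp(1)[OF that] by (auto intro!: derivative_eq_intros)
  let ?W = "{v. ?S v \<noteq> 0 \<and> ?S (v + z) \<noteq> 0 \<and> ?S (v - z) \<noteq> 0}"
  note shift = DERIV_compose_add
  have shift': "((\<lambda>v. g (v - c)) has_field_derivative D) (at v)" if "(g has_field_derivative D) (at (v - c))"
    for g :: "complex \<Rightarrow> complex" and D c v
    using shift[of g D v "- c"] that by simp
  have "\<forall>\<^sub>F v in nhds u. ?S v \<noteq> 0 \<and> ?S (v + z) \<noteq> 0 \<and> ?S (v - z) \<noteq> 0"
    using u uz by (intro eventually_conj isCont_imp_eventually_ne isCont_sigma(1)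
        DERIV_isCont[OF shift[OF DERIV_sigma(1)]] DERIV_isCont[OF shift'[OF DERIV_sigma(1)]]) auto
  hence evW: "\<forall>\<^sub>F v in nhds u. v \<in> ?W" by simp
  have nzf: "f v \<noteq> 0" if "v \<in> ?W" for v using that fac[of v] by auto
  have log1: "deriv ?S (v + z) / ?S (v + z) + deriv ?S (v - z) / ?S (v - z) = 2 * (deriv ?S v / ?S v) - p1 v / f v"
    if v: "v \<in> ?W" for v
  proof -
    have "\<forall>\<^sub>F w in nhds v. ?S w \<noteq> 0" using v isCont_sigma(1) by (intro isCont_imp_eventually_ne) auto
    hence ev: "\<forall>\<^sub>F w in nhds v. ?S (w + z) * ?S (w - z) = (?S w)^2 * (?S z)^2 * f w" by eventually_elim (rule fac)
    have "((\<lambda>w. ?S (w + z) * ?S (w - z)) has_field_derivative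
        deriv ?S (v + z) * ?S (v - z) + deriv ?S (v - z) * ?S (v + z)) (at v)"
      by (rule DERIV_mult[OF shift[OF DERIV_sigma(1)] shift'[OF DERIV_sigma(1)]])
    moreover have "((\<lambda>w. (?S w)^2 * (?S z)^2 * f w) has_field_derivative
        2 * ?S v * deriv ?S v * (?S z)^2 * f v - (?S v)^2 * (?S z)^2 * p1 v) (at v)"
      using v by (auto intro!: derivative_eq_intros DERIV_sigma df simp: algebra_simps)
    ultimately have "deriv ?S (v + z) * ?S (v - z) + deriv ?S (v - z) * ?S (v + z)
        = 2 * ?S v * deriv ?S v * (?S z)^2 * f v - (?S v)^2 * (?S z)^2 * p1 v"
      using ev by (rule DERIV_unique_eventually)
    hence "(deriv ?S (v + z) * ?S (v - z) + deriv ?S (v - z) * ?S (v + z)) / (?S (v + z) * ?S (v - z))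
        = (2 * ?S v * deriv ?S v * (?S z)^2 * f v - (?S v)^2 * (?S z)^2 * p1 v) / ((?S v)^2 * (?S z)^2 * f v)"
      using fac[of v] v by simp
    thus ?thesis using v z nzf[OF v] by (simp add: add_divide_distrib diff_divide_distrib power2_eq_square)
  qed
  have W: "u \<in> ?W" using u uz by simp
  have "((\<lambda>v. deriv ?S (v + z) / ?S (v + z) + deriv ?S (v - z) / ?S (v - z)) has_field_derivative
      - p (u + z) + - p (u - z)) (at u)"
    using DERIV_add[OF shift[of "\<lambda>v. deriv ?S v / ?S v", OF DERIV_wp_sigma(4)[OF uz(1)]]
       shift'[of "\<lambda>v. deriv ?S v / ?S v", OF DERIV_wp_sigma(4)[OF uz(2)]]] unfolding p_def .
  moreover have "((\<lambda>v. 2 * (deriv ?S v / ?S v) - p1 v / f v) has_field_derivative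
      2 * (- p u) - ((6 * (p u)^2 - g2 / 2) * f u - p1 u * (- p1 u)) / (f u * f u)) (at u)"
    using DERIV_diff[OF DERIV_cmult[OF DERIV_wp_sigma(4)[OF u]] DERIV_divide[OF dp(2)[OF u] df[OF u] nzf[OF W]]]
    unfolding p_def .
  ultimately have "- p (u + z) + - p (u - z) =
      2 * (- p u) - ((6 * (p u)^2 - g2 / 2) * f u - p1 u * (- p1 u)) / (f u * f u)"
    using eventually_mono[OF evW log1] by (rule DERIV_unique_eventually)
  hence "(2 * p u - p (u + z) - p (u - z)) * (f u)^2 = - (6 * (p u)^2 - g2 / 2) * f u - (p1 u)^2"
    using nzf[OF W] by (simp add: field_simps power2_eq_square)
  moreover have "(p1 u)^2 = 4 * p u ^ 3 - g2 * p u - g3"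
    using sigma_ode[OF u] by (simp add: wp_ode_def p_def p1_def)
  ultimately show ?thesis by (simp add: f_def)
qed

text \<open>The conditions on z restated for sigma: by the formula for \<sigma>(2z), the condition
  \<alpha> = \<wp>'(z)^2 is \<sigma>(2z)^2 = \<alpha> \<sigma>(z)^8. As \<alpha> \<noteq> 0, the
  point 2z is not a pole, and \<wp>(2z) is a genuine value.\<close>

lemma somos4_paramD:
  assumes "somos4_param \<alpha> \<beta> J z" "\<alpha> \<noteq> 0"
  defines "g2 \<equiv> somos4_g2 \<alpha> \<beta> J" and "g3 \<equiv> somos4_g3 \<alpha> \<beta> J"
  shows "wsigma g2 g3 z \<noteq> 0" "wsigma g2 g3 (2 * z) \<noteq> 0"
    "wp_of (wsigma g2 g3) z = somos4_lam \<alpha> \<beta> J"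
    "(wsigma g2 g3 (2 * z))^2 = \<alpha> * wsigma g2 g3 z ^ 8"
    "\<beta> = \<alpha> * (wp_of (wsigma g2 g3) (2 * z) - wp_of (wsigma g2 g3) z)"
proof -
  have par: "wsigma g2 g3 z \<noteq> 0" "wp_of (wsigma g2 g3) z = somos4_lam \<alpha> \<beta> J"
    "\<beta> / \<alpha> = wp_of (wsigma g2 g3) (2 * z) - wp_of (wsigma g2 g3) z"
    using assms(1) by (simp_all add: somos4_param_def Let_def weierstrass_p_eq weierstrass_sigma_eq g2_def g3_def)
  show s: "wsigma g2 g3 z \<noteq> 0" and "wp_of (wsigma g2 g3) z = somos4_lam \<alpha> \<beta> J" by fact+
  show "\<beta> = \<alpha> * (wp_of (wsigma g2 g3) (2 * z) - wp_of (wsigma g2 g3) z)"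
    using assms(2) by (simp flip: par(3))
  have "\<alpha> = (deriv (wp_of (wsigma g2 g3)) z)^2"
    using assms by (simp add: somos4_param_def Let_def weierstrass_p_eq)
  thus *: "(wsigma g2 g3 (2 * z))^2 = \<alpha> * wsigma g2 g3 z ^ 8"
    unfolding sigma_double[OF s] by (simp add: power_mult_distrib flip: power_mult)
  thus "wsigma g2 g3 (2 * z) \<noteq> 0" using assms(2) s by auto
qed

text \<open>Both products of shifted sigmas are expanded by the addition formula, and \<wp>(2z) is
  split as \<wp>(z) + \<beta>/\<alpha>. Using the numerator of \<wp> at u keeps the identity valid
  at zeros of \<sigma>.\<close>

lemma sigma_somos4:
  assumes "somos4_param \<alpha> \<beta> J z" "\<alpha> \<noteq> 0"
  defines "g2 \<equiv> somos4_g2 \<alpha> \<beta> J" and "g3 \<equiv> somos4_g3 \<alpha> \<beta> J"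
  shows "wsigma g2 g3 (u + 2 * z) * wsigma g2 g3 (u - 2 * z) =
    \<alpha> * wsigma g2 g3 z ^ 6 * (wsigma g2 g3 (u + z) * wsigma g2 g3 (u - z)) + \<beta> * wsigma g2 g3 z ^ 8 * (wsigma g2 g3 u)^2"
proof -
  note par = somos4_paramD[OF assms(1,2), folded g2_def g3_def]
  show ?thesis
    unfolding sigma_addition addN_def wp_num_sigma_eq[OF par(1)] wp_num_sigma_eq[OF par(2)] par(4)
    by (subst par(5)) (simp add: algebra_simps eval_nat_numeral)
qed

text \<open>The exponent n^2 earns its place here: (m+k)^2 + (m-k)^2 = 2m^2 + 2k^2, so apart from
  the sigma factors k enters only through \<sigma>(z)^(2k^2). The cases k = 0, 1, 2 supply all
  products in the recurrence.\<close>

lemma somos4_sol_sym_product: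
  fixes m k :: int
  assumes "weierstrass_sigma g2 g3 z \<noteq> 0" "B \<noteq> 0"
  shows "somos4_sol A B w z g2 g3 (m + k) * somos4_sol A B w z g2 g3 (m - k) =
    (A * B powi m / wsigma g2 g3 z powi (m^2))^2 *
      (wsigma g2 g3 (w + of_int m * z + of_int k * z) * wsigma g2 g3 (w + of_int m * z - of_int k * z))
      / wsigma g2 g3 z powi (2 * k^2)"
proof -
  define s where "s = wsigma g2 g3 z"
  have s: "s \<noteq> 0" using assms by (simp add: s_def weierstrass_sigma_eq)
  have "B powi (m + k) * B powi (m - k) = (B powi m)^2"
    using assms by (simp add: power2_eq_square flip: power_int_add)
  moreover have "s powi ((m + k)^2) * s powi ((m - k)^2) = (s powi (m^2))^2 * s powi (2 * k^2)"
  proof -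
    have "(m + k)^2 + (m - k)^2 = m^2 + m^2 + 2 * k^2" by (simp add: power2_eq_square algebra_simps)
    thus ?thesis using s by (simp add: power2_eq_square flip: power_int_add)
  qed
  moreover have "w + of_int (m + k) * z = w + of_int m * z + of_int k * z"
    "w + of_int (m - k) * z = w + of_int m * z - of_int k * z" by (simp_all add: algebra_simps)
  moreover have "(A * b * x / q) * (A * b' * x' / q') = (A^2 * (b * b') * (x * x')) / (q * q')" for b x q b' x' q' :: complex
    by (simp add: power2_eq_square)
  ultimately show ?thesis
    unfolding somos4_sol_def weierstrass_sigma_eq s_def[symmetric]
    by (simp only: power_mult_distrib power_divide) simp
qed

lemma somos4_sol_somos4:
  assumes "somos4_param \<alpha> \<beta> J z" "\<alpha> \<noteq> 0" "B \<noteq> 0"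
  shows "somos4 \<alpha> \<beta> (somos4_sol A B w z (somos4_g2 \<alpha> \<beta> J) (somos4_g3 \<alpha> \<beta> J))"
  unfolding somos4_def
proof
  fix n
  define g2 g3 where "g2 = somos4_g2 \<alpha> \<beta> J" and "g3 = somos4_g3 \<alpha> \<beta> J"
  define s where "s = wsigma g2 g3 z"
  define u where "u = w + of_int (n + 2) * z"
  have s: "s \<noteq> 0" "weierstrass_sigma g2 g3 z \<noteq> 0"
    using somos4_paramD(1)[OF assms(1,2)] by (simp_all add: s_def g2_def g3_def weierstrass_sigma_eq)
  note prod = somos4_sol_sym_product[OF s(2) assms(3), of A w "n + 2", folded s_def u_def]
  define K where "K = (A * B powi (n + 2) / s powi ((n + 2)^2))^2"
  have 2: "somos4_sol A B w z g2 g3 (n + 4) * somos4_sol A B w z g2 g3 n =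
      K * (wsigma g2 g3 (u + 2 * z) * wsigma g2 g3 (u - 2 * z)) / s ^ 8"
    using prod[of 2] by (simp add: K_def add_ac)
  have 1: "somos4_sol A B w z g2 g3 (n + 3) * somos4_sol A B w z g2 g3 (n + 1) =
      K * (wsigma g2 g3 (u + z) * wsigma g2 g3 (u - z)) / s ^ 2"
    using prod[of 1] by (simp add: K_def add_ac)
  have 0: "(somos4_sol A B w z g2 g3 (n + 2))^2 = K * (wsigma g2 g3 u)^2"
    using prod[of 0] by (simp add: K_def power2_eq_square)
  have "s ^ 8 = s ^ 6 * s ^ 2" by (simp flip: power_add)
  have alg: "K * (\<alpha> * p * a + \<beta> * (p * q) * b) / (p * q) = \<alpha> * (K * a / q) + \<beta> * (K * b)"
    if "p \<noteq> 0" "q \<noteq> 0" for p q a b :: complex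
    using that by (simp add: field_simps)
  have "K * (wsigma g2 g3 (u + 2 * z) * wsigma g2 g3 (u - 2 * z)) / s ^ 8
      = \<alpha> * (K * (wsigma g2 g3 (u + z) * wsigma g2 g3 (u - z)) / s ^ 2) + \<beta> * (K * (wsigma g2 g3 u)^2)"
    unfolding sigma_somos4[OF assms(1,2), of u, folded g2_def g3_def s_def] \<open>s ^ 8 = s ^ 6 * s ^ 2\<close>
    by (rule alg) (use s in auto)
  thus "somos4_sol A B w z (somos4_g2 \<alpha> \<beta> J) (somos4_g3 \<alpha> \<beta> J) (n + 4) *
      somos4_sol A B w z (somos4_g2 \<alpha> \<beta> J) (somos4_g3 \<alpha> \<beta> J) n =
    \<alpha> * somos4_sol A B w z (somos4_g2 \<alpha> \<beta> J) (somos4_g3 \<alpha> \<beta> J) (n + 3) *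
      somos4_sol A B w z (somos4_g2 \<alpha> \<beta> J) (somos4_g3 \<alpha> \<beta> J) (n + 1)
    + \<beta> * (somos4_sol A B w z (somos4_g2 \<alpha> \<beta> J) (somos4_g3 \<alpha> \<beta> J) (n + 2))^2"
    unfolding g2_def[symmetric] g3_def[symmetric] 0 2 mult.assoc[of \<alpha>] 1 .
qed

text \<open>With $f_n = x_{n+1} x_{n-1} / x_n^2 = \lambda - \wp(z_0 + nz)$, the numbers $f_0, f_2$ are the
  roots of $f_1^2 X^2 - (J f_1 - \alpha) X + \alpha f_1 + \beta$.\<close>
lemma somos4_sol_first_integral:
  fixes \<alpha> \<beta> J z A B w :: complex
  assumes par: "somos4_param \<alpha> \<beta> J z" and "\<alpha> \<noteq> 0" "B \<noteq> 0"
  defines "x \<equiv> somos4_sol A B w z (somos4_g2 \<alpha> \<beta> J) (somos4_g3 \<alpha> \<beta> J)"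
  assumes nz: "x 0 \<noteq> 0" "x 1 \<noteq> 0" "x 2 \<noteq> 0" "x 3 \<noteq> 0"
  shows "(x 0)^2 * (x 3)^2 + \<alpha> * ((x 1) ^ 3 * x 3 + x 0 * (x 2) ^ 3) + \<beta> * (x 1)^2 * (x 2)^2
    = J * (x 0 * x 1 * x 2 * x 3)"
proof -
  define g2 g3 where "g2 = somos4_g2 \<alpha> \<beta> J" and "g3 = somos4_g3 \<alpha> \<beta> J"
  define S p where "S = wsigma g2 g3" and "p = wp_of S"
  define l where "l = somos4_lam \<alpha> \<beta> J"
  have s: "S z \<noteq> 0" "weierstrass_sigma g2 g3 z \<noteq> 0" and pz: "p z = l"
    using somos4_paramD(1,3)[OF par \<open>\<alpha> \<noteq> 0\<close>] by (simp_all add: S_def p_def g2_def g3_def l_def weierstrass_sigma_eq)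
  have x_def': "x = somos4_sol A B w z g2 g3" by (simp add: x_def g2_def g3_def)
  have S_nz: "S (w + of_int n * z) \<noteq> 0" if "x n \<noteq> 0" for n
    using that by (auto simp: x_def' somos4_sol_def weierstrass_sigma_eq S_def)
  have f: "x (m + 1) * x (m - 1) = (x m)^2 * (l - p (w + of_int m * z))" if "x m \<noteq> 0" for m
  proof -
    let ?u = "w + of_int m * z"
    have "x (m + 1) * x (m - 1) = (A * B powi m / S z powi (m^2))^2 * (S (?u + z) * S (?u - z)) / (S z)^2"
      using somos4_sol_sym_product[OF s(2) \<open>B \<noteq> 0\<close>, of A w m 1] by (simp add: x_def' S_def)
    also have "S (?u + z) * S (?u - z) = (S ?u)^2 * (S z)^2 * (l - p ?u)"
      using sigma_shift_factor[of g2 g3 z ?u] s(1) S_nz[OF that] pz by (simp add: S_def p_def)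
    also have "(A * B powi m / S z powi (m^2))^2 * ((S ?u)^2 * (S z)^2 * (l - p ?u)) / (S z)^2
        = (A * B powi m * S ?u / S z powi (m^2))^2 * (l - p ?u)"
      using s(1) by (simp add: power2_eq_square)
    also have "A * B powi m * S ?u / S z powi (m^2) = x m"
      by (simp add: x_def' somos4_sol_def weierstrass_sigma_eq S_def)
    finally show ?thesis .
  qed
  define u where "u = w + z"
  define f0 f1 f2 where "f0 = l - p (u - z)" and "f1 = l - p u" and "f2 = l - p (u + z)"
  have F0: "x 1 * x (-1) = (x 0)^2 * f0" using f[of 0] nz by (simp add: f0_def u_def)
  have F1: "x 2 * x 0 = (x 1)^2 * f1" using f[of 1] nz by (simp add: f1_def u_def)
  have F2: "x 3 * x 1 = (x 2)^2 * f2"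
  proof -
    have "w + of_int 2 * z = u + z" by (simp add: u_def)
    from f[of 2, unfolded this] show ?thesis using nz by (simp add: f2_def)
  qed
  have prod: "f1^2 * f0 * f2 = \<alpha> * f1 + \<beta>"
  proof -
    \<comment> \<open>The recurrence at n = -1. Nothing prevents x_{-1} from vanishing, so it
      appears only in products and is never divided by.\<close>
    have "x 3 * x (-1) = \<alpha> * x 2 * x 0 + \<beta> * (x 1)^2"
      using somos4_sol_somos4[OF par \<open>\<alpha> \<noteq> 0\<close> \<open>B \<noteq> 0\<close>, of A w, unfolded somos4_def x_def[symmetric], rule_format, of "-1"]
      by simp
    moreover have "(x 2 * x 0)^2 * f0 * f2 = ((x 0)^2 * f0) * ((x 2)^2 * f2)"
      by (simp add: power2_eq_square)
    hence "(x 2 * x 0)^2 * f0 * f2 = (x 1)^2 * (x 3 * x (-1))"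
      unfolding F0[symmetric] F2[symmetric] by (simp add: power2_eq_square)
    ultimately have "(x 2 * x 0)^2 * f0 * f2 = (x 1)^2 * (\<alpha> * (x 2 * x 0) + \<beta> * (x 1)^2)"
      by (simp only: mult.assoc)
    hence "(x 1) ^ 4 * (f1^2 * f0 * f2) = (x 1) ^ 4 * (\<alpha> * f1 + \<beta>)"
      unfolding F1 by (simp add: algebra_simps eval_nat_numeral)
    thus ?thesis using nz by simp
  qed
  have sum: "(f0 + f2) * f1^2 = J * f1 - \<alpha>"
  proof -
    have "(2 * p u - p (u + z) - p (u - z)) * (p z - p u)^2 =
        - (6 * (p u)^2 - g2 / 2) * (p z - p u) - (4 * p u ^ 3 - g2 * p u - g3)"
      unfolding p_def S_def
      by (rule wp_add_sub) (use s(1) S_nz[of 0] S_nz[of 1] S_nz[of 2] nz in \<open>auto simp: S_def u_def algebra_simps\<close>)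
    moreover have "p u = l - f1" "p (u + z) = l - f2" "p (u - z) = l - f0"
      by (simp_all add: f0_def f1_def f2_def)
    moreover have "g2 = 12 * l^2 - 2 * J" "g3 = 4 * l ^ 3 - (12 * l^2 - 2 * J) * l - \<alpha>"
      by (simp_all add: g2_def g3_def somos4_g2_def somos4_g3_def l_def)
    ultimately have "(2 * (l - f1) - (l - f2) - (l - f0)) * f1^2 =
        - (6 * (l - f1)^2 - (12 * l^2 - 2 * J) / 2) * f1
        - (4 * (l - f1) ^ 3 - (12 * l^2 - 2 * J) * (l - f1) - (4 * l ^ 3 - (12 * l^2 - 2 * J) * l - \<alpha>))"
      using pz by simp
    hence "2 * ((f0 + f2) * f1^2) = 2 * (J * f1 - \<alpha>)" by (simp add: field_simps eval_nat_numeral)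
    thus ?thesis by (simp only: mult_cancel_left) simp
  qed
  \<comment> \<open>Inserting the root f2 into the quadratic eliminates f0. The remaining relation
    between f1 and f2 is the first integral divided by x_1^2 x_2^2.\<close>
  have "f2 * ((f0 + f2) * f1^2) = f1^2 * f0 * f2 + f1^2 * f2^2"
    by (simp add: algebra_simps power2_eq_square)
  hence curve: "f1^2 * f2^2 + \<alpha> * (f1 + f2) + \<beta> = J * f1 * f2"
    unfolding sum prod by (simp add: algebra_simps)
  have "(x 1)^2 * (x 2)^2 * (f1^2 * f2^2 + \<alpha> * (f1 + f2) + \<beta>) * ((x 1)^2 * (x 2)^2) =
    ((x 1)^2 * f1)^2 * ((x 2)^2 * f2)^2 + \<alpha> * (((x 1)^2 * f1) * ((x 1)^2 * (x 2)^4) + ((x 2)^2 * f2) * ((x 1)^4 * (x 2)^2)) + \<beta> * (x 1)^4 * (x 2)^4"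
    by (simp add: algebra_simps eval_nat_numeral)
  also have "\<dots> = (x 1)^2 * (x 2)^2 * ((x 0)^2 * (x 3)^2 + \<alpha> * ((x 1) ^ 3 * x 3 + x 0 * (x 2) ^ 3) + \<beta> * (x 1)^2 * (x 2)^2)"
    unfolding F1[symmetric] F2[symmetric] by (simp add: algebra_simps eval_nat_numeral)
  finally have e1: "(x 1)^2 * (x 2)^2 * (J * f1 * f2) * ((x 1)^2 * (x 2)^2) = \<dots>"
    unfolding curve .
  have "(x 1)^2 * (x 2)^2 * (J * f1 * f2) * ((x 1)^2 * (x 2)^2) = (x 1)^2 * (x 2)^2 * J * (((x 1)^2 * f1) * ((x 2)^2 * f2))"
    by (simp add: algebra_simps)
  also have "\<dots> = (x 1)^2 * (x 2)^2 * (J * (x 0 * x 1 * x 2 * x 3))"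
    unfolding F1[symmetric] F2[symmetric] by (simp add: algebra_simps)
  finally show ?thesis using e1 nz by simp
qed

subsection \<open>The branch of the parameter\<close>

text \<open>The iterates $Z \mapsto Z - F(Z(J), J)/c$ contract uniformly in $J$, so that their limit is holomorphic.\<close>
lemma implicit_function_newton:
  fixes F D :: "complex \<Rightarrow> complex \<Rightarrow> complex"
  assumes r: "r > 0" and \<delta>: "\<delta> > 0" and c: "c \<noteq> 0" and F0: "F z J0 = 0"
    and D: "\<And>u J. u \<in> ball z r \<Longrightarrow> J \<in> ball J0 \<delta> \<Longrightarrow> ((\<lambda>u. F u J) has_field_derivative D u J) (at u)"
    and Dc: "\<And>u J. u \<in> ball z r \<Longrightarrow> J \<in> ball J0 \<delta> \<Longrightarrow> norm (D u J - c) \<le> norm c / 2"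
    and Fz: "\<And>J. J \<in> ball J0 \<delta> \<Longrightarrow> norm (F z J) \<le> norm c * r / 4"
    and hol: "\<And>Z. Z holomorphic_on ball J0 \<delta> \<Longrightarrow> (\<And>J. J \<in> ball J0 \<delta> \<Longrightarrow> Z J \<in> ball z r) \<Longrightarrow>
        (\<lambda>J. F (Z J) J) holomorphic_on ball J0 \<delta>"
  obtains Z where "Z holomorphic_on ball J0 \<delta>" "Z J0 = z"
    "\<And>J. J \<in> ball J0 \<delta> \<Longrightarrow> Z J \<in> ball z r \<and> F (Z J) J = 0"
proof -
  define Y where "Y = (\<lambda>k. ((\<lambda>Z J. Z J - F (Z J) J / c) ^^ k) (\<lambda>_. z))"
  have Y0: "Y 0 = (\<lambda>_. z)" and YS: "Y (Suc k) = (\<lambda>J. Y k J - F (Y k J) J / c)" for k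
    by (simp_all add: Y_def)
  have contr: "norm ((u - F u J / c) - (v - F v J / c)) \<le> 1 / 2 * norm (u - v)"
    if "u \<in> ball z r" "v \<in> ball z r" "J \<in> ball J0 \<delta>" for u v J
  proof (rule field_differentiable_bound[OF convex_ball])
    fix w assume w: "w \<in> ball z r"
    show "((\<lambda>u. u - F u J / c) has_field_derivative 1 - D w J / c) (at w within ball z r)"
      by (rule DERIV_diff[OF DERIV_ident DERIV_cdivide[OF has_field_derivative_at_within[OF D[OF w that(3)]]]])
    have "1 - D w J / c = - ((D w J - c) / c)" using c by (simp add: field_simps)
    hence "norm (1 - D w J / c) = norm (D w J - c) / norm c" by (simp add: norm_divide)
    also have "\<dots> \<le> 1 / 2" using Dc[OF w that(3)] c by (simp add: field_simps)
    finally show "norm (1 - D w J / c) \<le> 1 / 2" .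
  qed (use that in auto)
  \<comment> \<open>The step lengths r/4, r/8, ... sum to r/2, so the iterates and their limit stay
    well inside the open ball.\<close>
  have bounds: "norm (Y k J - z) \<le> r / 2 * (1 - (1 / 2) ^ k) \<and> norm (Y (Suc k) J - Y k J) \<le> r / 4 * (1 / 2) ^ k"
    if J: "J \<in> ball J0 \<delta>" for k J
  proof (induction k)
    case 0
    have "norm (F z J) / norm c \<le> r / 4" using Fz[OF J] c by (simp add: field_simps)
    thus ?case by (simp add: Y0 YS norm_divide)
  next
    case (Suc k)
    have pos: "(1 / 2 :: real) ^ k > 0" by simp
    have "norm (Y (Suc k) J - z) \<le> norm (Y (Suc k) J - Y k J) + norm (Y k J - z)"
      by (metis norm_triangle_ineq diff_add_cancel add_diff_eq)
    hence 1: "norm (Y (Suc k) J - z) \<le> r / 2 * (1 - (1 / 2) ^ Suc k)"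
      using Suc by (simp add: algebra_simps)
    have lt: "r / 2 * (1 - (1 / 2) ^ j) < r" for j
    proof -
      have "r / 2 * (1 - (1 / 2) ^ j) \<le> r / 2 * 1" using r by (intro mult_left_mono) auto
      thus ?thesis using r by linarith
    qed
    have in_ball: "Y (Suc k) J \<in> ball z r" "Y k J \<in> ball z r"
      using order.strict_trans1[OF 1 lt] order.strict_trans1[OF conjunct1[OF Suc] lt]
      by (simp_all add: dist_norm norm_minus_commute)
    have "Y (Suc (Suc k)) J - Y (Suc k) J = (Y (Suc k) J - F (Y (Suc k) J) J / c) - (Y k J - F (Y k J) J / c)"
      by (simp add: YS)
    also have "norm \<dots> \<le> 1 / 2 * norm (Y (Suc k) J - Y k J)"
      by (rule contr[OF in_ball J])
    finally show ?case using 1 Suc by simp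
  qed
  have Y_half: "Y k J \<in> cball z (r / 2)" if "J \<in> ball J0 \<delta>" for k J
  proof -
    have "r / 2 * (1 - (1 / 2) ^ k) \<le> r / 2 * 1" using r by (intro mult_left_mono) auto
    hence "norm (Y k J - z) \<le> r / 2" using bounds[OF that, of k] by linarith
    thus ?thesis by (simp add: dist_norm norm_minus_commute)
  qed
  have Y_in: "Y k J \<in> ball z r" if "J \<in> ball J0 \<delta>" for k J
    using Y_half[OF that, of k] r by simp
  have Y_hol: "Y k holomorphic_on ball J0 \<delta>" for k
  proof (induction k)
    case (Suc k)
    show ?case unfolding YS using c Y_in by (intro holomorphic_intros Suc hol) auto
  qed (simp add: Y0)
  define Z where "Z = (\<lambda>J. z + (\<Sum>k. Y (Suc k) J - Y k J))"
  have "summable (\<lambda>k. r / 4 * (1 / 2 :: real) ^ k)" by (intro summable_mult summable_geometric) simp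
  hence "uniform_limit (ball J0 \<delta>) (\<lambda>n J. \<Sum>k<n. Y (Suc k) J - Y k J) (\<lambda>J. \<Sum>k. Y (Suc k) J - Y k J) sequentially"
    using bounds by (intro Weierstrass_m_test[where M = "\<lambda>k. r / 4 * (1 / 2) ^ k"]) blast+
  hence "uniform_limit (ball J0 \<delta>) (\<lambda>n J. z + (\<Sum>k<n. Y (Suc k) J - Y k J)) Z sequentially"
    unfolding Z_def by (intro uniform_limit_intros)
  moreover have "z + (\<Sum>k<n. Y (Suc k) J - Y k J) = Y n J" for n J
    by (subst sum_lessThan_telescope) (simp add: Y0)
  ultimately have ulim: "uniform_limit (ball J0 \<delta>) Y Z sequentially" by simp
  have Z_hol: "Z holomorphic_on ball J0 \<delta>"
  proof (rule holomorphic_uniform_sequence[OF open_ball Y_hol])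
    fix x assume "x \<in> ball J0 \<delta>"
    then obtain d where "d > 0" "cball x d \<subseteq> ball J0 \<delta>" using open_contains_cball_eq open_ball by metis
    thus "\<exists>d>0. cball x d \<subseteq> ball J0 \<delta> \<and> uniform_limit (cball x d) Y Z sequentially"
      using uniform_limit_on_subset[OF ulim] by blast
  qed
  have lim: "(\<lambda>k. Y k J) \<longlonglongrightarrow> Z J" if "J \<in> ball J0 \<delta>" for J
    using tendsto_uniform_limitI[OF ulim that] .
  have ZJ: "Z J \<in> ball z r \<and> F (Z J) J = 0" if J: "J \<in> ball J0 \<delta>" for J
  proof -
    have "Z J \<in> cball z (r / 2)"
      by (rule Lim_in_closed_set[OF closed_cball _ _ lim[OF J]]) (use Y_half[OF J] in auto)
    hence Z_in: "Z J \<in> ball z r" using r by simp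
    have "isCont (\<lambda>u. F u J) (Z J)" by (rule DERIV_isCont[OF D[OF Z_in J]])
    hence "(\<lambda>k. F (Y k J) J) \<longlonglongrightarrow> F (Z J) J" by (rule isCont_tendsto_compose[OF _ lim[OF J]])
    moreover have "(\<lambda>k. c * (Y k J - Y (Suc k) J)) \<longlonglongrightarrow> c * (Z J - Z J)"
      by (intro tendsto_intros lim[OF J] LIMSEQ_Suc)
    moreover have "c * (Y k J - Y (Suc k) J) = F (Y k J) J" for k using c by (simp add: YS)
    ultimately have "F (Z J) J = 0" using LIMSEQ_unique by fastforce
    with Z_in show ?thesis by simp
  qed
  have "Y k J0 = z" for k by (induction k) (simp_all add: Y0 YS F0)
  hence "(\<lambda>k. Y k J0) \<longlonglongrightarrow> z" by simp
  moreover have "(\<lambda>k. Y k J0) \<longlonglongrightarrow> Z J0" by (rule lim) (use \<delta> in simp)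
  ultimately have "Z J0 = z" by (rule LIMSEQ_unique[symmetric])
  thus ?thesis using Z_hol ZJ by (intro that[of Z])
qed

lemma holo3_compose_holomorphic:
  assumes "holo3 UNIV f" "open A" "a holomorphic_on A" "b holomorphic_on A" "c holomorphic_on A"
  shows "(\<lambda>t. f (a t) (b t) (c t)) holomorphic_on A"
  using holo3_chain[OF assms(1), of a _ b c] assms(3-5) holomorphic_derivI[OF _ assms(2)]
  unfolding holomorphic_on_open[OF assms(2)] by blast

lemma holo3_compose_continuous:
  assumes "holo3 UNIV f" "continuous_on A a" "continuous_on A b" "continuous_on A c"
  shows "continuous_on A (\<lambda>t. f (a t) (b t) (c t))"
proof -
  have "continuous_on UNIV (\<lambda>(x, y, z). f x y z)" using assms(1) by (simp add: holo3_def)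
  moreover have "continuous_on A (\<lambda>t. (a t, b t, c t))" by (intro continuous_on_Pair assms(2-4))
  ultimately show ?thesis using continuous_on_compose2 by fastforce
qed

lemma holomorphic_somos4_params:
  "somos4_lam \<alpha> \<beta> holomorphic_on A" "somos4_g2 \<alpha> \<beta> holomorphic_on A" "somos4_g3 \<alpha> \<beta> holomorphic_on A"
proof -
  show lam: "somos4_lam \<alpha> \<beta> holomorphic_on A" for A
    unfolding somos4_lam_def[abs_def] by (cases "\<alpha> = 0") (auto intro!: holomorphic_intros)
  show g2: "somos4_g2 \<alpha> \<beta> holomorphic_on A" for A
    unfolding somos4_g2_def[abs_def] by (intro holomorphic_intros lam)
  show "somos4_g3 \<alpha> \<beta> holomorphic_on A"
    unfolding somos4_g3_def[abs_def] by (intro holomorphic_intros lam g2)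
qed

text \<open>The single equation \<wp>(z) = \<lambda> carries the others: g3 is chosen so that the
  first-order equation gives \<wp>'(z)^2 = \<alpha>, g2 so that the second-order one gives
  \<wp>''(z) = J, and \<lambda> so that the duplication formula gives \<wp>(2z) - \<wp>(z) =
  \<beta>/\<alpha>.\<close>

lemma somos4_paramI:
  fixes \<alpha> \<beta> J z :: complex
  defines "g2 \<equiv> somos4_g2 \<alpha> \<beta> J" and "g3 \<equiv> somos4_g3 \<alpha> \<beta> J"
  assumes "\<alpha> \<noteq> 0" and s: "wsigma g2 g3 z \<noteq> 0" and s2: "wsigma g2 g3 (2 * z) \<noteq> 0"
    and p: "wp_of (wsigma g2 g3) z = somos4_lam \<alpha> \<beta> J"
  shows "somos4_param \<alpha> \<beta> J z"
proof -
  let ?p = "wp_of (wsigma g2 g3)" and ?l = "somos4_lam \<alpha> \<beta> J"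
  have p1: "(deriv ?p z)^2 = \<alpha>"
  proof -
    have "g3 = 4 * ?l ^ 3 - g2 * ?l - \<alpha>" by (simp add: g3_def somos4_g3_def g2_def)
    moreover have "(deriv ?p z)^2 = 4 * ?l ^ 3 - g2 * ?l - g3"
      using sigma_ode[OF s] unfolding wp_ode_def p by blast
    ultimately show ?thesis by simp
  qed
  have p2: "deriv (deriv ?p) z = J"
    using sigma_ode[OF s] unfolding wp_ode_def p by (simp add: g2_def somos4_g2_def field_simps)
  have l: "3 * \<alpha> * ?l = J^2 / 4 - \<beta>" using \<open>\<alpha> \<noteq> 0\<close> by (simp add: somos4_lam_def)
  have "?p (2 * z) - ?p z = J^2 / (4 * \<alpha>) - 3 * ?l"
    using wp_duplication[OF s s2] by (simp add: p p2 power_divide p1)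
  also have "\<dots> = (J^2 / 4 - 3 * \<alpha> * ?l) / \<alpha>"
    using \<open>\<alpha> \<noteq> 0\<close> by (simp add: field_simps)
  also have "\<dots> = \<beta> / \<alpha>" unfolding l by simp
  finally show ?thesis
    using s p p1 p2
    by (simp add: somos4_param_def Let_def weierstrass_p_eq weierstrass_sigma_eq flip: g2_def g3_def)
qed

text \<open>The implicit function theorem for \<wp>(u) = \<lambda>(J), with invariants depending on
  J. The u-derivative is written as -\<sigma>(2u)/\<sigma>(u)^4: its continuity in (u, J) then comes
  from the joint holomorphy of \<sigma>, and it is non-zero at z because \<sigma>(2z) \<noteq>
  0.\<close>

lemma somos4_branch_exists:
  assumes \<alpha>: "\<alpha> \<noteq> 0" and par: "somos4_param \<alpha> \<beta> J0 z"
  shows "\<exists>Z. somos4_branch \<alpha> \<beta> J0 z Z"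
proof -
  define G2 G3 l where "G2 = somos4_g2 \<alpha> \<beta>" and "G3 = somos4_g3 \<alpha> \<beta>" and "l = somos4_lam \<alpha> \<beta>"
  define s where "s = (\<lambda>J. wsigma (G2 J) (G3 J))"
  define F where "F = (\<lambda>u J. wp_of (s J) u - l J)"
  define D where "D = (\<lambda>u J. - s J (2 * u) / s J u ^ 4)"
  define c where "c = D z J0"
  note hol = holomorphic_somos4_params[of \<alpha> \<beta>, folded G2_def G3_def l_def]
  note cont = hol[THEN holomorphic_on_imp_continuous_on]
  note par' = somos4_paramD[OF par \<alpha>, folded G2_def G3_def l_def s_def]
  have s0: "s J0 z \<noteq> 0" "s J0 (2 * z) \<noteq> 0" using par' by (simp_all add: s_def)
  have c: "c \<noteq> 0" using s0 by (simp add: c_def D_def)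
  have F0: "F z J0 = 0" using par'(3) by (simp add: F_def s_def)
  have DF: "((\<lambda>u. F u J) has_field_derivative D u J) (at u)" if "s J u \<noteq> 0" for u J
  proof -
    have "deriv (wp_of (s J)) u = D u J"
      using sigma_double[of "G2 J" "G3 J" u] that by (simp add: D_def s_def)
    moreover have "(wp_of (s J) has_field_derivative deriv (wp_of (s J)) u) (at u)"
      using DERIV_wp_sigma(1) that by (simp add: s_def)
    ultimately show ?thesis unfolding F_def by (auto intro!: derivative_eq_intros)
  qed
  have cs: "isCont (\<lambda>p. s (snd p) (fst p)) x" "isCont (\<lambda>p. s (snd p) (2 * fst p)) x" for x
  proof -
    have G: "continuous_on UNIV (\<lambda>p::complex \<times> complex. G2 (snd p))"
      "continuous_on UNIV (\<lambda>p::complex \<times> complex. G3 (snd p))"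
      by (rule continuous_on_compose2[OF cont(2)[of UNIV]] continuous_on_compose2[OF cont(3)[of UNIV]];
          simp add: continuous_on_snd)+
    have "continuous_on UNIV (\<lambda>p::complex \<times> complex. fst p)" "continuous_on UNIV (\<lambda>p::complex \<times> complex. 2 * fst p)"
      by (intro continuous_intros)+
    from this[THEN holo3_compose_continuous[OF holo3_sigma G]]
    have "continuous_on UNIV (\<lambda>p. wsigma (G2 (snd p)) (G3 (snd p)) (fst p))"
      "continuous_on UNIV (\<lambda>p. wsigma (G2 (snd p)) (G3 (snd p)) (2 * fst p))" .
    thus "isCont (\<lambda>p. s (snd p) (fst p)) x" "isCont (\<lambda>p. s (snd p) (2 * fst p)) x"
      unfolding s_def continuous_on_eq_continuous_at[OF open_UNIV] by blast+
  qed
  have "isCont (\<lambda>p. D (fst p) (snd p)) (z, J0)"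
    unfolding D_def using s0(1) by (intro continuous_intros cs) auto
  hence "((\<lambda>p. D (fst p) (snd p)) \<longlongrightarrow> c) (nhds (z, J0))"
    using tendsto_at_iff_tendsto_nhds[of "\<lambda>p. D (fst p) (snd p)" "(z, J0)"] by (simp add: isCont_def c_def)
  hence "\<forall>\<^sub>F p in nhds (z, J0). dist (D (fst p) (snd p)) c < norm c / 2"
    using c by (intro tendstoD) auto
  moreover have "\<forall>\<^sub>F p in nhds (z, J0). s (snd p) (fst p) \<noteq> 0"
    using s0 by (intro isCont_imp_eventually_ne cs) auto
  ultimately have "\<forall>\<^sub>F p in nhds (z, J0). dist (D (fst p) (snd p)) c < norm c / 2 \<and> s (snd p) (fst p) \<noteq> 0"
    by (rule eventually_conj)
  then obtain U where U: "open U" "(z, J0) \<in> U"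
    "\<forall>p\<in>U. dist (D (fst p) (snd p)) c < norm c / 2 \<and> s (snd p) (fst p) \<noteq> 0"
    unfolding eventually_nhds by blast
  obtain A B where AB: "open A" "open B" "(z, J0) \<in> A \<times> B" "A \<times> B \<subseteq> U"
    using open_prod_elim[OF U(1,2)] by metis
  obtain r \<delta>1 where r: "r > 0" "ball z r \<subseteq> A" "\<delta>1 > 0" "ball J0 \<delta>1 \<subseteq> B"
    using AB open_contains_ball by (metis mem_Sigma_iff)
  have UD: "norm (D u J - c) < norm c / 2" "s J u \<noteq> 0" if "u \<in> ball z r" "J \<in> ball J0 \<delta>1" for u J
  proof -
    have "(u, J) \<in> U" using that r AB by blast
    with U(3) show "norm (D u J - c) < norm c / 2" "s J u \<noteq> 0" by (force simp: dist_norm)+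
  qed
  have hol_F: "(\<lambda>J. F (Z J) J) holomorphic_on ball J0 \<delta>"
    if "Z holomorphic_on ball J0 \<delta>" "\<And>J. J \<in> ball J0 \<delta> \<Longrightarrow> s J (Z J) \<noteq> 0" for Z \<delta>
    unfolding F_def s_def wp_of_sigma_eq
    by (intro holomorphic_intros hol holo3_compose_holomorphic[OF holo3_wp_num[OF holo3_sigma]]
        holo3_compose_holomorphic[OF holo3_sigma] that(1) open_ball)
      (use that(2) in \<open>simp add: s_def\<close>)
  have "(\<lambda>J. F z J) holomorphic_on ball J0 \<delta>1"
    using hol_F[of "\<lambda>_. z" \<delta>1] UD(2)[of z] r by auto
  hence "isCont (F z) J0"
    using r by (metis centre_in_ball continuous_on_eq_continuous_at holomorphic_on_imp_continuous_on open_ball)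
  hence "((\<lambda>J. F z J) \<longlongrightarrow> 0) (nhds J0)"
    using F0 tendsto_at_iff_tendsto_nhds[of "F z" J0] by (simp add: isCont_def)
  hence "\<forall>\<^sub>F J in nhds J0. dist (F z J) 0 < norm c * r / 4"
    using c r by (intro tendstoD) auto
  then obtain \<delta>2 where \<delta>2: "\<delta>2 > 0" "\<And>J. dist J J0 < \<delta>2 \<Longrightarrow> norm (F z J) < norm c * r / 4"
    unfolding eventually_nhds_metric by auto
  define \<delta> where "\<delta> = min \<delta>1 \<delta>2"
  have \<delta>: "\<delta> > 0" "ball J0 \<delta> \<subseteq> ball J0 \<delta>1" using r \<delta>2 by (auto simp: \<delta>_def)
  obtain Z where Z: "Z holomorphic_on ball J0 \<delta>" "Z J0 = z"
    "\<And>J. J \<in> ball J0 \<delta> \<Longrightarrow> Z J \<in> ball z r \<and> F (Z J) J = 0"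
  proof (rule implicit_function_newton[of r \<delta> c F z J0 D, OF r(1) \<delta>(1) c F0])
    show "((\<lambda>u. F u J) has_field_derivative D u J) (at u)" if "u \<in> ball z r" "J \<in> ball J0 \<delta>" for u J
      using UD(2)[of u J] that \<delta> by (intro DF) auto
    show "norm (D u J - c) \<le> norm c / 2" if "u \<in> ball z r" "J \<in> ball J0 \<delta>" for u J
      using UD(1)[of u J] that \<delta> by auto
    show "norm (F z J) \<le> norm c * r / 4" if "J \<in> ball J0 \<delta>" for J
      using \<delta>2(2)[of J] that by (auto simp: \<delta>_def dist_commute)
    show "(\<lambda>J. F (Z J) J) holomorphic_on ball J0 \<delta>"
      if "Z holomorphic_on ball J0 \<delta>" "\<And>J. J \<in> ball J0 \<delta> \<Longrightarrow> Z J \<in> ball z r" for Z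
      using that \<delta> UD(2) by (intro hol_F) auto
  qed blast
  have "somos4_param \<alpha> \<beta> J (Z J)" if J: "J \<in> ball J0 \<delta>" for J
  proof (rule somos4_paramI[OF \<alpha>])
    have ZJ: "Z J \<in> ball z r" "F (Z J) J = 0" and J1: "J \<in> ball J0 \<delta>1" using Z(3)[OF J] J \<delta> by auto
    show "wsigma (somos4_g2 \<alpha> \<beta> J) (somos4_g3 \<alpha> \<beta> J) (Z J) \<noteq> 0"
      using UD(2)[OF ZJ(1) J1] by (simp add: s_def G2_def G3_def)
    have "D (Z J) J \<noteq> 0" using UD(1)[OF ZJ(1) J1] c by auto
    thus "wsigma (somos4_g2 \<alpha> \<beta> J) (somos4_g3 \<alpha> \<beta> J) (2 * Z J) \<noteq> 0"
      by (auto simp: D_def s_def G2_def G3_def)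
    show "wp_of (wsigma (somos4_g2 \<alpha> \<beta> J) (somos4_g3 \<alpha> \<beta> J)) (Z J) = somos4_lam \<alpha> \<beta> J"
      using ZJ(2) by (simp add: F_def s_def G2_def G3_def l_def)
  qed
  moreover have "\<forall>\<^sub>F J in nhds J0. J \<in> ball J0 \<delta>" using \<delta> by (intro eventually_nhds_in_open) auto
  ultimately have "\<forall>\<^sub>F J in nhds J0. somos4_param \<alpha> \<beta> J (Z J)" by (auto elim: eventually_mono)
  moreover have "Z analytic_on {J0}" using Z(1) \<delta>(1) by (auto simp: analytic_at intro!: exI[of _ "ball J0 \<delta>"])
  ultimately have "somos4_branch \<alpha> \<beta> J0 z Z" using Z(2) by (simp add: somos4_branch_def)
  thus ?thesis by blast
qed

subsection \<open>Derivatives of the sigma solution\<close>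

text \<open>The derivative of x_n when g2, g3, z move with velocities a, b, c. The weight k inside
  is the velocity factor of the sigma argument: n for w + nz and 1 for z. Only \<sigma>(z) is
  divided by, so the formula is meaningful and continuous in w where x_n vanishes.\<close>

definition sol_deriv ::
    "complex \<Rightarrow> complex \<Rightarrow> complex \<Rightarrow> complex \<Rightarrow> complex \<Rightarrow> complex \<Rightarrow> int \<Rightarrow> complex \<Rightarrow> complex \<Rightarrow> complex \<Rightarrow> complex"
  where
  "sol_deriv A B w z g2 g3 n a b c =
     (let \<sigma>' = (\<lambda>u k. a * deriv (\<lambda>t. wsigma t g3 u) g2 + b * deriv (\<lambda>t. wsigma g2 t u) g3
                    + k * c * deriv (wsigma g2 g3) u);
          q = wsigma g2 g3 z powi (n^2)
      in A * B powi n * (\<sigma>' (w + of_int n * z) (of_int n) * q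
           - wsigma g2 g3 (w + of_int n * z) * (of_int (n^2) * wsigma g2 g3 z powi (n^2 - 1) * \<sigma>' z 1)) / (q * q))"

lemma DERIV_somos4_sol:
  assumes s: "wsigma (a t0) (b t0) (c t0) \<noteq> 0"
    and a: "(a has_field_derivative a') (at t0)" and b: "(b has_field_derivative b') (at t0)"
    and c: "(c has_field_derivative c') (at t0)"
  shows "((\<lambda>t. somos4_sol A B w (c t) (a t) (b t) n) has_field_derivative
           sol_deriv A B w (c t0) (a t0) (b t0) n a' b' c') (at t0)"
proof -
  define N' where "N' = a' * deriv (\<lambda>t. wsigma t (b t0) (w + of_int n * c t0)) (a t0)
    + b' * deriv (\<lambda>t. wsigma (a t0) t (w + of_int n * c t0)) (b t0)
    + of_int n * c' * deriv (wsigma (a t0) (b t0)) (w + of_int n * c t0)"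
  define s' where "s' = a' * deriv (\<lambda>t. wsigma t (b t0) (c t0)) (a t0)
    + b' * deriv (\<lambda>t. wsigma (a t0) t (c t0)) (b t0) + 1 * c' * deriv (wsigma (a t0) (b t0)) (c t0)"
  have "((\<lambda>t. w + of_int n * c t) has_field_derivative of_int n * c') (at t0)"
    using c by (auto intro!: derivative_eq_intros)
  from holo3_chain[OF holo3_sigma UNIV_I a b this]
  have N: "((\<lambda>t. wsigma (a t) (b t) (w + of_int n * c t)) has_field_derivative N') (at t0)"
    by (simp add: N'_def)
  from holo3_chain[OF holo3_sigma UNIV_I a b c]
  have "((\<lambda>t. wsigma (a t) (b t) (c t)) has_field_derivative s') (at t0)" by (simp add: s'_def)
  hence q: "((\<lambda>t. wsigma (a t) (b t) (c t) powi (n^2)) has_field_derivative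
      of_int (n^2) * wsigma (a t0) (b t0) (c t0) powi (n^2 - 1) * s') (at t0)"
    by (rule DERIV_power_int) (simp add: s)
  have "wsigma (a t0) (b t0) (c t0) powi (n^2) \<noteq> 0" using s by simp
  from DERIV_divide[OF DERIV_cmult[OF N, of "A * B powi n"] q this]
  show ?thesis
    unfolding somos4_sol_def weierstrass_sigma_eq sol_deriv_def Let_def N'_def[symmetric] s'_def[symmetric]
    by (simp add: algebra_simps)
qed

lemma sol_deriv_linear:
  "sol_deriv A B w z g2 g3 n a b c =
     c * sol_deriv A B w z g2 g3 n 0 0 1 + a * sol_deriv A B w z g2 g3 n 1 0 0 + b * sol_deriv A B w z g2 g3 n 0 1 0"
  unfolding sol_deriv_def Let_def times_divide_eq_right add_divide_distrib[symmetric]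
  by (simp add: algebra_simps)

lemma isCont_sol_deriv: "isCont (\<lambda>w. sol_deriv A B w z g2 g3 n a b c) w0"
proof -
  have "continuous_on UNIV (\<lambda>(x, y, z). deriv (\<lambda>t. wsigma t y z) x)"
    "continuous_on UNIV (\<lambda>(x, y, z). deriv (\<lambda>t. wsigma x t z) y)"
    by (rule holo3_continuous_partials[OF holo3_sigma])+
  hence part: "continuous_on UNIV (\<lambda>w. deriv (\<lambda>t. wsigma t g3 (w + k)) g2)"
    "continuous_on UNIV (\<lambda>w. deriv (\<lambda>t. wsigma g2 t (w + k)) g3)" for k
    using continuous_on_compose2[of UNIV "\<lambda>(x, y, z). deriv (\<lambda>t. wsigma t y z) x" UNIV "\<lambda>w. (g2, g3, w + k)"]
      continuous_on_compose2[of UNIV "\<lambda>(x, y, z). deriv (\<lambda>t. wsigma x t z) y" UNIV "\<lambda>w. (g2, g3, w + k)"]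
    by (simp_all add: continuous_on_Pair continuous_on_add)
  have shift: "continuous_on UNIV (\<lambda>w. f (w + k))" if "f holomorphic_on UNIV" for f and k :: complex
    by (rule continuous_on_compose2[OF holomorphic_on_imp_continuous_on[OF that]]) (auto intro!: continuous_intros)
  have "continuous_on UNIV (\<lambda>w. sol_deriv A B w z g2 g3 n a b c)"
    unfolding sol_deriv_def Let_def divide_inverse
    by (intro continuous_on_mult continuous_on_add continuous_on_diff continuous_on_const part
        shift holomorphic_sigma holomorphic_deriv open_UNIV)
  thus ?thesis by (simp add: continuous_on_eq_continuous_at)
qed

section \<open>The derivative in z_0, and removal of the singularities at zeros of x_n\<close>

definition sol_deriv_z0 ::
    "complex \<Rightarrow> complex \<Rightarrow> complex \<Rightarrow> complex \<Rightarrow> complex \<Rightarrow> complex \<Rightarrow> int \<Rightarrow> complex" where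
  "sol_deriv_z0 A B w z g2 g3 n =
     A * B powi n * deriv (wsigma g2 g3) (w + of_int n * z) / wsigma g2 g3 z powi (n^2)"

lemma DERIV_somos4_sol_z0:
  "((\<lambda>w. somos4_sol A B w z g2 g3 n) has_field_derivative sol_deriv_z0 A B w z g2 g3 n) (at w)"
proof -
  have "((\<lambda>w. wsigma g2 g3 (w + of_int n * z)) has_field_derivative deriv (wsigma g2 g3) (w + of_int n * z)) (at w)"
    by (rule DERIV_compose_add[OF DERIV_sigma(1)])
  from DERIV_cdivide[OF DERIV_cmult[OF this, of "A * B powi n"], of "wsigma g2 g3 z powi (n^2)"]
  show ?thesis
    unfolding somos4_sol_def weierstrass_sigma_eq sol_deriv_z0_def .
qed

lemma isCont_sol_deriv_z0: "isCont (\<lambda>w. sol_deriv_z0 A B w z g2 g3 n) w0"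
proof -
  have "((\<lambda>w. deriv (wsigma g2 g3) (w + of_int n * z)) has_field_derivative
      deriv (deriv (wsigma g2 g3)) (w0 + of_int n * z)) (at w0)"
    by (rule DERIV_compose_add[OF DERIV_sigma(2)])
  from DERIV_isCont[OF DERIV_cdivide[OF DERIV_cmult[OF this]]]
  show ?thesis unfolding sol_deriv_z0_def .
qed

lemma somos4_sol_eq_0_iff:
  assumes "wsigma g2 g3 z \<noteq> 0" "A \<noteq> 0" "B \<noteq> 0"
  shows "somos4_sol A B w z g2 g3 n = 0 \<longleftrightarrow> wsigma g2 g3 (w + of_int n * z) = 0"
  using assms by (simp add: somos4_sol_def weierstrass_sigma_eq)

lemma eventually_somos4_sol_nonzero:
  assumes "wsigma g2 g3 z \<noteq> 0" "A \<noteq> 0" "B \<noteq> 0"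
  shows "\<forall>\<^sub>F w in at w0. somos4_sol A B w z g2 g3 n \<noteq> 0"
proof -
  have "\<forall>\<^sub>F u in at (w0 + of_int n * z). wsigma g2 g3 u \<noteq> 0" by (rule eventually_sigma_nonzero)
  hence "\<forall>\<^sub>F w in at w0. wsigma g2 g3 (w + of_int n * z) \<noteq> 0"
    by (subst (asm) at_to_0, subst at_to_0) (simp add: eventually_filtermap add_ac)
  thus ?thesis by eventually_elim (simp add: somos4_sol_eq_0_iff[OF assms])
qed

text \<open>The conditional is the shape in which (iii) and (iv) are given. Zeros of X are isolated
  near z0, so a continuous K that agrees with y off these zeros is the value in both cases.\<close>

lemma continuous_extension_eq:
  fixes X y K :: "complex \<Rightarrow> complex"
  assumes "\<And>w. X w \<noteq> 0 \<Longrightarrow> y w = K w" "\<forall>\<^sub>F w in at z0. X w \<noteq> 0" "isCont K z0"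
  shows "(if X z0 \<noteq> 0 then y z0 else Lim (at z0) y) = K z0"
proof -
  have "\<forall>\<^sub>F w in at z0. K w = y w" using assms(2) by eventually_elim (simp add: assms(1))
  moreover have "K \<midarrow>z0\<rightarrow> K z0" using assms(3) by (simp add: isCont_def)
  ultimately have "y \<midarrow>z0\<rightarrow> K z0" using Lim_transform_eventually by blast
  hence "Lim (at z0) y = K z0" by (intro tendsto_Lim) auto
  thus ?thesis using assms(1) by simp
qed

lemma shadow_iii_eq:
  assumes "wsigma g2 g3 z \<noteq> 0" "A \<noteq> 0" "B \<noteq> 0"
  shows "shadow_iii A B z0 z g2 g3 n = sol_deriv_z0 A B z0 z g2 g3 n"
  unfolding shadow_iii_def Let_def
proof (rule continuous_extension_eq)
  fix w assume "somos4_sol A B w z g2 g3 n \<noteq> 0"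
  hence "wsigma g2 g3 (w + of_int n * z) \<noteq> 0" by (simp add: somos4_sol_eq_0_iff[OF assms])
  thus "somos4_sol A B w z g2 g3 n * weierstrass_zeta g2 g3 (w + of_int n * z) = sol_deriv_z0 A B w z g2 g3 n"
    by (simp add: somos4_sol_def sol_deriv_z0_def weierstrass_sigma_eq weierstrass_zeta_eq)
qed (intro eventually_somos4_sol_nonzero isCont_sol_deriv_z0 assms)+

text \<open>All products in the recurrence have index sum 2n + 4. Hence inserting x gives twice the
  defect of the recurrence, and inserting n x_n gives 2n + 4 times the defect.\<close>

lemma somos4_shadow_self:
  assumes "somos4 \<alpha> \<beta> x"
  shows "somos4_shadow \<alpha> \<beta> x x" "somos4_shadow \<alpha> \<beta> x (\<lambda>n. of_int n * x n)"
proof -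
  have eq: "x (n + 4) * x n = \<alpha> * (x (n + 3) * x (n + 1)) + \<beta> * (x (n + 2))^2" for n
    using assms by (simp add: somos4_def mult.assoc)
  show "somos4_shadow \<alpha> \<beta> x x"
    unfolding somos4_shadow_def
  proof
    fix n
    let ?E = "x n * x (n + 4) - \<alpha> * x (n + 1) * x (n + 3) - 2 * \<beta> * x (n + 2) * x (n + 2)
        - \<alpha> * x (n + 3) * x (n + 1) + x (n + 4) * x n"
    have "?E
      = 2 * (x (n + 4) * x n - (\<alpha> * (x (n + 3) * x (n + 1)) + \<beta> * (x (n + 2))^2))"
      by (simp add: algebra_simps power2_eq_square)
    thus "?E = 0" by (simp add: eq)
  qed
  show "somos4_shadow \<alpha> \<beta> x (\<lambda>n. of_int n * x n)"
    unfolding somos4_shadow_def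
  proof
    fix n
    let ?E = "x n * (of_int (n + 4) * x (n + 4)) - \<alpha> * x (n + 1) * (of_int (n + 3) * x (n + 3))
        - 2 * \<beta> * x (n + 2) * (of_int (n + 2) * x (n + 2))
        - \<alpha> * x (n + 3) * (of_int (n + 1) * x (n + 1)) + x (n + 4) * (of_int n * x n)"
    have "?E
      = (2 * of_int n + 4) * (x (n + 4) * x n - (\<alpha> * (x (n + 3) * x (n + 1)) + \<beta> * (x (n + 2))^2))"
      by (simp add: algebra_simps power2_eq_square)
    thus "?E = 0" by (simp add: eq)
  qed
qed

text \<open>The shadow equation is the linearisation of the recurrence for fixed \<alpha> and
  \<beta>; its coefficient 2 \<beta> comes from the square.\<close>

lemma somos4_shadow_derivative:
  fixes X :: "complex \<Rightarrow> int \<Rightarrow> complex"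
  assumes ev: "\<forall>\<^sub>F t in nhds t0. somos4 \<alpha> \<beta> (X t)"
    and der: "\<And>n. ((\<lambda>t. X t n) has_field_derivative Y n) (at t0)"
  shows "somos4_shadow \<alpha> \<beta> (X t0) Y"
  unfolding somos4_shadow_def
proof
  fix n
  let ?R = "\<lambda>t. X t (n + 4) * X t n - (\<alpha> * (X t (n + 3) * X t (n + 1)) + \<beta> * (X t (n + 2) * X t (n + 2)))"
  have "(?R has_field_derivative Y (n + 4) * X t0 n + Y n * X t0 (n + 4)
      - (\<alpha> * (Y (n + 3) * X t0 (n + 1) + Y (n + 1) * X t0 (n + 3))
       + \<beta> * (Y (n + 2) * X t0 (n + 2) + Y (n + 2) * X t0 (n + 2)))) (at t0)"
    by (intro DERIV_diff DERIV_add DERIV_cmult DERIV_mult der)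
  moreover have "((\<lambda>t. 0) has_field_derivative 0) (at t0)" by (rule DERIV_const)
  moreover have "\<forall>\<^sub>F t in nhds t0. ?R t = 0"
    using ev by eventually_elim (simp add: somos4_def mult.assoc power2_eq_square)
  ultimately have "Y (n + 4) * X t0 n + Y n * X t0 (n + 4)
      - (\<alpha> * (Y (n + 3) * X t0 (n + 1) + Y (n + 1) * X t0 (n + 3))
       + \<beta> * (Y (n + 2) * X t0 (n + 2) + Y (n + 2) * X t0 (n + 2))) = 0"
    by (rule DERIV_unique_eventually)
  thus "X t0 n * Y (n + 4) - \<alpha> * X t0 (n + 1) * Y (n + 3) - 2 * \<beta> * X t0 (n + 2) * Y (n + 2)
      - \<alpha> * X t0 (n + 3) * Y (n + 1) + X t0 (n + 4) * Y n = 0"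
    by (simp add: algebra_simps)
qed

text \<open>The linearisation at $x$ in direction $y$ of
  $x_0^2 x_3^2 + \alpha (x_1^3 x_3 + x_0 x_2^3) + \beta x_1^2 x_2^2 - J x_0 x_1 x_2 x_3$.\<close>
definition integral_lin :: "complex \<Rightarrow> complex \<Rightarrow> complex \<Rightarrow> (int \<Rightarrow> complex) \<Rightarrow> (int \<Rightarrow> complex) \<Rightarrow> complex" where
  "integral_lin \<alpha> \<beta> J x y =
     2 * x 0 * y 0 * (x 3)^2 + 2 * (x 0)^2 * x 3 * y 3
     + \<alpha> * (3 * (x 1)^2 * y 1 * x 3 + (x 1) ^ 3 * y 3 + y 0 * (x 2) ^ 3 + 3 * x 0 * (x 2)^2 * y 2)
     + \<beta> * (2 * x 1 * y 1 * (x 2)^2 + 2 * (x 1)^2 * x 2 * y 2)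
     - J * (y 0 * x 1 * x 2 * x 3 + x 0 * y 1 * x 2 * x 3 + x 0 * x 1 * y 2 * x 3 + x 0 * x 1 * x 2 * y 3)"

lemma integral_lin_derivative:
  fixes X :: "complex \<Rightarrow> int \<Rightarrow> complex" and j :: "complex \<Rightarrow> complex"
  assumes der: "\<And>n. ((\<lambda>t. X t n) has_field_derivative Y n) (at t0)"
    and j: "(j has_field_derivative j') (at t0)"
    and ev: "\<forall>\<^sub>F t in nhds t0. (X t 0)^2 * (X t 3)^2 + \<alpha> * ((X t 1) ^ 3 * X t 3 + X t 0 * (X t 2) ^ 3)
        + \<beta> * (X t 1)^2 * (X t 2)^2 = j t * (X t 0 * X t 1 * X t 2 * X t 3)"
  shows "integral_lin \<alpha> \<beta> (j t0) (X t0) Y = j' * (X t0 0 * X t0 1 * X t0 2 * X t0 3)"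
proof -
  let ?L = "\<lambda>t. (X t 0)^2 * (X t 3)^2 + \<alpha> * ((X t 1) ^ 3 * X t 3 + X t 0 * (X t 2) ^ 3)
        + \<beta> * (X t 1)^2 * (X t 2)^2 - j t * (X t 0 * X t 1 * X t 2 * X t 3)"
  have "(?L has_field_derivative integral_lin \<alpha> \<beta> (j t0) (X t0) Y - j' * (X t0 0 * X t0 1 * X t0 2 * X t0 3)) (at t0)"
    unfolding integral_lin_def
    by (rule derivative_eq_intros der j refl)+ (simp add: algebra_simps eval_nat_numeral)
  moreover have "((\<lambda>t. 0) has_field_derivative 0) (at t0)" by (rule DERIV_const)
  moreover have "\<forall>\<^sub>F t in nhds t0. ?L t = 0" using ev by eventually_elim simp
  ultimately have "integral_lin \<alpha> \<beta> (j t0) (X t0) Y - j' * (X t0 0 * X t0 1 * X t0 2 * X t0 3) = 0"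
    by (rule DERIV_unique_eventually)
  thus ?thesis by simp
qed

text \<open>Both sides of the first integral are homogeneous of degree 4 and of weight 6 in the index.\<close>
lemma integral_lin_affine:
  fixes x :: "int \<Rightarrow> complex"
  assumes "(x 0)^2 * (x 3)^2 + \<alpha> * ((x 1) ^ 3 * x 3 + x 0 * (x 2) ^ 3) + \<beta> * (x 1)^2 * (x 2)^2
      = J * (x 0 * x 1 * x 2 * x 3)"
    and v: "v 0 = a * x 0" "v 1 = (a + b) * x 1" "v 2 = (a + 2 * b) * x 2" "v 3 = (a + 3 * b) * x 3"
  shows "integral_lin \<alpha> \<beta> J x v = 0"
proof -
  have "integral_lin \<alpha> \<beta> J x v = (4 * a + 6 * b) * ((x 0)^2 * (x 3)^2 + \<alpha> * ((x 1) ^ 3 * x 3 + x 0 * (x 2) ^ 3)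
      + \<beta> * (x 1)^2 * (x 2)^2 - J * (x 0 * x 1 * x 2 * x 3))"
    unfolding integral_lin_def v by (simp add: algebra_simps eval_nat_numeral)
  thus ?thesis using assms(1) by simp
qed

lemma integral_lin_linear:
  "integral_lin \<alpha> \<beta> J x (\<lambda>n. a * y n + b * y' n) = a * integral_lin \<alpha> \<beta> J x y + b * integral_lin \<alpha> \<beta> J x y'"
  by (simp add: integral_lin_def algebra_simps)

text \<open>If $\zeta$ takes affine values on $u - z, u, u + z$, then $u$ is a half period.\<close>
lemma sigma_double_eq_0:
  fixes g2 g3 :: complex
  defines "S \<equiv> wsigma g2 g3"
  assumes nz: "S u \<noteq> 0" "S z \<noteq> 0" and c: "c \<noteq> 0"
    and aff: "c * deriv S (u - z) = (a - b) * S (u - z)" "c * deriv S u = a * S u"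
      "c * deriv S (u + z) = (a + b) * S (u + z)"
  shows "S (2 * u) = 0"
proof -
  have "((\<lambda>v. S (v + z) * S (v - z)) has_field_derivative
      deriv S (u + z) * S (u - z) + deriv S (u - z) * S (u + z)) (at u)"
  proof (rule DERIV_mult)
    show "((\<lambda>v. S (v + z)) has_field_derivative deriv S (u + z)) (at u)"
      unfolding S_def by (rule DERIV_compose_add[OF DERIV_sigma(1)])
    show "((\<lambda>v. S (v - z)) has_field_derivative deriv S (u - z)) (at u)"
      using DERIV_compose_add[of S "deriv S (u - z)" u "- z"] DERIV_sigma(1)[of g2 g3 "u - z"] by (simp add: S_def)
  qed
  moreover have "((\<lambda>v. addN S v z) has_field_derivative 2 * S u * deriv S u * wp_num S z - deriv (wp_num S) u * (S z)^2) (at u)"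
    unfolding addN_def S_def by (auto intro!: derivative_eq_intros DERIV_sigma)
  moreover have "\<forall>\<^sub>F v in nhds u. S (v + z) * S (v - z) = addN S v z"
    by (simp add: S_def sigma_addition)
  ultimately have d: "deriv S (u + z) * S (u - z) + deriv S (u - z) * S (u + z) =
      2 * S u * deriv S u * wp_num S z - deriv (wp_num S) u * (S z)^2"
    by (rule DERIV_unique_eventually)
  have "c * (deriv S (u + z) * S (u - z) + deriv S (u - z) * S (u + z)) =
      (c * deriv S (u + z)) * S (u - z) + (c * deriv S (u - z)) * S (u + z)"
    by (simp add: algebra_simps)
  also have "\<dots> = 2 * a * (S (u + z) * S (u - z))" unfolding aff by (simp add: algebra_simps)
  also have "S (u + z) * S (u - z) = (S u)^2 * wp_num S z - wp_num S u * (S z)^2"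
    unfolding S_def sigma_addition addN_def ..
  finally have "2 * S u * (c * deriv S u) * wp_num S z - c * deriv (wp_num S) u * (S z)^2
      = 2 * a * ((S u)^2 * wp_num S z - wp_num S u * (S z)^2)"
    unfolding d by (simp add: algebra_simps)
  hence "(S z)^2 * (c * deriv (wp_num S) u) = (S z)^2 * (2 * a * wp_num S u)"
    unfolding aff by (auto simp: algebra_simps power2_eq_square)
  moreover have "(S z)^2 \<noteq> 0" using nz by simp
  \<comment> \<open>Together with c \<sigma>'(u) = a \<sigma>(u), this equation expresses \<wp>'(u)
    = 0 through the numerator of \<wp>.\<close>
  ultimately have e: "c * deriv (wp_num S) u = 2 * a * wp_num S u" by (metis mult_left_cancel)
  have "c * S (2 * u) = 2 * S u * (c * deriv S u) * wp_num S u - (c * deriv (wp_num S) u) * (S u)^2"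
    unfolding S_def sigma_duplication dup_def by (simp add: algebra_simps)
  also have "\<dots> = 0" unfolding aff e by (simp add: algebra_simps power2_eq_square)
  finally show ?thesis using c by simp
qed

text \<open>Only J = \<open>j t\<close> is followed along the family; z and the shift are left
  existential, so that moving z_0 at fixed J and moving J along a branch are covered alike. By
  continuity the four values stay non-zero near \<open>t0\<close>, where the first integral may then
  be applied.\<close>

lemma first_integral_derivative:
  fixes X :: "complex \<Rightarrow> int \<Rightarrow> complex" and j :: "complex \<Rightarrow> complex"
  assumes sol: "\<forall>\<^sub>F t in nhds t0. \<exists>z w. somos4_param \<alpha> \<beta> (j t) z \<and>
      X t = somos4_sol A B w z (somos4_g2 \<alpha> \<beta> (j t)) (somos4_g3 \<alpha> \<beta> (j t))"
    and \<alpha>B: "\<alpha> \<noteq> 0" "B \<noteq> 0"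
    and der: "\<And>n. ((\<lambda>t. X t n) has_field_derivative Y n) (at t0)"
    and j: "(j has_field_derivative j') (at t0)"
    and nz: "X t0 0 \<noteq> 0" "X t0 1 \<noteq> 0" "X t0 2 \<noteq> 0" "X t0 3 \<noteq> 0"
  shows "integral_lin \<alpha> \<beta> (j t0) (X t0) Y = j' * (X t0 0 * X t0 1 * X t0 2 * X t0 3)"
proof (rule integral_lin_derivative[OF der j])
  have "\<forall>\<^sub>F t in nhds t0. X t n \<noteq> 0" if "X t0 n \<noteq> 0" for n
    using DERIV_isCont[OF der] that by (rule isCont_imp_eventually_ne)
  from this[OF nz(1)] this[OF nz(2)] this[OF nz(3)] this[OF nz(4)] sol
  show "\<forall>\<^sub>F t in nhds t0. (X t 0)^2 * (X t 3)^2 + \<alpha> * ((X t 1) ^ 3 * X t 3 + X t 0 * (X t 2) ^ 3)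
      + \<beta> * (X t 1)^2 * (X t 2)^2 = j t * (X t 0 * X t 1 * X t 2 * X t 3)"
  proof eventually_elim
    case (elim t)
    then obtain z w where zw: "somos4_param \<alpha> \<beta> (j t) z"
      "X t = somos4_sol A B w z (somos4_g2 \<alpha> \<beta> (j t)) (somos4_g3 \<alpha> \<beta> (j t))" by blast
    show ?case unfolding zw(2)
      by (rule somos4_sol_first_integral[OF zw(1) \<alpha>B]) (use elim in \<open>simp_all add: zw(2)\<close>)
  qed
qed

theorem lemma3p1:
  fixes \<alpha> \<beta> A B z0 z J0 g2 g3 :: complex and x :: "int \<Rightarrow> complex"
  assumes "\<alpha> \<noteq> 0" and "A \<noteq> 0" and "B \<noteq> 0"
    and "somos4 \<alpha> \<beta> x"
    and "x 0 \<noteq> 0" and "x 1 \<noteq> 0" and "x 2 \<noteq> 0" and "x 3 \<noteq> 0"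
    and "J0 = somos4_integral \<alpha> \<beta> x 0"
    and "g2 = somos4_g2 \<alpha> \<beta> J0" and "g3 = somos4_g3 \<alpha> \<beta> J0"
    and "somos4_param \<alpha> \<beta> J0 z"
    and "\<And>n. x n = somos4_sol A B z0 z g2 g3 n"
  shows "(\<exists>Z. somos4_branch \<alpha> \<beta> J0 z Z) \<and>
    (\<forall>Z. somos4_branch \<alpha> \<beta> J0 z Z \<longrightarrow>
      (\<forall>n. (\<lambda>J. somos4_sol A B z0 (Z J) (somos4_g2 \<alpha> \<beta> J) (somos4_g3 \<alpha> \<beta> J) n)
              field_differentiable (at J0) \<and>
           (\<lambda>t. somos4_sol A B z0 t g2 g3 n) field_differentiable (at z) \<and>
           (\<lambda>t. somos4_sol A B z0 z t g3 n) field_differentiable (at g2) \<and>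
           (\<lambda>t. somos4_sol A B z0 z g2 t n) field_differentiable (at g3) \<and>
           shadow_iv \<alpha> \<beta> J0 A B z0 Z n = shadow_iv_chain \<alpha> \<beta> J0 A B z0 Z n) \<and>
      somos4_shadow \<alpha> \<beta> x x \<and>
      somos4_shadow \<alpha> \<beta> x (\<lambda>n. of_int n * x n) \<and>
      somos4_shadow \<alpha> \<beta> x (shadow_iii A B z0 z g2 g3) \<and>
      somos4_shadow \<alpha> \<beta> x (shadow_iv \<alpha> \<beta> J0 A B z0 Z) \<and>
      lin_indep4 x (\<lambda>n. of_int n * x n)
        (shadow_iii A B z0 z g2 g3) (shadow_iv \<alpha> \<beta> J0 A B z0 Z))"
proof (intro conjI allI impI)
  note \<alpha> = assms(1) and AB = assms(2,3) and par = assms(12)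
  note g = assms(10,11)
  have x: "x = somos4_sol A B z0 z g2 g3" using assms(13) by (simp add: fun_eq_iff)
  note par' = somos4_paramD[OF par \<alpha>, folded g]
  have s: "wsigma g2 g3 z \<noteq> 0" by (rule par'(1))
  show "\<exists>Z. somos4_branch \<alpha> \<beta> J0 z Z" by (rule somos4_branch_exists[OF \<alpha> par])
  show "somos4_shadow \<alpha> \<beta> x x" "somos4_shadow \<alpha> \<beta> x (\<lambda>n. of_int n * x n)"
    by (rule somos4_shadow_self[OF assms(4)])+
  have Y3: "shadow_iii A B z0 z g2 g3 = sol_deriv_z0 A B z0 z g2 g3"
    using shadow_iii_eq[OF s AB] by (simp add: fun_eq_iff)
  have sol_w: "somos4 \<alpha> \<beta> (somos4_sol A B w z g2 g3)" for w
    using somos4_sol_somos4[OF par \<alpha> AB(2)] by (simp add: g)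
  show "somos4_shadow \<alpha> \<beta> x (shadow_iii A B z0 z g2 g3)"
    unfolding Y3 x
    by (rule somos4_shadow_derivative[where X = "\<lambda>w. somos4_sol A B w z g2 g3"])
      (auto intro: sol_w DERIV_somos4_sol_z0 always_eventually)
  fix Z assume "somos4_branch \<alpha> \<beta> J0 z Z"
  hence Z: "Z analytic_on {J0}" "Z J0 = z" "\<forall>\<^sub>F J in nhds J0. somos4_param \<alpha> \<beta> J (Z J)"
    by (auto simp: somos4_branch_def)
  define Z' G2' G3' where "Z' = deriv Z J0" and "G2' = deriv (somos4_g2 \<alpha> \<beta>) J0" and "G3' = deriv (somos4_g3 \<alpha> \<beta>) J0"
  have dZ: "(Z has_field_derivative Z') (at J0)"
    using Z(1) by (simp add: Z'_def DERIV_deriv_iff_field_differentiable analytic_on_imp_differentiable_at)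
  have dG: "(somos4_g2 \<alpha> \<beta> has_field_derivative G2') (at J0)" "(somos4_g3 \<alpha> \<beta> has_field_derivative G3') (at J0)"
    unfolding G2'_def G3'_def by (intro holomorphic_derivI[of _ UNIV] holomorphic_somos4_params; simp)+
  define K where "K = (\<lambda>w n. sol_deriv A B w z g2 g3 n G2' G3' Z')"
  have dJ: "((\<lambda>J. somos4_sol A B w (Z J) (somos4_g2 \<alpha> \<beta> J) (somos4_g3 \<alpha> \<beta> J) n) has_field_derivative K w n) (at J0)" for w n
    using DERIV_somos4_sol[of "somos4_g2 \<alpha> \<beta>" J0 "somos4_g3 \<alpha> \<beta>" Z, OF _ dG dZ] s
    unfolding K_def Z(2) g by simp
  have dz: "((\<lambda>t. somos4_sol A B w t g2 g3 n) has_field_derivative sol_deriv A B w z g2 g3 n 0 0 1) (at z)" for w n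
    using DERIV_somos4_sol[of "\<lambda>_. g2" z "\<lambda>_. g3" "\<lambda>t. t" 0 0 1] s by simp
  have d2: "((\<lambda>t. somos4_sol A B w z t g3 n) has_field_derivative sol_deriv A B w z g2 g3 n 1 0 0) (at g2)" for w n
    using DERIV_somos4_sol[of "\<lambda>t. t" g2 "\<lambda>_. g3" "\<lambda>_. z" 1 0 0] s by simp
  have d3: "((\<lambda>t. somos4_sol A B w z g2 t n) has_field_derivative sol_deriv A B w z g2 g3 n 0 1 0) (at g3)" for w n
    using DERIV_somos4_sol[of "\<lambda>_. g2" g3 "\<lambda>t. t" "\<lambda>_. z" 0 1 0] s by simp
  have isCont_K: "isCont (\<lambda>w. K w n) z0" for n
    unfolding K_def by (rule isCont_sol_deriv)
  have iv: "shadow_iv \<alpha> \<beta> J0 A B z0 Z n = K z0 n" for n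
    unfolding shadow_iv_def Let_def Z(2) g[symmetric]
  proof (rule continuous_extension_eq[OF _ eventually_somos4_sol_nonzero[OF s AB] isCont_K])
    fix w assume "somos4_sol A B w z g2 g3 n \<noteq> 0"
    thus "somos4_sol A B w z g2 g3 n *
        dlog (\<lambda>J. somos4_sol A B w (Z J) (somos4_g2 \<alpha> \<beta> J) (somos4_g3 \<alpha> \<beta> J) n) J0 = K w n"
      unfolding dlog_def DERIV_imp_deriv[OF dJ] by (simp add: Z(2) flip: g)
  qed
  have chain: "shadow_iv_chain \<alpha> \<beta> J0 A B z0 Z n = K z0 n" for n
    unfolding shadow_iv_chain_def Let_def Z(2) g[symmetric] Z'_def[symmetric] G2'_def[symmetric] G3'_def[symmetric]
  proof (rule continuous_extension_eq[OF _ eventually_somos4_sol_nonzero[OF s AB] isCont_K])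
    fix w assume nz: "somos4_sol A B w z g2 g3 n \<noteq> 0"
    show "somos4_sol A B w z g2 g3 n *
        (Z' * dlog (\<lambda>t. somos4_sol A B w t g2 g3 n) z + G2' * dlog (\<lambda>t. somos4_sol A B w z t g3 n) g2
         + G3' * dlog (\<lambda>t. somos4_sol A B w z g2 t n) g3) = K w n"
      unfolding dlog_def DERIV_imp_deriv[OF dz] DERIV_imp_deriv[OF d2] DERIV_imp_deriv[OF d3] K_def
      \<comment> \<open>The fourth occurrence is the full derivative along the branch; the first
        three, in the coordinate directions, must remain as they are.\<close>
      by (subst (4) sol_deriv_linear) (use nz in \<open>simp add: field_simps\<close>)
  qed
  show "(\<lambda>J. somos4_sol A B z0 (Z J) (somos4_g2 \<alpha> \<beta> J) (somos4_g3 \<alpha> \<beta> J) n) field_differentiable at J0"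
    "(\<lambda>t. somos4_sol A B z0 t g2 g3 n) field_differentiable at z"
    "(\<lambda>t. somos4_sol A B z0 z t g3 n) field_differentiable at g2"
    "(\<lambda>t. somos4_sol A B z0 z g2 t n) field_differentiable at g3" for n
    using dJ dz d2 d3 unfolding field_differentiable_def by blast+
  show "shadow_iv \<alpha> \<beta> J0 A B z0 Z n = shadow_iv_chain \<alpha> \<beta> J0 A B z0 Z n" for n
    by (simp add: iv chain)
  have Y4: "shadow_iv \<alpha> \<beta> J0 A B z0 Z = K z0" using iv by (simp add: fun_eq_iff)
  define X where "X = (\<lambda>J. somos4_sol A B z0 (Z J) (somos4_g2 \<alpha> \<beta> J) (somos4_g3 \<alpha> \<beta> J))"
  have X0: "X J0 = x" by (simp add: X_def x Z(2) g)
  have dX: "((\<lambda>J. X J n) has_field_derivative K z0 n) (at J0)" for n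
    unfolding X_def by (rule dJ)
  have "\<forall>\<^sub>F J in nhds J0. somos4 \<alpha> \<beta> (X J)"
    using Z(3) unfolding X_def by eventually_elim (rule somos4_sol_somos4[OF _ \<alpha> AB(2)])
  from somos4_shadow_derivative[OF this dX]
  show "somos4_shadow \<alpha> \<beta> x (shadow_iv \<alpha> \<beta> J0 A B z0 Z)"
    by (simp add: X0 Y4)
  show "lin_indep4 x (\<lambda>n. of_int n * x n) (shadow_iii A B z0 z g2 g3) (shadow_iv \<alpha> \<beta> J0 A B z0 Z)"
    unfolding lin_indep4_def Y3 Y4
  proof (intro allI impI)
    fix c1 c2 c3 c4
    let ?W = "sol_deriv_z0 A B z0 z g2 g3"
    assume zero: "\<forall>n\<ge>0. c1 * x n + c2 * (of_int n * x n) + c3 * ?W n + c4 * K z0 n = 0"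
    have rel: "c3 * ?W n + c4 * K z0 n = (- c1 + of_int n * (- c2)) * x n" if "n \<ge> 0" for n
    proof -
      have "c3 * ?W n + c4 * K z0 n = (c1 * x n + c2 * (of_int n * x n) + c3 * ?W n + c4 * K z0 n)
          + (- c1 + of_int n * (- c2)) * x n"
        by (simp add: algebra_simps)
      thus ?thesis using zero that by simp
    qed
    \<comment> \<open>Moving z_0 keeps J fixed, so the linearised integral kills (iii). Along the
      branch J has derivative 1, so it maps (iv) to the non-zero product x_0 x_1 x_2 x_3. Evaluating
      it on the combination therefore isolates \<open>c4\<close>.\<close>
    have "integral_lin \<alpha> \<beta> J0 (somos4_sol A B z0 z g2 g3) ?W = 0 * (x 0 * x 1 * x 2 * x 3)"
      unfolding x
    proof (rule first_integral_derivative[where j = "\<lambda>_. J0" and X = "\<lambda>w. somos4_sol A B w z g2 g3"])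
      show "\<forall>\<^sub>F w in nhds z0. \<exists>z' w'. somos4_param \<alpha> \<beta> J0 z' \<and>
          somos4_sol A B w z g2 g3 = somos4_sol A B w' z' (somos4_g2 \<alpha> \<beta> J0) (somos4_g3 \<alpha> \<beta> J0)"
        unfolding g using par by (intro always_eventually) blast
    qed (use assms(5-8) x \<alpha> AB in \<open>auto intro: DERIV_somos4_sol_z0\<close>)
    moreover have "integral_lin \<alpha> \<beta> J0 (X J0) (K z0) = 1 * (X J0 0 * X J0 1 * X J0 2 * X J0 3)"
    proof (rule first_integral_derivative[where j = "\<lambda>J. J" and X = X])
      show "\<forall>\<^sub>F J in nhds J0. \<exists>z w. somos4_param \<alpha> \<beta> J z \<and>
          X J = somos4_sol A B w z (somos4_g2 \<alpha> \<beta> J) (somos4_g3 \<alpha> \<beta> J)"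
        using Z(3) by eventually_elim (auto simp: X_def)
    qed (use assms(5-8) X0 \<alpha> AB dX in auto)
    ultimately have "integral_lin \<alpha> \<beta> J0 x (\<lambda>n. c3 * ?W n + c4 * K z0 n) = c4 * (x 0 * x 1 * x 2 * x 3)"
      unfolding integral_lin_linear by (simp add: X0 flip: x)
    moreover have "integral_lin \<alpha> \<beta> J0 x (\<lambda>n. c3 * ?W n + c4 * K z0 n) = 0"
    \<comment> \<open>On n = 0, ..., 3 the assumed relation turns the combination into an affine
      multiple of x, which the linearised integral annihilates by homogeneity.\<close>
    proof (rule integral_lin_affine[where a = "- c1" and b = "- c2"])
      show "(x 0)^2 * (x 3)^2 + \<alpha> * ((x 1) ^ 3 * x 3 + x 0 * (x 2) ^ 3) + \<beta> * (x 1)^2 * (x 2)^2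
          = J0 * (x 0 * x 1 * x 2 * x 3)"
        using somos4_sol_first_integral[OF par \<alpha> AB(2), of A z0] assms(5-8) by (simp add: x g)
    qed (use rel[of 0] rel[of 1] rel[of 2] rel[of 3] in simp_all)
    ultimately have c4: "c4 = 0" using assms(5-8) by simp
    let ?S = "wsigma g2 g3" and ?u = "\<lambda>n. z0 + of_int n * z"
    have S_nz: "?S (?u n) \<noteq> 0" if "x n \<noteq> 0" for n
      using that by (simp add: x somos4_sol_eq_0_iff[OF s AB])
    have aff: "c3 * deriv ?S (?u n) = (- c1 + of_int n * (- c2)) * ?S (?u n)" if "n \<ge> 0" for n
    proof -
      define k where "k = A * B powi n / ?S z powi (n^2)"
      have "k \<noteq> 0" using s AB by (simp add: k_def)
      moreover have "k * (c3 * deriv ?S (?u n)) = k * ((- c1 + of_int n * (- c2)) * ?S (?u n))"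
        using rel[OF that] c4
        by (simp add: k_def x somos4_sol_def sol_deriv_z0_def weierstrass_sigma_eq mult_ac)
      ultimately show ?thesis by (metis mult_left_cancel)
    qed
    have c3: "c3 = 0"
    proof (rule ccontr)
      assume "c3 \<noteq> 0"
      \<comment> \<open>The condition m \<ge> 1 keeps the left neighbour m - 1 within the range of
        \<open>aff\<close>.\<close>
      have dbl: "?S (2 * ?u m) = 0" if m: "m \<ge> 1" "x m \<noteq> 0" for m
      proof (rule sigma_double_eq_0[OF S_nz[OF m(2)] s \<open>c3 \<noteq> 0\<close>])
        have "?u m - z = ?u (m - 1)" "?u m + z = ?u (m + 1)" by (simp_all add: algebra_simps)
        thus "c3 * deriv ?S (?u m - z) = ((- c1 + of_int m * (- c2)) - (- c2)) * ?S (?u m - z)"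
          "c3 * deriv ?S (?u m + z) = ((- c1 + of_int m * (- c2)) + (- c2)) * ?S (?u m + z)"
          using aff[of "m - 1"] aff[of "m + 1"] m(1) by (simp_all add: algebra_simps)
      qed (use aff m in auto)
      \<comment> \<open>The difference is 2z, while \<sigma>(2z) \<noteq> 0 by \<alpha> \<noteq>
        0.\<close>
      have "?S (2 * ?u 2 - 2 * ?u 1) = 0"
        using dbl[of 1] dbl[of 2] assms(6,7) by (intro sigma_zeros_diff) auto
      thus False using par'(2) by (simp add: algebra_simps)
    qed
    have "c1 = 0" using rel[of 0] c3 c4 assms(5) by simp
    moreover have "c2 = 0" using rel[of 1] c3 c4 \<open>c1 = 0\<close> assms(6) by simp
    ultimately show "c1 = 0 \<and> c2 = 0 \<and> c3 = 0 \<and> c4 = 0" using c3 c4 by simp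
  qed
qed

end
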